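(* Let $f:\mathbb{R}\to\mathbb{R}$ be such that $f\in\mathcal{H}_H$ for every $H\in(\frac12,1)$. Assume that the limit $$\sigma_f^2=\lim_{H\to\frac12}\|f\|^2_{\mathcal{H}_H}=\lim_{H\to\frac12} H(2H-1)\int_{\mathbb{R}}\int_{\mathbb{R}} f(u)f(v)|u-v|^{2H-2}\,du\,dv$$ exists and is finite, and that $$(2H-1)^2\int_{\mathbb{R}^4} f(u_1)f(u_2)f(u_3)f(u_4)\,|u_1-u_2|^{H-1}|u_2-u_3|^{H-1}|u_3-u_4|^{H-1}|u_4-u_1|^{H-1}\,du_1du_2du_3du_4\longrightarrow 0\quad\text{as } H\to\tfrac12 .$$ Then, as $H\to\frac12$ (with $H>\frac12$), the Wiener-Rosenblatt integral $\int_{\mathbb{R}} f(u)\,dZ^H(u)$ converges in distribution to $N(0,\sigma_f^2)$.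
   Context: Let $(B(y))_{y\in\mathbb{R}}$ be a Wiener process on a probability space $(\Omega,\mathcal{F},P)$ and let $I_2$ denote the multiple (Wiener-Itô) stochastic integral of order two with respect to $B$, normalized so that $\mathbf{E}[I_2(h)^2]=2\|h\|_{L^2(\mathbb{R}^2)}^2$ for symmetric $h\in L^2(\mathbb{R}^2)$. Write $x_+=\max(x,0)$. For $H\in(\frac12,1)$ let $c(H,2)>0$ be given by $$c(H,2)^2=\frac{H(2H-1)}{2\,\beta\left(\frac H2,1-H\right)^2},\qquad \beta(p,q)=\int_0^1 z^{p-1}(1-z)^{q-1}dz .$$ The Rosenblatt process with self-similarity index $H$ is $Z^H(t)=I_2(L^H_t)$, $t\ge0$, where $L^H_t(y_1,y_2)=c(H,2)\int_0^t (u-y_1)_+^{\frac H2-1}(u-y_2)_+^{\frac H2-1}du$. Let $\mathcal{H}_H$ be the set of (measurable) functions $f:\mathbb{R}\to\mathbb{R}$ with $\|f\|^2_{\mathcal{H}_H}:=H(2H-1)\int_{\mathbb{R}}\int_{\mathbb{R}} f(u)f(v)|u-v|^{2H-2}\,du\,dv<\infty$, the double integral being a Lebesgue integral, i.e. absolutely convergent. For $f\in\mathcal{H}_H$ the Wiener-Rosenblatt integral is $$\int_{\mathbb{R}} f(u)\,dZ^H(u):=I_2(J_Hf),\qquad (J_Hf)(y_1,y_2)=c(H,2)\int_{\mathbb{R}} f(u)(u-y_1)_+^{\frac H2-1}(u-y_2)_+^{\frac H2-1}du .$$ $N(0,0)$ denotes the Dirac mass at $0$. *)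

theory Defs
  imports "HOL-Probability.Probability"
begin

locale wiener_process = prob_space M
  for M :: "'a measure" +
  fixes B :: "real \<Rightarrow> 'a \<Rightarrow> real"
  assumes random_variable_B: "random_variable borel (B t)"
    and B_zero: "AE \<omega> in M. B 0 \<omega> = 0"
    and gaussian_increments:
      "s < t \<Longrightarrow> distributed M lborel (\<lambda>\<omega>. B t \<omega> - B s \<omega>) (normal_density 0 (sqrt (t - s)))"
    and independent_increments:
      "(\<And>i. i < n \<Longrightarrow> \<tau> i < \<tau> (Suc i)) \<Longrightarrow>
        indep_vars (\<lambda>_. borel) (\<lambda>(i::nat) \<omega>. B (\<tau> (Suc i)) \<omega> - B (\<tau> i) \<omega>) {..<n}"
    and continuous_paths: "AE \<omega> in M. continuous_on UNIV (\<lambda>t. B t \<omega>)"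

text \<open>
  The Wiener-Ito integral of order two is first given on step functions over rectangles \<open>]\<tau> i, \<tau> (i+1)] \<times> ]\<tau> j, \<tau> (j+1)]\<close>
  with \<open>i \<noteq> j\<close>, i.e. vanishing on the diagonal blocks, and is then extended by
  \<open>L\<^sup>2\<close>-continuity. The coefficients need not be symmetric; for symmetric \<open>h\<close> the second moment
  of the integral is twice the squared \<open>L\<^sup>2\<close>-norm of \<open>h\<close>.
\<close>

definition off_diag_step ::
    "nat \<Rightarrow> (nat \<Rightarrow> real) \<Rightarrow> (nat \<Rightarrow> nat \<Rightarrow> real) \<Rightarrow> real \<times> real \<Rightarrow> real" where
  "off_diag_step n \<tau> a = (\<lambda>(x, y). \<Sum>i<n. \<Sum>j\<in>{..<n} - {i}.
     a i j * indicator {\<tau> i<..\<tau> (Suc i)} x * indicator {\<tau> j<..\<tau> (Suc j)} y)"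

definition off_diag_step_integral ::
    "(real \<Rightarrow> 'a \<Rightarrow> real) \<Rightarrow> nat \<Rightarrow> (nat \<Rightarrow> real) \<Rightarrow> (nat \<Rightarrow> nat \<Rightarrow> real) \<Rightarrow> 'a \<Rightarrow> real" where
  "off_diag_step_integral B n \<tau> a \<omega> = (\<Sum>i<n. \<Sum>j\<in>{..<n} - {i}.
     a i j * (B (\<tau> (Suc i)) \<omega> - B (\<tau> i) \<omega>) * (B (\<tau> (Suc j)) \<omega> - B (\<tau> j) \<omega>))"

definition L2_converges :: "'b measure \<Rightarrow> (nat \<Rightarrow> 'b \<Rightarrow> real) \<Rightarrow> ('b \<Rightarrow> real) \<Rightarrow> bool" where
  "L2_converges N g h \<longleftrightarrow>
     (\<lambda>k. \<integral>\<^sup>+ z. ennreal ((g k z - h z)\<^sup>2) \<partial>N) \<longlonglongrightarrow> 0"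

definition is_wiener_ito2 ::
    "'a measure \<Rightarrow> (real \<Rightarrow> 'a \<Rightarrow> real) \<Rightarrow> (real \<times> real \<Rightarrow> real) \<Rightarrow> ('a \<Rightarrow> real) \<Rightarrow> bool" where
  "is_wiener_ito2 M B h X \<longleftrightarrow> X \<in> borel_measurable M \<and>
     (\<exists>n \<tau> a. (\<forall>k. \<forall>i < n k. \<tau> k i < \<tau> k (Suc i)) \<and>
        L2_converges lebesgue (\<lambda>k. off_diag_step (n k) (\<tau> k) (a k)) h \<and>
        L2_converges M (\<lambda>k. off_diag_step_integral B (n k) (\<tau> k) (a k)) X)"

text \<open>
  For square-integrable \<open>h\<close> the random variable \<open>X\<close> above exists and is unique up to almost sure
  equality (off-diagonal step functions are dense and the integral is \<open>L\<^sup>2\<close>-bounded on them), so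
  the choice below only selects a version. It is unspecified for other \<open>h\<close>.
\<close>

definition wiener_ito2 ::
    "'a measure \<Rightarrow> (real \<Rightarrow> 'a \<Rightarrow> real) \<Rightarrow> (real \<times> real \<Rightarrow> real) \<Rightarrow> 'a \<Rightarrow> real" where
  "wiener_ito2 M B h = (SOME X. is_wiener_ito2 M B h X)"

text \<open>Since \<^term>\<open>0 powr a = (0::real)\<close>, \<open>(max x 0) powr a\<close> vanishes for \<open>x \<le> 0\<close>, also for \<open>a < 0\<close>.\<close>

definition rosenblatt_const :: "real \<Rightarrow> real" where
  "rosenblatt_const H = sqrt (H * (2 * H - 1) / (2 * (Beta (H / 2) (1 - H))\<^sup>2))"

definition rosenblatt_space :: "real \<Rightarrow> (real \<Rightarrow> real) set" where
  "rosenblatt_space H = {f. f \<in> borel_measurable lebesgue \<and>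
     integrable lebesgue (\<lambda>(u, v). f u * f v * \<bar>u - v\<bar> powr (2 * H - 2))}"

definition rosenblatt_sqnorm :: "real \<Rightarrow> (real \<Rightarrow> real) \<Rightarrow> real" where
  "rosenblatt_sqnorm H f =
     H * (2 * H - 1) * (\<integral>(u, v). f u * f v * \<bar>u - v\<bar> powr (2 * H - 2) \<partial>lebesgue)"

definition rosenblatt_kernel :: "real \<Rightarrow> (real \<Rightarrow> real) \<Rightarrow> real \<times> real \<Rightarrow> real" where
  "rosenblatt_kernel H f = (\<lambda>(y1, y2). rosenblatt_const H *
     (\<integral>u. f u * (max (u - y1) 0) powr (H / 2 - 1) * (max (u - y2) 0) powr (H / 2 - 1) \<partial>lebesgue))"

definition wiener_rosenblatt_integral ::
    "'a measure \<Rightarrow> (real \<Rightarrow> 'a \<Rightarrow> real) \<Rightarrow> real \<Rightarrow> (real \<Rightarrow> real) \<Rightarrow> 'a \<Rightarrow> real" where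
  "wiener_rosenblatt_integral M B H f = wiener_ito2 M B (rosenblatt_kernel H f)"

text \<open>The second argument of \<open>normal_law\<close> is the variance.\<close>

definition normal_law :: "real \<Rightarrow> real \<Rightarrow> real measure" where
  "normal_law m v =
     (if v = 0 then return borel m else density lborel (normal_density m (sqrt v)))"

definition weak_conv_along :: "'i filter \<Rightarrow> ('i \<Rightarrow> real measure) \<Rightarrow> real measure \<Rightarrow> bool" where
  "weak_conv_along F \<mu> \<nu> \<longleftrightarrow>
     (\<forall>x. isCont (cdf \<nu>) x \<longrightarrow> ((\<lambda>i. cdf (\<mu> i) x) \<longlongrightarrow> cdf \<nu> x) F)"

lemma weak_conv_along_sequentially: "weak_conv_along sequentially \<mu> \<nu> \<longleftrightarrow> weak_conv_m \<mu> \<nu>"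
  by (simp add: weak_conv_along_def weak_conv_m_def weak_conv_def)

end

theory Submission
  imports Defs
begin

text \<open>
  The Wiener-Rosenblatt integral is an \<open>L\<^sup>2\<close>-limit of Gaussian quadratic forms \<open>G = \<Sum>\<^sub>i\<^sub>j a\<^sub>i\<^sub>j \<xi>\<^sub>i \<xi>\<^sub>j\<close>
  with symmetric coefficients and zero diagonal, where \<open>\<xi>\<^sub>i\<close> are Wiener increments of variance \<open>v\<^sub>i\<close>.
  Gaussian integration by parts in each \<open>\<xi>\<^sub>i\<close> shows that the characteristic function \<open>\<phi>\<close> of \<open>G\<close> satisfies
  \<open>\<phi>'(t) = - 2 t E[S e\<^sup>i\<^sup>t\<^sup>G]\<close> with \<open>S = \<Sum>\<^sub>i v\<^sub>i (a \<xi>)\<^sub>i\<^sup>2\<close>. The mean of \<open>S\<close> is half the variance of \<open>G\<close>, and the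
  variance of \<open>S\<close> is at most a multiple of the squared \<open>L\<^sup>2\<close>-norm of the contraction of the kernel with itself.
  Hence \<open>\<phi>\<close> differs from the Gaussian characteristic function of the same variance by at most \<open>C t\<^sup>2\<close> times
  the norm of the contraction, and this bound survives the passage to the limit.
  For the Rosenblatt kernel, the identity \<open>\<integral> (u - y)\<^sub>+\<^sup>a (v - y)\<^sub>+\<^sup>a dy = \<beta>(H/2, 1 - H) \<bar>u - v\<bar>\<^sup>b\<close> with \<open>a = H/2 - 1\<close>,
  \<open>b = H - 1\<close> turns the variance and the squared norm of the contraction into the two quantities in the
  hypotheses, and Levy's continuity theorem applies.
\<close>

section \<open>Characteristic functions and Gaussian integration by parts\<close>

text \<open>The double integral is a choice among the random variables specified by
  \<open>is_wiener_ito2\<close>, whose approximants live on arbitrary partitions and may have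
  non-symmetric coefficients. The bound on the characteristic function is therefore proved for every
  such random variable, after symmetrising the approximants. Existence, on which the choice rests,
  is shown on dyadic grids: since they are nested, two approximants can be compared on one
  partition.

  Constants: since E[I_2(h)^2] = 2 ||h||^2, the limiting exponent is -||h||^2 t^2. The square of
  \<open>rosenblatt_const\<close> times the squared Beta value is H (2 H - 1) / 2, so for the
  Rosenblatt kernel ||h||^2 is half of \<open>rosenblatt_sqnorm\<close>, and the squared norm of the
  contraction is (H / 2)^2 times the second quantity in the hypotheses.

  Absolute convergence of the fourfold integral, on which Fubini rests, is derived from that of the
  double integral. As f is only Lebesgue measurable, a Borel representative takes its place before
  product measures are used.\<close>

lemma abs_mult_le_sum_squares: "\<bar>x * y\<bar> \<le> x\<^sup>2 + y\<^sup>2" for x y :: real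
proof -
  have "2 * (\<bar>x\<bar> * \<bar>y\<bar>) \<le> \<bar>x\<bar>\<^sup>2 + \<bar>y\<bar>\<^sup>2"
    using sum_squares_bound[of "\<bar>x\<bar>" "\<bar>y\<bar>"] by simp
  then have "\<bar>x\<bar> * \<bar>y\<bar> \<le> x\<^sup>2 + y\<^sup>2"
    using mult_nonneg_nonneg[of "\<bar>x\<bar>" "\<bar>y\<bar>"] by (simp del: mult_nonneg_nonneg zero_le_mult_iff)
  then show ?thesis
    by (simp add: abs_mult)
qed

lemma power2_add_le: "(x + y)\<^sup>2 \<le> 2 * x\<^sup>2 + 2 * y\<^sup>2" for x y :: real
  using sum_squares_bound[of x y] by (simp add: power2_sum)

lemma integrable_mult_of_squares:
  fixes X Y :: "'a \<Rightarrow> real"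
  assumes [measurable]: "X \<in> borel_measurable M" "Y \<in> borel_measurable M"
    and "integrable M (\<lambda>\<omega>. (X \<omega>)\<^sup>2)" "integrable M (\<lambda>\<omega>. (Y \<omega>)\<^sup>2)"
  shows "integrable M (\<lambda>\<omega>. X \<omega> * Y \<omega>)"
  by (rule Bochner_Integration.integrable_bound[OF Bochner_Integration.integrable_add[OF assms(3,4)]])
    (auto intro!: AE_I2 order_trans[OF abs_mult_le_sum_squares])

lemma (in prob_space) integrable_of_square:
  fixes X :: "'a \<Rightarrow> real"
  assumes "X \<in> borel_measurable M" "integrable M (\<lambda>\<omega>. (X \<omega>)\<^sup>2)"
  shows "integrable M X"
  using integrable_mult_of_squares[of X M "\<lambda>_. 1"] assms by simp

text \<open>Nonnegativity of the variance of |X| is the Cauchy-Schwarz inequality against the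
  constant 1.\<close>

lemma (in prob_space) expectation_abs_le_sqrt:
  fixes X :: "'a \<Rightarrow> real"
  assumes [measurable]: "X \<in> borel_measurable M" and "integrable M (\<lambda>\<omega>. (X \<omega>)\<^sup>2)"
  shows "expectation (\<lambda>\<omega>. \<bar>X \<omega>\<bar>) \<le> sqrt (expectation (\<lambda>\<omega>. (X \<omega>)\<^sup>2))"
proof (rule real_le_rsqrt)
  have "0 \<le> variance (\<lambda>\<omega>. \<bar>X \<omega>\<bar>)"
    by (rule variance_positive)
  also have "variance (\<lambda>\<omega>. \<bar>X \<omega>\<bar>) = expectation (\<lambda>\<omega>. \<bar>X \<omega>\<bar>\<^sup>2) - (expectation (\<lambda>\<omega>. \<bar>X \<omega>\<bar>))\<^sup>2"
    using integrable_of_square[of X] assms by (intro variance_eq) auto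
  finally show "(expectation (\<lambda>\<omega>. \<bar>X \<omega>\<bar>))\<^sup>2 \<le> expectation (\<lambda>\<omega>. (X \<omega>)\<^sup>2)"
    by simp
qed

lemma (in prob_space) integrable_mult_iexp:
  assumes "integrable M X" and [measurable]: "Y \<in> borel_measurable M"
  shows "integrable M (\<lambda>\<omega>. complex_of_real (X \<omega>) * iexp (Y \<omega>))"
proof (rule Bochner_Integration.integrable_bound[OF assms(1)])
  have [measurable]: "X \<in> borel_measurable M"
    using assms(1) by simp
  show "(\<lambda>\<omega>. complex_of_real (X \<omega>) * iexp (Y \<omega>)) \<in> borel_measurable M"
    by measurable
qed (simp add: norm_mult)

text \<open>The second-order Taylor bound for exp(i x) is integrated: the error of the linear
  approximation between t and s is at most (s - t)^2 E[G^2], so the error of the difference quotient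
  is at most |s - t| E[G^2].\<close>

lemma (in prob_space) has_vector_derivative_expectation_iexp:
  fixes G :: "'a \<Rightarrow> real"
  assumes [measurable]: "G \<in> borel_measurable M" and int2: "integrable M (\<lambda>\<omega>. (G \<omega>)\<^sup>2)"
  shows "((\<lambda>t. expectation (\<lambda>\<omega>. iexp (t * G \<omega>))) has_vector_derivative
           \<i> * expectation (\<lambda>\<omega>. complex_of_real (G \<omega>) * iexp (t * G \<omega>))) (at t)"
proof -
  define C where "C = expectation (\<lambda>\<omega>. (G \<omega>)\<^sup>2)"
  define D where "D = \<i> * expectation (\<lambda>\<omega>. complex_of_real (G \<omega>) * iexp (t * G \<omega>))"
  have int1: "integrable M G"
    by (rule integrable_of_square) fact+
  have i0: "integrable M (\<lambda>\<omega>. iexp (s * G \<omega>))" for s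
    by (rule integrable_iexp) auto
  have i1: "integrable M (\<lambda>\<omega>. complex_of_real (G \<omega>) * iexp (t * G \<omega>))"
    by (rule integrable_mult_iexp[OF int1]) simp
  have lin: "expectation (\<lambda>\<omega>. f \<omega> - g \<omega> - k * h \<omega>) = expectation f - expectation g - k * expectation h"
    if "integrable M f" "integrable M g" "integrable M h" for f g h :: "'a \<Rightarrow> complex" and k
    using that by simp
  have bound: "cmod (expectation (\<lambda>\<omega>. iexp (s * G \<omega>)) - expectation (\<lambda>\<omega>. iexp (t * G \<omega>)) - (s - t) *\<^sub>R D)
      \<le> (s - t)\<^sup>2 * C" for s
  proof -
    have "expectation (\<lambda>\<omega>. iexp (s * G \<omega>)) - expectation (\<lambda>\<omega>. iexp (t * G \<omega>)) - (s - t) *\<^sub>R D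
      = expectation (\<lambda>\<omega>. iexp (s * G \<omega>) - iexp (t * G \<omega>)
          - (complex_of_real (s - t) * \<i>) * (complex_of_real (G \<omega>) * iexp (t * G \<omega>)))"
      by (subst lin[OF i0 i0 i1]) (simp only: D_def scaleR_conv_of_real mult.assoc)
    also have "cmod \<dots> \<le> expectation (\<lambda>\<omega>. (s - t)\<^sup>2 * (G \<omega>)\<^sup>2)"
    proof (rule order_trans[OF integral_norm_bound], rule integral_mono)
      show "integrable M (\<lambda>\<omega>. cmod (iexp (s * G \<omega>) - iexp (t * G \<omega>)
          - (complex_of_real (s - t) * \<i>) * (complex_of_real (G \<omega>) * iexp (t * G \<omega>))))"
        by (intro integrable_norm Bochner_Integration.integrable_diff integrable_mult_right i0 i1)
      show "integrable M (\<lambda>\<omega>. (s - t)\<^sup>2 * (G \<omega>)\<^sup>2)"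
        using int2 by simp
      fix \<omega>
      define x where "x = (s - t) * G \<omega>"
      have "s * G \<omega> = t * G \<omega> + x"
        by (simp add: x_def left_diff_distrib)
      then have "\<i> * complex_of_real (s * G \<omega>) = \<i> * complex_of_real (t * G \<omega>) + \<i> * complex_of_real x"
        by (simp only: of_real_add distrib_left)
      then have 1: "iexp (s * G \<omega>) = iexp (t * G \<omega>) * iexp x"
        by (simp only: exp_add)
      have 2: "complex_of_real x = complex_of_real (s - t) * complex_of_real (G \<omega>)"
        by (simp add: x_def)
      have 3: "E * F - E - (d * \<i>) * (g * E) = E * (F - 1 - \<i> * (d * g))" for E F d g :: complex
        by algebra
      have "iexp (s * G \<omega>) - iexp (t * G \<omega>)
          - (complex_of_real (s - t) * \<i>) * (complex_of_real (G \<omega>) * iexp (t * G \<omega>))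
        = iexp (t * G \<omega>) * (iexp x - 1 - \<i> * x)"
        unfolding 1 2 3 ..
      also have "cmod \<dots> = cmod (iexp x - 1 - \<i> * x)"
        by (simp add: norm_mult)
      also have "\<dots> \<le> x\<^sup>2"
      proof -
        have "2 * cmod (iexp x - 1 - \<i> * x) \<le> x\<^sup>2"
          using iexp_approx1[of x 1] by (simp add: diff_diff_eq eval_nat_numeral)
        moreover have "0 \<le> cmod (iexp x - 1 - \<i> * x)"
          by (rule norm_ge_zero)
        ultimately show ?thesis
          by linarith
      qed
      finally show "cmod (iexp (s * G \<omega>) - iexp (t * G \<omega>)
          - (complex_of_real (s - t) * \<i>) * (complex_of_real (G \<omega>) * iexp (t * G \<omega>)))
        \<le> (s - t)\<^sup>2 * (G \<omega>)\<^sup>2"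
        by (simp add: x_def power_mult_distrib)
    qed
    finally show ?thesis
      by (simp add: C_def)
  qed
  have "C \<ge> 0"
    by (simp add: C_def)
  show ?thesis
    unfolding has_vector_derivative_def D_def[symmetric] has_derivative_within
  proof (intro conjI bounded_linear_scaleR_left)
    show "((\<lambda>y. (1 / norm (y - t)) *\<^sub>R (expectation (\<lambda>\<omega>. iexp (y * G \<omega>))
       - (expectation (\<lambda>\<omega>. iexp (t * G \<omega>)) + (y - t) *\<^sub>R D))) \<longlongrightarrow> 0) (at t)"
    proof (rule Lim_null_comparison)
      show "\<forall>\<^sub>F y in at t. norm ((1 / norm (y - t)) *\<^sub>R (expectation (\<lambda>\<omega>. iexp (y * G \<omega>))
         - (expectation (\<lambda>\<omega>. iexp (t * G \<omega>)) + (y - t) *\<^sub>R D))) \<le> \<bar>y - t\<bar> * C"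
      proof (rule eventually_at_topological[THEN iffD2], intro exI[of _ UNIV] conjI ballI impI)
        fix y assume "y \<noteq> t"
        have "norm ((1 / norm (y - t)) *\<^sub>R (expectation (\<lambda>\<omega>. iexp (y * G \<omega>))
           - (expectation (\<lambda>\<omega>. iexp (t * G \<omega>)) + (y - t) *\<^sub>R D))) \<le> (1 / \<bar>y - t\<bar>) * ((y - t)\<^sup>2 * C)"
          using mult_left_mono[OF bound[of y], of "1 / \<bar>y - t\<bar>"] by (simp add: diff_diff_eq)
        also have "\<dots> = \<bar>y - t\<bar> * C"
          unfolding power2_abs[symmetric, of "y - t"]
          using \<open>y \<noteq> t\<close> by (simp add: power2_eq_square del: abs_mult_self_eq)
        finally show "norm ((1 / norm (y - t)) *\<^sub>R (expectation (\<lambda>\<omega>. iexp (y * G \<omega>))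
           - (expectation (\<lambda>\<omega>. iexp (t * G \<omega>)) + (y - t) *\<^sub>R D))) \<le> \<bar>y - t\<bar> * C" .
      qed auto
      have "((\<lambda>y. \<bar>y - t\<bar> * C) \<longlongrightarrow> \<bar>t - t\<bar> * C) (at t)"
        by (intro tendsto_intros)
      then show "((\<lambda>y. \<bar>y - t\<bar> * C) \<longlongrightarrow> 0) (at t)"
        by simp
    qed
  qed
qed

lemma (in prob_space) expectation_iexp_normal:
  assumes X: "distributed M lborel X (normal_density 0 (sqrt v))" and "v > 0"
  shows "expectation (\<lambda>\<omega>. iexp (t * X \<omega>)) = exp (- (v * t\<^sup>2 / 2))"
proof -
  have [measurable]: "X \<in> borel_measurable M"
    using distributed_measurable[OF X] by simp
  define Y where "Y = (\<lambda>\<omega>. (X \<omega> - 0) / sqrt v)"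
  have "distributed M lborel Y std_normal_density"
    using normal_standard_normal_convert[of "sqrt v" X 0] X \<open>v > 0\<close> by (simp add: Y_def)
  then have eq: "distr M lborel Y = std_normal_distribution"
    by (rule distributed_distr_eq_density)
  have [measurable]: "Y \<in> borel_measurable M"
    by (simp add: Y_def)
  have "expectation (\<lambda>\<omega>. iexp (t * X \<omega>)) = expectation (\<lambda>\<omega>. iexp ((t * sqrt v) * Y \<omega>))"
    using \<open>v > 0\<close> by (simp add: Y_def)
  also have "\<dots> = char (distr M lborel Y) (t * sqrt v)"
    unfolding char_def by (subst integral_distr) auto
  also have "\<dots> = exp (- (v * t\<^sup>2 / 2))"
    using \<open>v > 0\<close> unfolding eq char_std_normal_distribution
    by (simp add: power_mult_distrib mult.commute flip: exp_of_real)
  finally show ?thesis .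
qed

lemma (in prob_space) normal_moments:
  assumes X: "distributed M lborel X (normal_density 0 (sqrt v))" and "v > 0"
  shows normal_integrable_power: "integrable M (\<lambda>\<omega>. X \<omega> ^ k)"
    and normal_expectation: "expectation X = 0"
    and normal_second_moment: "expectation (\<lambda>\<omega>. (X \<omega>)\<^sup>2) = v"
    and normal_fourth_moment: "expectation (\<lambda>\<omega>. (X \<omega>)^4) = 3 * v\<^sup>2"
proof -
  have sv: "0 < sqrt v" using assms by simp
  show "integrable M (\<lambda>\<omega>. X \<omega> ^ k)"
    using distributed_integrable[OF X, of "\<lambda>x. x ^ k"] integrable_normal_moment[OF sv, of 0 k] by simp
  show "expectation X = 0"
    using distributed_integral[OF X, of "\<lambda>x. x"] integral_normal_moment_nz_1[OF sv, of 0] by simp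
  show "expectation (\<lambda>\<omega>. (X \<omega>)\<^sup>2) = v"
    using distributed_integral[OF X, of "\<lambda>x. x ^ 2"] integral_normal_moment_even[OF sv, of 0 1] \<open>v > 0\<close>
    by (simp add: fact_numeral)
  show "expectation (\<lambda>\<omega>. (X \<omega>)^4) = 3 * v\<^sup>2"
    using distributed_integral[OF X, of "\<lambda>x. x ^ 4"] integral_normal_moment_even[OF sv, of 0 2] \<open>v > 0\<close>
    by (simp add: fact_numeral power_divide field_simps)
qed

text \<open>Stein's identity E[X g(X)] = v E[g'(X)] for g(x) = exp(i t x): the derivative of the
  characteristic function is computed once under the expectation and once from the closed form
  exp(-v t^2 / 2).\<close>

lemma (in prob_space) normal_expectation_mult_iexp:
  assumes X: "distributed M lborel X (normal_density 0 (sqrt v))" and "v > 0"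
  shows "expectation (\<lambda>\<omega>. complex_of_real (X \<omega>) * iexp (t * X \<omega>)) =
    \<i> * v * t * expectation (\<lambda>\<omega>. iexp (t * X \<omega>))"
proof -
  have [measurable]: "X \<in> borel_measurable M"
    using distributed_measurable[OF X] by simp
  have "((\<lambda>t. expectation (\<lambda>\<omega>. iexp (t * X \<omega>))) has_vector_derivative
      \<i> * expectation (\<lambda>\<omega>. complex_of_real (X \<omega>) * iexp (t * X \<omega>))) (at t)"
    by (rule has_vector_derivative_expectation_iexp) (use normal_integrable_power[OF assms] in auto)
  moreover have "((\<lambda>t. complex_of_real (exp (- (v * t\<^sup>2 / 2)))) has_vector_derivative
      complex_of_real (- (v * t) * exp (- (v * t\<^sup>2 / 2)))) (at t)"
    by (rule has_vector_derivative_of_real)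
      (auto intro!: derivative_eq_intros simp flip: has_real_derivative_iff_has_vector_derivative)
  ultimately have "\<i> * expectation (\<lambda>\<omega>. complex_of_real (X \<omega>) * iexp (t * X \<omega>)) =
      complex_of_real (- (v * t) * exp (- (v * t\<^sup>2 / 2)))"
    unfolding expectation_iexp_normal[OF assms] by (metis (no_types, lifting) vector_derivative_at)
  then have "\<i> * (\<i> * expectation (\<lambda>\<omega>. complex_of_real (X \<omega>) * iexp (t * X \<omega>))) =
      \<i> * complex_of_real (- (v * t) * exp (- (v * t\<^sup>2 / 2)))"
    by simp
  then show ?thesis
    unfolding expectation_iexp_normal[OF assms] by (simp add: field_simps flip: exp_of_real)
qed

text \<open>Independence of X and (c, d) enters as a product law, so Fubini freezes c and d at
  constants a and b, and Stein's identity is applied at frequency s a. The factor a from the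
  frequency and the factor a already present make up the c^2 on the right.\<close>

lemma (in prob_space) gaussian_integration_by_parts_iexp:
  assumes X: "distributed M lborel X (normal_density 0 (sqrt v))" and "v > 0"
    and [measurable]: "c \<in> borel_measurable M" "d \<in> borel_measurable M"
    and law: "distr M borel X \<Otimes>\<^sub>M distr M (borel \<Otimes>\<^sub>M borel) (\<lambda>\<omega>. (c \<omega>, d \<omega>)) =
      distr M (borel \<Otimes>\<^sub>M (borel \<Otimes>\<^sub>M borel)) (\<lambda>\<omega>. (X \<omega>, c \<omega>, d \<omega>))"
    and c2: "integrable M (\<lambda>\<omega>. (c \<omega> :: real)\<^sup>2)"
  shows "expectation (\<lambda>\<omega>. complex_of_real (X \<omega> * c \<omega>) * iexp (s * (X \<omega> * c \<omega>) + d \<omega>)) =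
    \<i> * v * s * expectation (\<lambda>\<omega>. complex_of_real ((c \<omega>)\<^sup>2) * iexp (s * (X \<omega> * c \<omega>) + d \<omega>))"
proof -
  have [measurable]: "X \<in> borel_measurable M"
    using distributed_measurable[OF X] by simp
  define P where "P = distr M borel X"
  define R where "R = distr M (borel \<Otimes>\<^sub>M borel) (\<lambda>\<omega>. (c \<omega>, d \<omega>))"
  interpret P: prob_space P unfolding P_def by (rule prob_space_distr) simp
  interpret R: prob_space R unfolding R_def by (rule prob_space_distr) simp
  interpret PR: pair_prob_space P R ..
  have [measurable_cong]: "sets P = sets borel" "sets R = sets (borel \<Otimes>\<^sub>M borel)"
    by (simp_all add: P_def R_def)
  note law = law[folded P_def R_def]
  have fubini: "expectation (\<lambda>\<omega>. F (X \<omega>, c \<omega>, d \<omega>)) = (\<integral>q. (\<integral>x. F (x, q) \<partial>P) \<partial>R)"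
    if [measurable]: "F \<in> borel_measurable (borel \<Otimes>\<^sub>M (borel \<Otimes>\<^sub>M borel))"
      and "integrable M (\<lambda>\<omega>. F (X \<omega>, c \<omega>, d \<omega>))" for F :: "_ \<Rightarrow> complex"
  proof -
    have "integrable (P \<Otimes>\<^sub>M R) F"
      unfolding law using that(2) by (subst integrable_distr_eq) auto
    then have "(\<integral>q. (\<integral>x. F (x, q) \<partial>P) \<partial>R) = integral\<^sup>L (P \<Otimes>\<^sub>M R) F"
      using PR.integral_snd[of "\<lambda>x y. F (x, y)"] by (simp add: case_prod_beta')
    also have "\<dots> = expectation (\<lambda>\<omega>. F (X \<omega>, c \<omega>, d \<omega>))"
      unfolding law by (subst integral_distr) auto
    finally show ?thesis by simp
  qed
  have inner: "(\<integral>x. complex_of_real (x * a) * iexp (s * (x * a) + b) \<partial>P) =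
      \<i> * v * s * (\<integral>x. complex_of_real (a\<^sup>2) * iexp (s * (x * a) + b) \<partial>P)" for a b
  proof -
    have "(\<integral>x. complex_of_real (x * a) * iexp (s * (x * a) + b) \<partial>P) =
        (\<integral>x. (complex_of_real a * iexp b) * (complex_of_real x * iexp ((s * a) * x)) \<partial>P)"
      by (intro Bochner_Integration.integral_cong) (auto simp: exp_add algebra_simps)
    also have "\<dots> = complex_of_real a * iexp b * expectation (\<lambda>\<omega>. complex_of_real (X \<omega>) * iexp ((s * a) * X \<omega>))"
      unfolding P_def by (subst integral_distr) (auto simp del: of_real_mult)
    also have "\<dots> = complex_of_real a * iexp b * (\<i> * v * (s * a) * expectation (\<lambda>\<omega>. iexp ((s * a) * X \<omega>)))"
      unfolding normal_expectation_mult_iexp[OF X \<open>v > 0\<close>] by simp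
    also have "\<dots> = \<i> * v * s * (complex_of_real (a\<^sup>2) * iexp b * expectation (\<lambda>\<omega>. iexp ((s * a) * X \<omega>)))"
      by (simp add: power2_eq_square)
    also have "complex_of_real (a\<^sup>2) * iexp b * expectation (\<lambda>\<omega>. iexp ((s * a) * X \<omega>)) =
        (\<integral>x. (complex_of_real (a\<^sup>2) * iexp b) * iexp ((s * a) * x) \<partial>P)"
      unfolding P_def by (subst integral_distr) (auto simp del: of_real_mult of_real_power)
    also have "\<dots> = (\<integral>x. complex_of_real (a\<^sup>2) * iexp (s * (x * a) + b) \<partial>P)"
      by (intro Bochner_Integration.integral_cong) (auto simp: exp_add algebra_simps)
    finally show ?thesis .
  qed
  have X2: "integrable M (\<lambda>\<omega>. (X \<omega>)\<^sup>2)"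
    using normal_integrable_power[OF X \<open>v > 0\<close>] .
  have Xc: "integrable M (\<lambda>\<omega>. X \<omega> * c \<omega>)"
    by (rule integrable_mult_of_squares) (use X2 c2 in auto)
  define F1 :: "real \<times> real \<times> real \<Rightarrow> complex"
    where "F1 = (\<lambda>(x, a, b). complex_of_real (x * a) * iexp (s * (x * a) + b))"
  define F2 :: "real \<times> real \<times> real \<Rightarrow> complex"
    where "F2 = (\<lambda>(x, a, b). complex_of_real (a\<^sup>2) * iexp (s * (x * a) + b))"
  have F1: "F1 \<in> borel_measurable (borel \<Otimes>\<^sub>M (borel \<Otimes>\<^sub>M borel))"
    and F2: "F2 \<in> borel_measurable (borel \<Otimes>\<^sub>M (borel \<Otimes>\<^sub>M borel))"
    unfolding F1_def F2_def by measurable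
  have eq1: "F1 (X \<omega>, c \<omega>, d \<omega>) = complex_of_real (X \<omega> * c \<omega>) * iexp (s * (X \<omega> * c \<omega>) + d \<omega>)" for \<omega>
    by (simp add: F1_def)
  have eq2: "F2 (X \<omega>, c \<omega>, d \<omega>) = complex_of_real ((c \<omega>)\<^sup>2) * iexp (s * (X \<omega> * c \<omega>) + d \<omega>)" for \<omega>
    by (simp add: F2_def)
  have i1: "integrable M (\<lambda>\<omega>. F1 (X \<omega>, c \<omega>, d \<omega>))"
    unfolding eq1 by (rule integrable_mult_iexp[OF Xc]) measurable
  have i2: "integrable M (\<lambda>\<omega>. F2 (X \<omega>, c \<omega>, d \<omega>))"
    unfolding eq2 by (rule integrable_mult_iexp[OF c2]) measurable
  have "(\<integral>x. F1 (x, q) \<partial>P) = \<i> * v * s * (\<integral>x. F2 (x, q) \<partial>P)" for q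
    using inner[of "fst q" "snd q"] by (simp only: F1_def F2_def case_prod_beta fst_conv snd_conv)
  then have "expectation (\<lambda>\<omega>. F1 (X \<omega>, c \<omega>, d \<omega>)) = \<i> * v * s * expectation (\<lambda>\<omega>. F2 (X \<omega>, c \<omega>, d \<omega>))"
    unfolding fubini[OF F1 i1] fubini[OF F2 i2] by (simp only: integral_mult_right_zero)
  then show ?thesis
    by (simp only: eq1 eq2)
qed

section \<open>Quadratic forms in independent Gaussian variables\<close>

locale gaussian_family = prob_space M
  for M :: "'a measure" +
  fixes I :: "'i set" and \<xi> :: "'i \<Rightarrow> 'a \<Rightarrow> real" and v :: "'i \<Rightarrow> real"
  assumes finite_I[simp]: "finite I"
    and v_pos: "i \<in> I \<Longrightarrow> 0 < v i"
    and normal: "i \<in> I \<Longrightarrow> distributed M lborel (\<xi> i) (normal_density 0 (sqrt (v i)))"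
    and indep: "indep_vars (\<lambda>_. borel) \<xi> I"
begin

lemma measurable_\<xi>[measurable]: "i \<in> I \<Longrightarrow> \<xi> i \<in> borel_measurable M"
  using distributed_measurable[OF normal] by simp

text \<open>Disjoint blocks of an independent family are independent as tuples; this is used for the
  block {i} and its complement, and the product law is then pushed forward under projection and
  \<open>F\<close>. The target \<open>N\<close> is left open because integration by parts needs
  independence from a pair of functions of the remaining variables.\<close>

lemma joint_law_rest:
  assumes "i \<in> I" and F: "F \<in> PiM (I - {i}) (\<lambda>_. borel) \<rightarrow>\<^sub>M N"
  shows "distr M borel (\<xi> i) \<Otimes>\<^sub>M distr M N (\<lambda>\<omega>. F (\<lambda>j\<in>I-{i}. \<xi> j \<omega>)) =
    distr M (borel \<Otimes>\<^sub>M N) (\<lambda>\<omega>. (\<xi> i \<omega>, F (\<lambda>j\<in>I-{i}. \<xi> j \<omega>)))"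
proof -
  let ?P = "PiM {i} (\<lambda>_. borel) :: ('i \<Rightarrow> real) measure" and ?R = "PiM (I - {i}) (\<lambda>_. borel) :: ('i \<Rightarrow> real) measure"
  let ?X = "\<lambda>\<omega>. \<lambda>j\<in>{i}. \<xi> j \<omega>" and ?Y = "\<lambda>\<omega>. \<lambda>j\<in>I-{i}. \<xi> j \<omega>"
  have "indep_var ?P ?X ?R ?Y"
    by (rule indep_var_restrict[OF indep]) (use \<open>i \<in> I\<close> in auto)
  then have X[measurable]: "?X \<in> M \<rightarrow>\<^sub>M ?P" and Y[measurable]: "?Y \<in> M \<rightarrow>\<^sub>M ?R"
    and law: "distr M ?P ?X \<Otimes>\<^sub>M distr M ?R ?Y = distr M (?P \<Otimes>\<^sub>M ?R) (\<lambda>\<omega>. (?X \<omega>, ?Y \<omega>))"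
    unfolding indep_var_distribution_eq by blast+
  interpret Y: prob_space "distr M ?R ?Y" by (rule prob_space_distr) fact
  interpret FY: prob_space "distr (distr M ?R ?Y) N F"
    by (rule Y.prob_space_distr) (use F in simp)
  have proj: "(\<lambda>x. x i) \<in> ?P \<rightarrow>\<^sub>M borel"
    by (rule measurable_component_singleton) simp
  have "distr (distr M ?P ?X) borel (\<lambda>x. x i) \<Otimes>\<^sub>M distr (distr M ?R ?Y) N F =
      distr (distr M ?P ?X \<Otimes>\<^sub>M distr M ?R ?Y) (borel \<Otimes>\<^sub>M N) (\<lambda>(x, y). (x i, F y))"
    by (rule pair_measure_distr) (use F proj in \<open>auto intro: FY.sigma_finite_measure_axioms\<close>)
  also have "\<dots> = distr M (borel \<Otimes>\<^sub>M N) ((\<lambda>(x, y). (x i, F y)) \<circ> (\<lambda>\<omega>. (?X \<omega>, ?Y \<omega>)))"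
    unfolding law by (rule distr_distr) (use F proj in measurable)
  finally show ?thesis
    using F proj by (simp add: distr_distr comp_def)
qed

lemma indep_var_rest:
  assumes "i \<in> I" and F: "F \<in> borel_measurable (PiM (I - {i}) (\<lambda>_. borel))"
  shows "indep_var borel (\<xi> i) borel (\<lambda>\<omega>. F (\<lambda>j\<in>I-{i}. \<xi> j \<omega>) :: real)"
proof -
  let ?Y = "\<lambda>\<omega>. \<lambda>j\<in>I-{i}. \<xi> j \<omega>"
  have [measurable]: "?Y \<in> M \<rightarrow>\<^sub>M PiM (I - {i}) (\<lambda>_. borel)"
    by (intro measurable_restrict) auto
  show ?thesis
    unfolding indep_var_distribution_eq
    using joint_law_rest[OF assms] assms by (auto intro: measurable_compose[OF _ F])
qed

section \<open>Moments of products of up to four variables, and second moments of quadratic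
  forms\<close>

lemma integrable_\<xi>_power: "i \<in> I \<Longrightarrow> integrable M (\<lambda>\<omega>. \<xi> i \<omega> ^ k)"
  by (rule normal_integrable_power[OF normal v_pos])

lemma integrable_\<xi>2:
  assumes "i \<in> I" "j \<in> I"
  shows "integrable M (\<lambda>\<omega>. \<xi> i \<omega> * \<xi> j \<omega>)"
  by (rule integrable_mult_of_squares) (use assms integrable_\<xi>_power in auto)

lemma integrable_\<xi>2_squared:
  assumes "i \<in> I" "j \<in> I"
  shows "integrable M (\<lambda>\<omega>. (\<xi> i \<omega> * \<xi> j \<omega>)\<^sup>2)"
  unfolding power_mult_distrib
  by (rule integrable_mult_of_squares) (use assms integrable_\<xi>_power in \<open>auto simp flip: power_mult\<close>)

lemma integrable_\<xi>4:
  assumes "i \<in> I" "j \<in> I" "k \<in> I" "l \<in> I"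
  shows "integrable M (\<lambda>\<omega>. (\<xi> i \<omega> * \<xi> j \<omega>) * (\<xi> k \<omega> * \<xi> l \<omega>))"
  by (rule integrable_mult_of_squares) (use assms integrable_\<xi>2_squared in auto)

text \<open>A variable that occurs exactly once splits off by independence and has mean
  zero.\<close>

lemma expectation_\<xi>4_simple_factor:
  assumes "i \<in> I" "j \<in> I" "k \<in> I" "l \<in> I" and "i \<noteq> j" "i \<noteq> k" "i \<noteq> l"
  shows "expectation (\<lambda>\<omega>. (\<xi> i \<omega> * \<xi> j \<omega>) * (\<xi> k \<omega> * \<xi> l \<omega>)) = 0"
proof -
  define F where "F = (\<lambda>x. x j * (x k * x l) :: real)"
  have F: "F \<in> borel_measurable (PiM (I - {i}) (\<lambda>_. borel))"
    unfolding F_def using assms by (intro borel_measurable_times measurable_component_singleton) auto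
  let ?Y = "\<lambda>\<omega>. F (\<lambda>j\<in>I-{i}. \<xi> j \<omega>)"
  have Y: "?Y \<omega> = \<xi> j \<omega> * (\<xi> k \<omega> * \<xi> l \<omega>)" for \<omega>
    using assms by (auto simp: F_def)
  have "integrable M (\<lambda>\<omega>. \<xi> j \<omega> * (\<xi> k \<omega> * \<xi> l \<omega>))"
    by (rule integrable_mult_of_squares) (use assms integrable_\<xi>_power integrable_\<xi>2_squared in auto)
  then have "expectation (\<lambda>\<omega>. \<xi> i \<omega> * ?Y \<omega>) = expectation (\<xi> i) * expectation ?Y"
    using integrable_\<xi>_power[of i 1] assms
    by (intro indep_var_lebesgue_integral indep_var_rest F) (auto simp: Y)
  then show ?thesis
    using normal_expectation[OF normal v_pos] assms by (simp add: Y mult.assoc)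
qed

lemma expectation_\<xi>_squares:
  assumes "i \<in> I" "j \<in> I" "i \<noteq> j"
  shows "expectation (\<lambda>\<omega>. (\<xi> i \<omega>)\<^sup>2 * (\<xi> j \<omega>)\<^sup>2) = v i * v j"
proof -
  define F where "F = (\<lambda>x. x j :: real)"
  have F: "F \<in> borel_measurable (PiM (I - {i}) (\<lambda>_. borel))"
    unfolding F_def using assms by (intro measurable_component_singleton) auto
  let ?Y = "\<lambda>\<omega>. F (\<lambda>j\<in>I-{i}. \<xi> j \<omega>)"
  have "indep_var borel ((\<lambda>x. x\<^sup>2) \<circ> \<xi> i) borel ((\<lambda>x. x\<^sup>2) \<circ> ?Y)"
    by (rule indep_var_compose[OF indep_var_rest[OF _ F]]) (use assms in auto)
  then have "expectation (\<lambda>\<omega>. (\<xi> i \<omega>)\<^sup>2 * (\<xi> j \<omega>)\<^sup>2) = expectation (\<lambda>\<omega>. (\<xi> i \<omega>)\<^sup>2) * expectation (\<lambda>\<omega>. (\<xi> j \<omega>)\<^sup>2)"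
    using assms integrable_\<xi>_power by (intro indep_var_lebesgue_integral) (auto simp: F_def comp_def)
  then show ?thesis
    using normal_second_moment[OF normal v_pos] assms by simp
qed

text \<open>Wick's formula: the pairing of i with j and k with l vanishes off the diagonal, which
  leaves the two cross pairings. If neither of them matches, then i or j occurs only once.\<close>

lemma expectation_\<xi>4_off_diag:
  assumes "i \<in> I" "j \<in> I" "k \<in> I" "l \<in> I" and "i \<noteq> j" "k \<noteq> l"
  shows "expectation (\<lambda>\<omega>. (\<xi> i \<omega> * \<xi> j \<omega>) * (\<xi> k \<omega> * \<xi> l \<omega>)) =
    (if k = i \<and> l = j then v i * v j else 0) + (if k = j \<and> l = i then v i * v j else 0)"
proof -
  consider "k = i \<and> l = j" | "k = j \<and> l = i" | "i \<noteq> k \<and> i \<noteq> l" | "j \<noteq> k \<and> j \<noteq> l"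
    using assms by blast
  then show ?thesis
  proof cases
    case 1
    have "(\<lambda>\<omega>. (\<xi> i \<omega> * \<xi> j \<omega>) * (\<xi> k \<omega> * \<xi> l \<omega>)) = (\<lambda>\<omega>. (\<xi> i \<omega>)\<^sup>2 * (\<xi> j \<omega>)\<^sup>2)"
      using 1 by (auto simp: power2_eq_square)
    with 1 expectation_\<xi>_squares[of i j] assms show ?thesis
      by auto
  next
    case 2
    have "(\<lambda>\<omega>. (\<xi> i \<omega> * \<xi> j \<omega>) * (\<xi> k \<omega> * \<xi> l \<omega>)) = (\<lambda>\<omega>. (\<xi> i \<omega>)\<^sup>2 * (\<xi> j \<omega>)\<^sup>2)"
      using 2 by (auto simp: power2_eq_square)
    with 2 expectation_\<xi>_squares[of i j] assms show ?thesis
      by auto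
  next
    case 3
    with expectation_\<xi>4_simple_factor[of i j k l] assms show ?thesis
      by auto
  next
    case 4
    have "(\<lambda>\<omega>. (\<xi> i \<omega> * \<xi> j \<omega>) * (\<xi> k \<omega> * \<xi> l \<omega>)) = (\<lambda>\<omega>. (\<xi> j \<omega> * \<xi> i \<omega>) * (\<xi> k \<omega> * \<xi> l \<omega>))"
      by (auto simp: mult_ac)
    with 4 expectation_\<xi>4_simple_factor[of j i k l] assms show ?thesis
      by auto
  qed
qed

text \<open>Wick's formula leaves the sum of b_ij^2 + b_ij b_ji with weights v_i v_j. The mixed
  product is at most the mean of b_ij^2 and b_ji^2, and both squares have the same weighted sum.
  Symmetry of b is not assumed, as the integrals of step functions have arbitrary
  coefficients.\<close>

lemma off_diag_form_second_moment:
  assumes diag: "\<And>i. i \<in> I \<Longrightarrow> b i i = 0"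
  shows "integrable M (\<lambda>\<omega>. (\<Sum>i\<in>I. \<Sum>j\<in>I. b i j * (\<xi> i \<omega> * \<xi> j \<omega>))\<^sup>2)"
    and "expectation (\<lambda>\<omega>. (\<Sum>i\<in>I. \<Sum>j\<in>I. b i j * (\<xi> i \<omega> * \<xi> j \<omega>))\<^sup>2)
      \<le> 2 * (\<Sum>i\<in>I. \<Sum>j\<in>I. (b i j)\<^sup>2 * (v i * v j))"
proof -
  have expand: "(\<Sum>i\<in>I. \<Sum>j\<in>I. b i j * (\<xi> i \<omega> * \<xi> j \<omega>))\<^sup>2 = (\<Sum>i\<in>I. \<Sum>j\<in>I. \<Sum>k\<in>I. \<Sum>l\<in>I.
      (b i j * b k l) * ((\<xi> i \<omega> * \<xi> j \<omega>) * (\<xi> k \<omega> * \<xi> l \<omega>)))" for \<omega>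
    unfolding power2_eq_square sum_distrib_left sum_distrib_right
    by (intro sum.cong refl) (simp add: mult_ac)
  show "integrable M (\<lambda>\<omega>. (\<Sum>i\<in>I. \<Sum>j\<in>I. b i j * (\<xi> i \<omega> * \<xi> j \<omega>))\<^sup>2)"
    unfolding expand by (intro Bochner_Integration.integrable_sum integrable_mult_right integrable_\<xi>4)
  have "expectation (\<lambda>\<omega>. (\<Sum>i\<in>I. \<Sum>j\<in>I. b i j * (\<xi> i \<omega> * \<xi> j \<omega>))\<^sup>2) =
      (\<Sum>i\<in>I. \<Sum>j\<in>I. \<Sum>k\<in>I. \<Sum>l\<in>I.
        (b i j * b k l) * expectation (\<lambda>\<omega>. (\<xi> i \<omega> * \<xi> j \<omega>) * (\<xi> k \<omega> * \<xi> l \<omega>)))"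
    unfolding expand
    by (simp add: Bochner_Integration.integral_sum integrable_\<xi>4)
  \<comment> \<open>The conditions are nested with the one on l outermost, so that
    \<open>sum.delta\<close> collapses the sum over l and then the sum over k.\<close>
  also have "\<dots> = (\<Sum>i\<in>I. \<Sum>j\<in>I. \<Sum>k\<in>I. \<Sum>l\<in>I.
        (if l = j then (if k = i then b i j * b k l * (v i * v j) else 0) else 0)
        + (if l = i then (if k = j then b i j * b k l * (v i * v j) else 0) else 0))"
  proof (intro sum.cong refl)
    fix i j k l assume I: "i \<in> I" "j \<in> I" "k \<in> I" "l \<in> I"
    show "(b i j * b k l) * expectation (\<lambda>\<omega>. (\<xi> i \<omega> * \<xi> j \<omega>) * (\<xi> k \<omega> * \<xi> l \<omega>)) =
        (if l = j then (if k = i then b i j * b k l * (v i * v j) else 0) else 0)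
        + (if l = i then (if k = j then b i j * b k l * (v i * v j) else 0) else 0)"
    proof (cases "i = j \<or> k = l")
      case True
      then show ?thesis using diag I by auto
    next
      case False
      then show ?thesis using expectation_\<xi>4_off_diag[OF I] by auto
    qed
  qed
  also have "\<dots> = (\<Sum>i\<in>I. \<Sum>j\<in>I. b i j * b i j * (v i * v j) + b i j * b j i * (v i * v j))"
    by (simp add: sum.distrib sum.delta)
  also have "\<dots> \<le> (\<Sum>i\<in>I. \<Sum>j\<in>I. b i j * b i j * (v i * v j)
      + ((b i j)\<^sup>2 / 2 * (v i * v j) + (b j i)\<^sup>2 / 2 * (v i * v j)))"
  proof (intro sum_mono add_left_mono)
    fix i j assume "i \<in> I" "j \<in> I"
    then have "0 \<le> v i * v j"
      using v_pos[of i] v_pos[of j] by simp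
    then have "b i j * b j i * (v i * v j) \<le> ((b i j)\<^sup>2 / 2 + (b j i)\<^sup>2 / 2) * (v i * v j)"
      using sum_squares_bound[of "b i j" "b j i"] by (intro mult_right_mono) auto
    then show "b i j * b j i * (v i * v j) \<le> (b i j)\<^sup>2 / 2 * (v i * v j) + (b j i)\<^sup>2 / 2 * (v i * v j)"
      by (simp add: distrib_right)
  qed
  also have "\<dots> = (\<Sum>i\<in>I. \<Sum>j\<in>I. (b i j)\<^sup>2 * (v i * v j)) + (\<Sum>i\<in>I. \<Sum>j\<in>I. (b i j)\<^sup>2 / 2 * (v i * v j))
      + (\<Sum>i\<in>I. \<Sum>j\<in>I. (b j i)\<^sup>2 / 2 * (v i * v j))"
    by (simp only: sum.distrib power2_eq_square add.assoc)
  also have "(\<Sum>i\<in>I. \<Sum>j\<in>I. (b j i)\<^sup>2 / 2 * (v i * v j)) = (\<Sum>i\<in>I. \<Sum>j\<in>I. (b i j)\<^sup>2 / 2 * (v i * v j))"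
    by (subst sum.swap) (simp add: mult.commute)
  also have "(\<Sum>i\<in>I. \<Sum>j\<in>I. (b i j)\<^sup>2 * (v i * v j)) + (\<Sum>i\<in>I. \<Sum>j\<in>I. (b i j)\<^sup>2 / 2 * (v i * v j))
      + (\<Sum>i\<in>I. \<Sum>j\<in>I. (b i j)\<^sup>2 / 2 * (v i * v j)) = 2 * (\<Sum>i\<in>I. \<Sum>j\<in>I. (b i j)\<^sup>2 * (v i * v j))"
    by (simp add: sum_divide_distrib[symmetric] times_divide_eq_left)
  finally show "expectation (\<lambda>\<omega>. (\<Sum>i\<in>I. \<Sum>j\<in>I. b i j * (\<xi> i \<omega> * \<xi> j \<omega>))\<^sup>2)
      \<le> 2 * (\<Sum>i\<in>I. \<Sum>j\<in>I. (b i j)\<^sup>2 * (v i * v j))" .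
qed

text \<open>The variables \<open>(\<xi> j)\<^sup>2 - v j\<close> are uncorrelated with variance 3
  v^2 - v^2 = 2 v^2, by the fourth Gaussian moment.\<close>

lemma centred_squares_second_moment:
  shows "integrable M (\<lambda>\<omega>. (\<Sum>j\<in>I. c j * ((\<xi> j \<omega>)\<^sup>2 - v j))\<^sup>2)"
    and "expectation (\<lambda>\<omega>. (\<Sum>j\<in>I. c j * ((\<xi> j \<omega>)\<^sup>2 - v j))\<^sup>2) = 2 * (\<Sum>j\<in>I. (c j)\<^sup>2 * (v j)\<^sup>2)"
proof -
  have expand: "(\<Sum>j\<in>I. c j * ((\<xi> j \<omega>)\<^sup>2 - v j))\<^sup>2 = (\<Sum>j\<in>I. \<Sum>k\<in>I.
      (c j * c k) * (((\<xi> j \<omega>)\<^sup>2 - v j) * ((\<xi> k \<omega>)\<^sup>2 - v k)))" for \<omega>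
    unfolding power2_eq_square sum_distrib_left sum_distrib_right
    by (intro sum.cong refl) (simp add: mult_ac)
  have expand2: "((\<xi> j \<omega>)\<^sup>2 - v j) * ((\<xi> k \<omega>)\<^sup>2 - v k) =
      ((\<xi> j \<omega> * \<xi> j \<omega>) * (\<xi> k \<omega> * \<xi> k \<omega>) - v k * (\<xi> j \<omega>)\<^sup>2) - (v j * (\<xi> k \<omega>)\<^sup>2 - v j * v k)" for j k \<omega>
    by (simp add: power2_eq_square algebra_simps)
  have int: "integrable M (\<lambda>\<omega>. ((\<xi> j \<omega>)\<^sup>2 - v j) * ((\<xi> k \<omega>)\<^sup>2 - v k))" if "j \<in> I" "k \<in> I" for j k
    unfolding expand2 using that
    by (intro Bochner_Integration.integrable_diff integrable_mult_right integrable_\<xi>4 integrable_\<xi>_power) auto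
  have E: "expectation (\<lambda>\<omega>. ((\<xi> j \<omega>)\<^sup>2 - v j) * ((\<xi> k \<omega>)\<^sup>2 - v k)) = (if k = j then 2 * (v j)\<^sup>2 else 0)"
    if I: "j \<in> I" "k \<in> I" for j k
  proof -
    have e4: "expectation (\<lambda>\<omega>. (\<xi> j \<omega> * \<xi> j \<omega>) * (\<xi> k \<omega> * \<xi> k \<omega>)) = (if k = j then 3 * (v j)\<^sup>2 else v j * v k)"
      using normal_fourth_moment[OF normal v_pos, OF I(1) I(1)] expectation_\<xi>_squares[of j k] I
      by (auto simp: power2_eq_square power4_eq_xxxx mult.assoc)
    have "expectation (\<lambda>\<omega>. ((\<xi> j \<omega>)\<^sup>2 - v j) * ((\<xi> k \<omega>)\<^sup>2 - v k)) =
      expectation (\<lambda>\<omega>. (\<xi> j \<omega> * \<xi> j \<omega>) * (\<xi> k \<omega> * \<xi> k \<omega>)) - v k * expectation (\<lambda>\<omega>. (\<xi> j \<omega>)\<^sup>2)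
        - (v j * expectation (\<lambda>\<omega>. (\<xi> k \<omega>)\<^sup>2) - v j * v k)"
      unfolding expand2 using I by (simp add: integrable_\<xi>4 integrable_\<xi>_power prob_space)
    then show ?thesis
      using normal_second_moment[OF normal v_pos] I unfolding e4 by (auto simp: power2_eq_square)
  qed
  show "integrable M (\<lambda>\<omega>. (\<Sum>j\<in>I. c j * ((\<xi> j \<omega>)\<^sup>2 - v j))\<^sup>2)"
    unfolding expand by (intro Bochner_Integration.integrable_sum integrable_mult_right int)
  have "expectation (\<lambda>\<omega>. (\<Sum>j\<in>I. c j * ((\<xi> j \<omega>)\<^sup>2 - v j))\<^sup>2) =
      (\<Sum>j\<in>I. \<Sum>k\<in>I. (c j * c k) * expectation (\<lambda>\<omega>. ((\<xi> j \<omega>)\<^sup>2 - v j) * ((\<xi> k \<omega>)\<^sup>2 - v k)))"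
    unfolding expand by (simp add: Bochner_Integration.integral_sum int)
  also have "\<dots> = (\<Sum>j\<in>I. \<Sum>k\<in>I. if k = j then (c j * c k) * (2 * (v j)\<^sup>2) else 0)"
    by (intro sum.cong refl) (auto simp: E)
  also have "\<dots> = 2 * (\<Sum>j\<in>I. (c j)\<^sup>2 * (v j)\<^sup>2)"
    by (simp add: sum_distrib_left power2_eq_square mult_ac)
  finally show "expectation (\<lambda>\<omega>. (\<Sum>j\<in>I. c j * ((\<xi> j \<omega>)\<^sup>2 - v j))\<^sup>2) = 2 * (\<Sum>j\<in>I. (c j)\<^sup>2 * (v j)\<^sup>2)" .
qed

text \<open>The form is split into its off-diagonal part U and the centred squares V on the
  diagonal. The constant 4 is the product of the 2 in (U + V)^2 \<le> 2 U^2 + 2 V^2 and the 2 in the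
  second moment of each part.\<close>

lemma centred_form_second_moment:
  fixes b :: "'i \<Rightarrow> 'i \<Rightarrow> real"
  defines "T \<equiv> \<lambda>\<omega>. (\<Sum>j\<in>I. \<Sum>k\<in>I. b j k * (\<xi> j \<omega> * \<xi> k \<omega>)) - (\<Sum>j\<in>I. b j j * v j)"
  shows "integrable M (\<lambda>\<omega>. (T \<omega>)\<^sup>2)"
    and "expectation (\<lambda>\<omega>. (T \<omega>)\<^sup>2) \<le> 4 * (\<Sum>j\<in>I. \<Sum>k\<in>I. (b j k)\<^sup>2 * (v j * v k))"
proof -
  define b' where "b' = (\<lambda>j k. if k = j then 0 else b j k)"
  define U where "U = (\<lambda>\<omega>. \<Sum>j\<in>I. \<Sum>k\<in>I. b' j k * (\<xi> j \<omega> * \<xi> k \<omega>))"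
  define V where "V = (\<lambda>\<omega>. \<Sum>j\<in>I. b j j * ((\<xi> j \<omega>)\<^sup>2 - v j))"
  have split: "(\<Sum>k\<in>I. f k) = (\<Sum>k\<in>I. if k = j then 0 else f k) + f j" if "j \<in> I" for f :: "'i \<Rightarrow> real" and j
    using that by (simp add: sum.remove[of I j])
  have T: "T \<omega> = U \<omega> + V \<omega>" for \<omega>
  proof -
    have "(\<Sum>j\<in>I. \<Sum>k\<in>I. b j k * (\<xi> j \<omega> * \<xi> k \<omega>)) = (\<Sum>j\<in>I. (\<Sum>k\<in>I. b' j k * (\<xi> j \<omega> * \<xi> k \<omega>)) + b j j * (\<xi> j \<omega>)\<^sup>2)"
    proof (intro sum.cong refl)
      fix j assume "j \<in> I"
      then show "(\<Sum>k\<in>I. b j k * (\<xi> j \<omega> * \<xi> k \<omega>)) = (\<Sum>k\<in>I. b' j k * (\<xi> j \<omega> * \<xi> k \<omega>)) + b j j * (\<xi> j \<omega>)\<^sup>2"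
        by (subst split[of j]) (auto simp: b'_def power2_eq_square intro!: sum.cong)
    qed
    then show ?thesis
      by (simp add: T_def U_def V_def sum.distrib right_diff_distrib sum_subtractf)
  qed
  have b'0: "b' i i = 0" for i by (simp add: b'_def)
  have U2: "integrable M (\<lambda>\<omega>. (U \<omega>)\<^sup>2)"
    "expectation (\<lambda>\<omega>. (U \<omega>)\<^sup>2) \<le> 2 * (\<Sum>i\<in>I. \<Sum>j\<in>I. (b' i j)\<^sup>2 * (v i * v j))"
    unfolding U_def by (rule off_diag_form_second_moment[of b', OF b'0])+
  have V2: "integrable M (\<lambda>\<omega>. (V \<omega>)\<^sup>2)"
    "expectation (\<lambda>\<omega>. (V \<omega>)\<^sup>2) = 2 * (\<Sum>j\<in>I. (b j j)\<^sup>2 * (v j)\<^sup>2)"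
    unfolding V_def by (rule centred_squares_second_moment)+
  have [measurable]: "U \<in> borel_measurable M" "V \<in> borel_measurable M"
    unfolding U_def V_def by measurable
  have i: "integrable M (\<lambda>\<omega>. 2 * (U \<omega>)\<^sup>2 + 2 * (V \<omega>)\<^sup>2)"
    using U2 V2 by simp
  show i': "integrable M (\<lambda>\<omega>. (T \<omega>)\<^sup>2)"
    by (rule Bochner_Integration.integrable_bound[OF i])
      (auto simp: T intro!: AE_I2 power2_add_le order_trans[OF _ abs_ge_self])
  have "expectation (\<lambda>\<omega>. (T \<omega>)\<^sup>2) \<le> expectation (\<lambda>\<omega>. 2 * (U \<omega>)\<^sup>2 + 2 * (V \<omega>)\<^sup>2)"
    by (rule integral_mono[OF i' i]) (auto simp: T intro: power2_add_le)
  also have "\<dots> = 2 * expectation (\<lambda>\<omega>. (U \<omega>)\<^sup>2) + 2 * expectation (\<lambda>\<omega>. (V \<omega>)\<^sup>2)"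
    using U2 V2 by simp
  also have "\<dots> \<le> 4 * (\<Sum>j\<in>I. (\<Sum>k\<in>I. (b' j k)\<^sup>2 * (v j * v k)) + (b j j)\<^sup>2 * (v j)\<^sup>2)"
    using U2(2) unfolding V2(2) by (simp add: sum.distrib)
  also have "(\<Sum>j\<in>I. (\<Sum>k\<in>I. (b' j k)\<^sup>2 * (v j * v k)) + (b j j)\<^sup>2 * (v j)\<^sup>2) =
      (\<Sum>j\<in>I. \<Sum>k\<in>I. (b j k)\<^sup>2 * (v j * v k))"
  proof (intro sum.cong refl)
    fix j assume "j \<in> I"
    then show "(\<Sum>k\<in>I. (b' j k)\<^sup>2 * (v j * v k)) + (b j j)\<^sup>2 * (v j)\<^sup>2 = (\<Sum>k\<in>I. (b j k)\<^sup>2 * (v j * v k))"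
      by (subst (2) split[of j]) (auto simp: b'_def power2_eq_square intro!: sum.cong)
  qed
  finally show "expectation (\<lambda>\<omega>. (T \<omega>)\<^sup>2) \<le> 4 * (\<Sum>j\<in>I. \<Sum>k\<in>I. (b j k)\<^sup>2 * (v j * v k))" .
qed

end

section \<open>Characteristic function of an off-diagonal quadratic form\<close>

context gaussian_family
begin

text \<open>
  As \<open>a\<close> has zero diagonal, \<open>G\<close> is affine in \<open>\<xi> i\<close> with slope \<open>2 c\<close>, and \<open>c\<close> does not involve \<open>\<xi> i\<close>.
\<close>

lemma quadratic_form_integration_by_parts:
  assumes sym: "\<And>i j. i \<in> I \<Longrightarrow> j \<in> I \<Longrightarrow> a i j = a j i" and diag: "\<And>i. i \<in> I \<Longrightarrow> a i i = 0"
    and i: "i \<in> I"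
  defines "G \<equiv> \<lambda>\<omega>. \<Sum>i\<in>I. \<Sum>j\<in>I. a i j * (\<xi> i \<omega> * \<xi> j \<omega>)"
    and "c \<equiv> \<lambda>\<omega>. \<Sum>j\<in>I. a i j * \<xi> j \<omega>"
  shows "integrable M (\<lambda>\<omega>. (c \<omega>)\<^sup>2)" and "integrable M (\<lambda>\<omega>. \<xi> i \<omega> * c \<omega>)"
    and "expectation (\<lambda>\<omega>. complex_of_real (\<xi> i \<omega> * c \<omega>) * iexp (t * G \<omega>)) =
      \<i> * v i * (2 * t) * expectation (\<lambda>\<omega>. complex_of_real ((c \<omega>)\<^sup>2) * iexp (t * G \<omega>))"
proof -
  define I' where "I' = I - {i}"
  have I': "finite I'" "I = insert i I'" "i \<notin> I'"
    using i by (auto simp: I'_def)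
  define d where "d = (\<lambda>\<omega>. t * (\<Sum>j\<in>I'. \<Sum>k\<in>I'. a j k * (\<xi> j \<omega> * \<xi> k \<omega>)))"
  define F where "F = (\<lambda>x :: 'i \<Rightarrow> real. (\<Sum>j\<in>I'. a i j * x j, t * (\<Sum>j\<in>I'. \<Sum>k\<in>I'. a j k * (x j * x k))))"
  have c: "c \<omega> = (\<Sum>j\<in>I'. a i j * \<xi> j \<omega>)" for \<omega>
    unfolding c_def I'(2) using I'(1,3) diag[OF i] by simp
  have F: "F (\<lambda>j\<in>I-{i}. \<xi> j \<omega>) = (c \<omega>, d \<omega>)" for \<omega>
    unfolding F_def c d_def I'_def[symmetric] by simp
  have "F \<in> PiM (I - {i}) (\<lambda>_. borel) \<rightarrow>\<^sub>M borel \<Otimes>\<^sub>M borel"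
    unfolding F_def I'_def[symmetric]
    by (intro measurable_Pair borel_measurable_sum borel_measurable_times measurable_component_singleton
        borel_measurable_const) auto
  from joint_law_rest[OF i this]
  have law: "distr M borel (\<xi> i) \<Otimes>\<^sub>M distr M (borel \<Otimes>\<^sub>M borel) (\<lambda>\<omega>. (c \<omega>, d \<omega>)) =
    distr M (borel \<Otimes>\<^sub>M (borel \<Otimes>\<^sub>M borel)) (\<lambda>\<omega>. (\<xi> i \<omega>, c \<omega>, d \<omega>))"
    unfolding F .
  have [measurable]: "j \<in> I' \<Longrightarrow> \<xi> j \<in> borel_measurable M" for j
    by (auto simp: I'_def)
  have meas[measurable]: "c \<in> borel_measurable M" "d \<in> borel_measurable M"
    unfolding c d_def by measurable
  have c2: "(c \<omega>)\<^sup>2 = (\<Sum>j\<in>I. \<Sum>k\<in>I. (a i j * a i k) * (\<xi> j \<omega> * \<xi> k \<omega>))" for \<omega>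
    unfolding c_def power2_eq_square sum_distrib_left sum_distrib_right
    by (intro sum.cong refl) (simp add: mult_ac)
  show int: "integrable M (\<lambda>\<omega>. (c \<omega>)\<^sup>2)"
    unfolding c2 by (intro Bochner_Integration.integrable_sum integrable_mult_right integrable_\<xi>2)
  show "integrable M (\<lambda>\<omega>. \<xi> i \<omega> * c \<omega>)"
    by (rule integrable_mult_of_squares) (use i int integrable_\<xi>_power in auto)
  \<comment> \<open>Row i and column i of the matrix both contribute
    \<open>\<xi> i \<omega> * c \<omega>\<close>, the latter by symmetry; hence the frequency 2
    t.\<close>
  have split: "t * G \<omega> = (2 * t) * (\<xi> i \<omega> * c \<omega>) + d \<omega>" for \<omega>
  proof -
    have "G \<omega> = (\<Sum>k\<in>I'. a i k * (\<xi> i \<omega> * \<xi> k \<omega>)) +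
        ((\<Sum>j\<in>I'. a j i * (\<xi> j \<omega> * \<xi> i \<omega>)) + (\<Sum>j\<in>I'. \<Sum>k\<in>I'. a j k * (\<xi> j \<omega> * \<xi> k \<omega>)))"
      unfolding G_def I'(2) using I'(1,3) diag[OF i] by (simp add: sum.distrib)
    also have "(\<Sum>k\<in>I'. a i k * (\<xi> i \<omega> * \<xi> k \<omega>)) = \<xi> i \<omega> * c \<omega>"
      unfolding c sum_distrib_left by (simp add: mult_ac)
    also have "(\<Sum>j\<in>I'. a j i * (\<xi> j \<omega> * \<xi> i \<omega>)) = \<xi> i \<omega> * c \<omega>"
      unfolding c sum_distrib_left
    proof (intro sum.cong refl)
      fix j assume "j \<in> I'"
      then show "a j i * (\<xi> j \<omega> * \<xi> i \<omega>) = \<xi> i \<omega> * (a i j * \<xi> j \<omega>)"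
        using sym[of j i] i by (simp add: I'_def)
    qed
    finally show ?thesis
      by (simp add: d_def algebra_simps)
  qed
  show "expectation (\<lambda>\<omega>. complex_of_real (\<xi> i \<omega> * c \<omega>) * iexp (t * G \<omega>)) =
      \<i> * v i * (2 * t) * expectation (\<lambda>\<omega>. complex_of_real ((c \<omega>)\<^sup>2) * iexp (t * G \<omega>))"
    unfolding split
    using gaussian_integration_by_parts_iexp[OF normal[OF i] v_pos[OF i] meas law int, of "2 * t"] by simp
qed

text \<open>
  Summed over \<open>i\<close>, the previous identity says \<open>\<phi>' = - 2 t E[S e\<^sup>i\<^sup>t\<^sup>G]\<close>. Since \<open>S\<close> is close to its mean \<open>s\<close>, the
  function \<open>\<phi>\<close> nearly solves \<open>\<phi>' = - 2 s t \<phi>\<close>, and the mean value theorem is applied to \<open>e\<^sup>s\<^sup>t\<^sup>t \<phi>(t)\<close>.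
\<close>

lemma quadratic_form_char_bound:
  assumes sym: "\<And>i j. i \<in> I \<Longrightarrow> j \<in> I \<Longrightarrow> a i j = a j i" and diag: "\<And>i. i \<in> I \<Longrightarrow> a i i = 0"
  defines "G \<equiv> \<lambda>\<omega>. \<Sum>i\<in>I. \<Sum>j\<in>I. a i j * (\<xi> i \<omega> * \<xi> j \<omega>)"
    and "s \<equiv> \<Sum>i\<in>I. \<Sum>j\<in>I. (a i j)\<^sup>2 * (v i * v j)"
    and "Q \<equiv> \<Sum>i\<in>I. \<Sum>j\<in>I. (\<Sum>k\<in>I. a i k * v k * a k j)\<^sup>2 * (v i * v j)"
  shows "cmod (expectation (\<lambda>\<omega>. iexp (t * G \<omega>)) - exp (- (s * t\<^sup>2))) \<le> 4 * t\<^sup>2 * sqrt Q"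
proof -
  define c where "c = (\<lambda>i \<omega>. \<Sum>j\<in>I. a i j * \<xi> j \<omega>)"
  define S where "S = (\<lambda>\<omega>. \<Sum>i\<in>I. v i * (c i \<omega>)\<^sup>2)"
  \<comment> \<open>This is the matrix product a diag(v) a. By symmetry of a, S is the quadratic
    form of b and s is its diagonal summed with the weights v, so S - s is a centred form in the
    sense of \<open>centred_form_second_moment\<close>, and Q is the sum that controls its second
    moment.\<close>
  define b where "b = (\<lambda>j k. \<Sum>i\<in>I. a j i * v i * a i k)"
  define \<delta> where "\<delta> = expectation (\<lambda>\<omega>. \<bar>S \<omega> - s\<bar>)"
  define \<phi> where "\<phi> = (\<lambda>t. expectation (\<lambda>\<omega>. iexp (t * G \<omega>)))"
  have [measurable]: "G \<in> borel_measurable M" "i \<in> I \<Longrightarrow> c i \<in> borel_measurable M" for i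
    unfolding G_def c_def by measurable
  then have [measurable]: "S \<in> borel_measurable M"
    unfolding S_def by measurable
  have c2: "integrable M (\<lambda>\<omega>. (c i \<omega>)\<^sup>2)" and \<xi>c: "integrable M (\<lambda>\<omega>. \<xi> i \<omega> * c i \<omega>)"
    and ibp_c: "expectation (\<lambda>\<omega>. complex_of_real (\<xi> i \<omega> * c i \<omega>) * iexp (t * G \<omega>)) =
      \<i> * v i * (2 * t) * expectation (\<lambda>\<omega>. complex_of_real ((c i \<omega>)\<^sup>2) * iexp (t * G \<omega>))"
    if "i \<in> I" for i t
    unfolding c_def G_def
    by (rule quadratic_form_integration_by_parts[where a = a]; auto simp: that diag intro: sym)+
  have G2: "integrable M (\<lambda>\<omega>. (G \<omega>)\<^sup>2)"
    unfolding G_def by (rule off_diag_form_second_moment[OF diag])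
  have s: "s = (\<Sum>j\<in>I. b j j * v j)"
  proof -
    have "s = (\<Sum>j\<in>I. \<Sum>i\<in>I. (a j i * v i * a i j) * v j)"
      unfolding s_def
      by (intro sum.cong refl) (simp add: power2_eq_square sym mult_ac)
    then show ?thesis
      by (simp add: b_def sum_distrib_right)
  qed
  have S: "S \<omega> = (\<Sum>j\<in>I. \<Sum>k\<in>I. b j k * (\<xi> j \<omega> * \<xi> k \<omega>))" for \<omega>
  proof -
    have "S \<omega> = (\<Sum>i\<in>I. \<Sum>j\<in>I. \<Sum>k\<in>I. (a j i * v i * a i k) * (\<xi> j \<omega> * \<xi> k \<omega>))"
      unfolding S_def c_def power2_eq_square sum_distrib_left sum_distrib_right
      by (intro sum.cong refl) (simp add: sym mult_ac)
    also have "\<dots> = (\<Sum>j\<in>I. \<Sum>i\<in>I. \<Sum>k\<in>I. (a j i * v i * a i k) * (\<xi> j \<omega> * \<xi> k \<omega>))"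
      by (rule sum.swap)
    also have "\<dots> = (\<Sum>j\<in>I. \<Sum>k\<in>I. \<Sum>i\<in>I. (a j i * v i * a i k) * (\<xi> j \<omega> * \<xi> k \<omega>))"
      by (intro sum.cong refl sum.swap)
    finally show ?thesis
      by (simp add: b_def sum_distrib_right)
  qed
  have Ss2: "integrable M (\<lambda>\<omega>. (S \<omega> - s)\<^sup>2)" "expectation (\<lambda>\<omega>. (S \<omega> - s)\<^sup>2) \<le> 4 * Q"
    using centred_form_second_moment[of b] unfolding S s Q_def b_def by simp_all
  have Ss1: "integrable M (\<lambda>\<omega>. S \<omega> - s)"
    by (rule integrable_of_square) (use Ss2 in auto)
  have Sint: "integrable M S"
    unfolding S_def using c2 by simp
  have "\<delta> \<le> sqrt (expectation (\<lambda>\<omega>. (S \<omega> - s)\<^sup>2))"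
    unfolding \<delta>_def by (rule expectation_abs_le_sqrt) (use Ss2 in auto)
  also have "\<dots> \<le> sqrt (4 * Q)"
    using Ss2 by simp
  finally have \<delta>: "\<delta> \<le> 2 * sqrt Q"
    by (simp add: real_sqrt_mult)
  have "\<delta> \<ge> 0" unfolding \<delta>_def by simp
  have "s \<ge> 0"
    unfolding s_def by (intro sum_nonneg mult_nonneg_nonneg) (auto intro: less_imp_le v_pos)
  have alg1: "\<i> * (\<i> * complex_of_real x * y) = complex_of_real (- x) * y"
    and alg2: "complex_of_real (- x) * y + complex_of_real (x * w) * z = complex_of_real (- x) * (y - complex_of_real w * z)"
    for x w y z
    by (simp_all add: right_diff_distrib flip: mult.assoc)
  have EG: "\<i> * expectation (\<lambda>\<omega>. complex_of_real (G \<omega>) * iexp (t * G \<omega>)) =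
      complex_of_real (- (2 * t)) * expectation (\<lambda>\<omega>. complex_of_real (S \<omega>) * iexp (t * G \<omega>))" for t
  proof -
    have "complex_of_real (G \<omega>) * iexp (t * G \<omega>) =
        (\<Sum>i\<in>I. complex_of_real (\<xi> i \<omega> * c i \<omega>) * iexp (t * G \<omega>))" for \<omega>
    proof -
      have "G \<omega> = (\<Sum>i\<in>I. \<xi> i \<omega> * c i \<omega>)"
        unfolding G_def c_def sum_distrib_left by (simp add: mult_ac)
      then have "complex_of_real (G \<omega>) = (\<Sum>i\<in>I. complex_of_real (\<xi> i \<omega> * c i \<omega>))"
        by (simp only: of_real_sum)
      then show ?thesis
        by (simp only: sum_distrib_right)
    qed
    then have "expectation (\<lambda>\<omega>. complex_of_real (G \<omega>) * iexp (t * G \<omega>)) =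
        (\<Sum>i\<in>I. expectation (\<lambda>\<omega>. complex_of_real (\<xi> i \<omega> * c i \<omega>) * iexp (t * G \<omega>)))"
      using \<xi>c by (simp only:) (intro Bochner_Integration.integral_sum integrable_mult_iexp, auto)
    also have "\<dots> = (\<Sum>i\<in>I. \<i> * (2 * t) * (v i * expectation (\<lambda>\<omega>. complex_of_real ((c i \<omega>)\<^sup>2) * iexp (t * G \<omega>))))"
      by (intro sum.cong refl) (simp only: ibp_c mult_ac)
    also have "\<dots> = \<i> * (2 * t) * (\<Sum>i\<in>I. v i * expectation (\<lambda>\<omega>. complex_of_real ((c i \<omega>)\<^sup>2) * iexp (t * G \<omega>)))"
      by (simp only: sum_distrib_left)
    also have "(\<Sum>i\<in>I. v i * expectation (\<lambda>\<omega>. complex_of_real ((c i \<omega>)\<^sup>2) * iexp (t * G \<omega>))) =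
        (\<Sum>i\<in>I. expectation (\<lambda>\<omega>. complex_of_real (v i) * (complex_of_real ((c i \<omega>)\<^sup>2) * iexp (t * G \<omega>))))"
      by (simp only: integral_mult_right_zero)
    also have "\<dots> = expectation (\<lambda>\<omega>. \<Sum>i\<in>I. complex_of_real (v i) * (complex_of_real ((c i \<omega>)\<^sup>2) * iexp (t * G \<omega>)))"
      by (rule Bochner_Integration.integral_sum[symmetric])
        (intro integrable_mult_right integrable_mult_iexp c2, auto)
    also have "\<dots> = expectation (\<lambda>\<omega>. complex_of_real (S \<omega>) * iexp (t * G \<omega>))"
      by (simp add: S_def sum_distrib_right mult.assoc)
    finally show ?thesis
      by (simp only: alg1)
  qed
  define D where "D = (\<lambda>t. complex_of_real (- (2 * t)) * expectation (\<lambda>\<omega>. complex_of_real (S \<omega>) * iexp (t * G \<omega>)))"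
  have D: "(\<phi> has_vector_derivative D t) (at t)" for t
    unfolding \<phi>_def D_def EG[symmetric] by (rule has_vector_derivative_expectation_iexp) (use G2 in auto)
  have D_bound: "cmod (D t + complex_of_real (2 * t * s) * \<phi> t) \<le> 2 * \<bar>t\<bar> * \<delta>" for t
  proof -
    have "expectation (\<lambda>\<omega>. complex_of_real (S \<omega> - s) * iexp (t * G \<omega>)) =
        expectation (\<lambda>\<omega>. complex_of_real (S \<omega>) * iexp (t * G \<omega>) - complex_of_real s * iexp (t * G \<omega>))"
      by (simp only: of_real_diff left_diff_distrib)
    also have "\<dots> = expectation (\<lambda>\<omega>. complex_of_real (S \<omega>) * iexp (t * G \<omega>)) - s * \<phi> t"
      unfolding \<phi>_def integral_mult_right_zero[symmetric]
      by (intro Bochner_Integration.integral_diff integrable_mult_iexp integrable_mult_right integrable_iexp Sint) auto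
    finally have "D t + complex_of_real (2 * t * s) * \<phi> t = complex_of_real (- (2 * t)) * expectation (\<lambda>\<omega>. complex_of_real (S \<omega> - s) * iexp (t * G \<omega>))"
      by (simp only: D_def alg2)
    also have "cmod \<dots> = 2 * \<bar>t\<bar> * cmod (expectation (\<lambda>\<omega>. complex_of_real (S \<omega> - s) * iexp (t * G \<omega>)))"
      by (simp only: norm_mult norm_of_real abs_minus_cancel abs_mult abs_numeral)
    also have "cmod (expectation (\<lambda>\<omega>. complex_of_real (S \<omega> - s) * iexp (t * G \<omega>))) \<le> \<delta>"
      unfolding \<delta>_def
      by (rule order_trans[OF integral_norm_bound]) (simp add: norm_mult del: of_real_diff)
    finally show ?thesis
      by (simp add: mult_left_mono)
  qed
  define \<psi> where "\<psi> = (\<lambda>t. exp (s * t\<^sup>2) *\<^sub>R \<phi> t)"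
  have \<psi>: "(\<psi> has_vector_derivative exp (s * t\<^sup>2) *\<^sub>R (D t + complex_of_real (2 * t * s) * \<phi> t)) (at t within T)" for t T
    unfolding \<psi>_def
    by (rule has_vector_derivative_eq_rhs[OF has_vector_derivative_scaleR
          [of _ "2 * t * s * exp (s * t\<^sup>2)"]])
      (auto intro!: derivative_eq_intros has_vector_derivative_at_within[OF D]
        simp: scaleR_conv_of_real algebra_simps simp flip: exp_of_real)
  \<comment> \<open>A bound for the derivative of \<open>\<psi>\<close> on the interval from -|t| to
    |t|, which is symmetric so that the sign of t does not matter; it uses s \<ge> 0. The
    exponential factor cancels when the estimate for \<open>\<psi>\<close> is turned back into one
    for \<open>\<phi>\<close>.\<close>
  define K where "K = exp (s * t\<^sup>2) * (2 * \<bar>t\<bar> * \<delta>)"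
  have "norm (\<psi> t - \<psi> 0) \<le> K * norm (t - 0)"
  proof (rule differentiable_bound[of "{-\<bar>t\<bar>..\<bar>t\<bar>}"])
    show "(\<psi> has_derivative (\<lambda>h. h *\<^sub>R (exp (s * x\<^sup>2) *\<^sub>R (D x + complex_of_real (2 * x * s) * \<phi> x)))) (at x within {-\<bar>t\<bar>..\<bar>t\<bar>})" for x
      using \<psi> unfolding has_vector_derivative_def .
    fix x :: real assume "x \<in> {-\<bar>t\<bar>..\<bar>t\<bar>}"
    then have x: "\<bar>x\<bar> \<le> \<bar>t\<bar>" "x\<^sup>2 \<le> t\<^sup>2"
      by (auto simp: abs_le_square_iff[symmetric])
    have "norm (exp (s * x\<^sup>2) *\<^sub>R (D x + complex_of_real (2 * x * s) * \<phi> x)) \<le> exp (s * x\<^sup>2) * (2 * \<bar>x\<bar> * \<delta>)"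
      using mult_left_mono[OF D_bound[of x], of "exp (s * x\<^sup>2)"] by simp
    also have "\<dots> \<le> K"
      unfolding K_def using x \<open>s \<ge> 0\<close> \<open>\<delta> \<ge> 0\<close>
      by (intro mult_mono) (auto intro: mult_left_mono)
    finally have *: "norm (exp (s * x\<^sup>2) *\<^sub>R (D x + complex_of_real (2 * x * s) * \<phi> x)) \<le> K" .
    show "onorm (\<lambda>h. h *\<^sub>R (exp (s * x\<^sup>2) *\<^sub>R (D x + complex_of_real (2 * x * s) * \<phi> x))) \<le> K"
    proof (rule onorm_le)
      fix h :: real
      show "norm (h *\<^sub>R (exp (s * x\<^sup>2) *\<^sub>R (D x + complex_of_real (2 * x * s) * \<phi> x))) \<le> K * norm h"
        using mult_right_mono[OF *, of "norm h"] unfolding norm_scaleR[of h] by (simp only: mult.commute real_norm_def abs_ge_zero simp_thms)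
    qed
  qed auto
  moreover have "\<psi> 0 = 1"
    by (simp add: \<psi>_def \<phi>_def prob_space)
  ultimately have "norm (exp (- (s * t\<^sup>2)) *\<^sub>R (\<psi> t - 1)) \<le> exp (- (s * t\<^sup>2)) * (K * \<bar>t\<bar>)"
    by (simp add: mult_left_mono)
  also have "exp (- (s * t\<^sup>2)) *\<^sub>R (\<psi> t - 1) = \<phi> t - exp (- (s * t\<^sup>2))"
    by (simp add: \<psi>_def scaleR_diff_right exp_minus) (simp add: scaleR_conv_of_real exp_minus flip: exp_of_real)
  also have "exp (- (s * t\<^sup>2)) * (K * \<bar>t\<bar>) = 2 * (\<bar>t\<bar> * \<bar>t\<bar>) * \<delta>"
    by (simp add: K_def exp_minus del: abs_mult_self_eq)
  \<comment> \<open>The constant 4 combines the 2 of the differential equation with the 2 in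
    \<delta> \<le> 2 sqrt Q.\<close>
  also have "\<dots> \<le> 4 * t\<^sup>2 * sqrt Q"
    using mult_left_mono[OF \<delta>, of "2 * t\<^sup>2"] by (simp add: power2_eq_square)
  finally show ?thesis
    unfolding \<phi>_def .
qed

end

section \<open>Step functions and existence of the double Wiener integral\<close>

definition matrix_step :: "nat \<Rightarrow> (nat \<Rightarrow> real) \<Rightarrow> (nat \<Rightarrow> nat \<Rightarrow> real) \<Rightarrow> real \<times> real \<Rightarrow> real" where
  "matrix_step n \<tau> a = (\<lambda>(x, y). \<Sum>i<n. \<Sum>j<n.
     a i j * indicator {\<tau> i<..\<tau> (Suc i)} x * indicator {\<tau> j<..\<tau> (Suc j)} y)"

definition off_diag :: "(nat \<Rightarrow> nat \<Rightarrow> real) \<Rightarrow> nat \<Rightarrow> nat \<Rightarrow> real" where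
  "off_diag a i j = (if i = j then 0 else a i j)"

lemma sum_off_diag:
  fixes X Y :: "nat \<Rightarrow> real"
  shows "(\<Sum>i<n. \<Sum>j\<in>{..<n} - {i}. a i j * X i * Y j) = (\<Sum>i<n. \<Sum>j<n. off_diag a i j * X i * Y j)"
proof (rule sum.cong[OF refl])
  fix i assume "i \<in> {..<n}"
  then have "(\<Sum>j<n. off_diag a i j * X i * Y j) =
      off_diag a i i * X i * Y i + (\<Sum>j\<in>{..<n} - {i}. off_diag a i j * X i * Y j)"
    by (subst sum.remove[of "{..<n}" i]) auto
  also have "(\<Sum>j\<in>{..<n} - {i}. off_diag a i j * X i * Y j) = (\<Sum>j\<in>{..<n} - {i}. a i j * X i * Y j)"
    by (intro sum.cong) (auto simp: off_diag_def)
  finally show "(\<Sum>j\<in>{..<n} - {i}. a i j * X i * Y j) = (\<Sum>j<n. off_diag a i j * X i * Y j)"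
    by (simp add: off_diag_def)
qed

lemma off_diag_step_eq_matrix_step: "off_diag_step n \<tau> a = matrix_step n \<tau> (off_diag a)"
  unfolding off_diag_step_def matrix_step_def sum_off_diag ..

lemma borel_measurable_matrix_step[measurable]: "matrix_step n \<tau> a \<in> borel_measurable borel"
  unfolding matrix_step_def borel_prod[symmetric] by measurable

section \<open>Step functions on a partition: norms and contractions\<close>

locale partition =
  fixes n :: nat and \<tau> :: "nat \<Rightarrow> real"
  assumes \<tau>_less: "i < n \<Longrightarrow> \<tau> i < \<tau> (Suc i)"
begin

abbreviation cell :: "nat \<Rightarrow> real set" where
  "cell i \<equiv> {\<tau> i<..\<tau> (Suc i)}"

abbreviation v :: "nat \<Rightarrow> real" where
  "v i \<equiv> \<tau> (Suc i) - \<tau> i"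

lemma \<tau>_mono: "i \<le> j \<Longrightarrow> j \<le> n \<Longrightarrow> \<tau> i \<le> \<tau> j"
proof (induction j rule: dec_induct)
  case (step k)
  then show ?case using \<tau>_less[of k] by simp
qed simp

lemma cell_unique:
  assumes "i < n" "j < n" "x \<in> cell i" "x \<in> cell j"
  shows "i = j"
proof (rule ccontr)
  assume "i \<noteq> j"
  then have "Suc i \<le> j \<or> Suc j \<le> i"
    by auto
  then show False
    using \<tau>_mono[of "Suc i" j] \<tau>_mono[of "Suc j" i] assms by auto
qed

lemma indicator_cell:
  assumes "p < n" "x \<in> cell p" "i < n"
  shows "indicator (cell i) x = (if i = p then 1 else 0 :: real)"
proof (cases "i = p")
  case False
  then have "x \<notin> cell i"
    using cell_unique[OF assms(3,1) _ assms(2)] by blast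
  then show ?thesis
    using False by (simp only: indicator_simps if_False simp_thms)
qed (use assms in simp)

lemma sum_indicator_cell:
  fixes f :: "nat \<Rightarrow> real"
  assumes "p < n" "x \<in> cell p"
  shows "(\<Sum>i<n. f i * indicator (cell i) x) = f p"
proof -
  have "(\<Sum>i<n. f i * indicator (cell i) x) = (\<Sum>i<n. if i = p then f i else 0)"
    by (intro sum.cong refl) (simp add: indicator_cell[OF assms])
  then show ?thesis
    using assms by simp
qed

lemma matrix_step_fst: "matrix_step n \<tau> a (x, y) = (\<Sum>i<n. (\<Sum>j<n. a i j * indicator (cell j) y) * indicator (cell i) x)"
  unfolding matrix_step_def prod.case sum_distrib_right by (simp add: mult_ac)

lemma matrix_step_snd: "matrix_step n \<tau> a (x, y) = (\<Sum>j<n. (\<Sum>i<n. a i j * indicator (cell i) x) * indicator (cell j) y)"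
  unfolding matrix_step_def prod.case sum_distrib_right by (subst sum.swap) (simp add: mult_ac)

lemma matrix_step_cell:
  "p < n \<Longrightarrow> x \<in> cell p \<Longrightarrow> q < n \<Longrightarrow> y \<in> cell q \<Longrightarrow> matrix_step n \<tau> a (x, y) = a p q"
  by (simp only: matrix_step_fst sum_indicator_cell)

lemma matrix_step_outside:
  assumes "\<not> (\<exists>p<n. x \<in> cell p) \<or> \<not> (\<exists>q<n. y \<in> cell q)"
  shows "matrix_step n \<tau> a (x, y) = 0"
proof -
  have "indicator (cell i) x * indicator (cell j) y = (0 :: real)" if "i < n" "j < n" for i j
    using assms that by (auto simp: indicator_def)
  then show ?thesis
    unfolding matrix_step_def prod.case mult.assoc
    by (intro sum.neutral ballI) (simp only: lessThan_iff mult_zero_right)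
qed

lemma v_pos: "i < n \<Longrightarrow> 0 < v i"
  using \<tau>_less by simp

lemma vv_nonneg: "i < n \<Longrightarrow> j < n \<Longrightarrow> 0 \<le> v i * v j"
  using v_pos by (intro mult_nonneg_nonneg less_imp_le)

lemma weighted_square_sum_nonneg: "0 \<le> (\<Sum>i<n. \<Sum>j<n. (a i j)\<^sup>2 * (v i * v j))"
  by (intro sum_nonneg mult_nonneg_nonneg[OF zero_le_power2 vv_nonneg]) auto

text \<open>A point lies in at most one of the rectangles, so squaring produces no mixed
  terms.\<close>

lemma matrix_step_square:
  "(matrix_step n \<tau> a (x, y))\<^sup>2 = (\<Sum>i<n. \<Sum>j<n. (a i j)\<^sup>2 * indicator (cell i \<times> cell j) (x, y))"
proof (cases "(\<exists>p<n. x \<in> cell p) \<and> (\<exists>q<n. y \<in> cell q)")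
  case True
  then obtain p q where pq: "p < n" "x \<in> cell p" "q < n" "y \<in> cell q"
    by blast
  have "(\<Sum>i<n. \<Sum>j<n. (a i j)\<^sup>2 * indicator (cell i \<times> cell j) (x, y)) = matrix_step n \<tau> (\<lambda>i j. (a i j)\<^sup>2) (x, y)"
    by (simp add: matrix_step_def indicator_times mult.assoc)
  with pq show ?thesis
    by (simp add: matrix_step_cell)
next
  case False
  then have "(\<Sum>i<n. \<Sum>j<n. (a i j)\<^sup>2 * indicator (cell i \<times> cell j) (x, y)) = 0"
    by (intro sum.neutral ballI) (auto simp: indicator_def)
  with False show ?thesis
    by (subst matrix_step_outside) auto
qed

lemma nn_integral_matrix_step_square:
  "(\<integral>\<^sup>+z. ennreal ((matrix_step n \<tau> a z)\<^sup>2) \<partial>lborel) = ennreal (\<Sum>i<n. \<Sum>j<n. (a i j)\<^sup>2 * (v i * v j))"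
proof -
  have [measurable]: "cell i \<times> cell j \<in> sets borel" for i j
    by (simp add: borel_Times)
  have rect: "(\<integral>\<^sup>+z. indicator (cell i \<times> cell j) z \<partial>lborel) = ennreal (v i * v j)"
    if "i < n" "j < n" for i j
  proof -
    have "cell i \<times> cell j \<in> sets lborel"
      by (simp add: borel_Times)
    then have "(\<integral>\<^sup>+z. indicator (cell i \<times> cell j) z \<partial>lborel) = emeasure (lborel \<Otimes>\<^sub>M lborel) (cell i \<times> cell j)"
      unfolding lborel_prod by simp
    also have "\<dots> = emeasure lborel (cell i) * emeasure lborel (cell j)"
      by (rule lborel.emeasure_pair_measure_Times) auto
    also have "\<dots> = ennreal (v i * v j)"
      using v_pos[OF that(1)] v_pos[OF that(2)] by (simp add: ennreal_mult)
    finally show ?thesis .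
  qed
  have "ennreal ((matrix_step n \<tau> a z)\<^sup>2) =
      (\<Sum>i<n. \<Sum>j<n. ennreal ((a i j)\<^sup>2) * indicator (cell i \<times> cell j) z)" for z
    by (cases z) (simp only: matrix_step_square sum_ennreal[symmetric] sum_nonneg mult_nonneg_nonneg
        zero_le_power2 indicator_pos_le ennreal_mult ennreal_indicator)
  then have "(\<integral>\<^sup>+z. ennreal ((matrix_step n \<tau> a z)\<^sup>2) \<partial>lborel) =
      (\<integral>\<^sup>+z. (\<Sum>i<n. \<Sum>j<n. ennreal ((a i j)\<^sup>2) * indicator (cell i \<times> cell j) z) \<partial>lborel)"
    by (simp only:)
  also have "\<dots> = (\<Sum>i<n. \<integral>\<^sup>+z. (\<Sum>j<n. ennreal ((a i j)\<^sup>2) * indicator (cell i \<times> cell j) z) \<partial>lborel)"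
    by (rule nn_integral_sum) measurable
  also have "\<dots> = (\<Sum>i<n. \<Sum>j<n. \<integral>\<^sup>+z. ennreal ((a i j)\<^sup>2) * indicator (cell i \<times> cell j) z \<partial>lborel)"
    by (intro sum.cong refl nn_integral_sum) measurable
  also have "\<dots> = (\<Sum>i<n. \<Sum>j<n. ennreal ((a i j)\<^sup>2) * (\<integral>\<^sup>+z. indicator (cell i \<times> cell j) z \<partial>lborel))"
    by (intro sum.cong refl nn_integral_cmult) measurable
  also have "\<dots> = (\<Sum>i<n. \<Sum>j<n. ennreal ((a i j)\<^sup>2 * (v i * v j)))"
    by (intro sum.cong refl) (simp only: rect lessThan_iff ennreal_mult[OF zero_le_power2 vv_nonneg])
  also have "\<dots> = ennreal (\<Sum>i<n. \<Sum>j<n. (a i j)\<^sup>2 * (v i * v j))"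
  proof -
    have "(\<Sum>j<n. ennreal ((a i j)\<^sup>2 * (v i * v j))) = ennreal (\<Sum>j<n. (a i j)\<^sup>2 * (v i * v j))" if "i < n" for i
      by (intro sum_ennreal mult_nonneg_nonneg[OF zero_le_power2 vv_nonneg]) (use that in auto)
    then have "(\<Sum>i<n. \<Sum>j<n. ennreal ((a i j)\<^sup>2 * (v i * v j))) = (\<Sum>i<n. ennreal (\<Sum>j<n. (a i j)\<^sup>2 * (v i * v j)))"
      by simp
    also have "\<dots> = ennreal (\<Sum>i<n. \<Sum>j<n. (a i j)\<^sup>2 * (v i * v j))"
      by (intro sum_ennreal sum_nonneg mult_nonneg_nonneg[OF zero_le_power2 vv_nonneg]) auto
    finally show ?thesis .
  qed
  finally show ?thesis .
qed

text \<open>In the variable z both factors are constant on each cell k, so integration turns the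
  contraction into the matrix product a diag(v) b. For a = b this identifies the sum Q of
  \<open>quadratic_form_char_bound\<close> as the squared norm of a contraction.\<close>

lemma matrix_step_contraction:
  "(\<integral>z. matrix_step n \<tau> a (x, z) * matrix_step n \<tau> b (z, y) \<partial>lborel) =
    matrix_step n \<tau> (\<lambda>i j. \<Sum>k<n. a i k * v k * b k j) (x, y)"
proof -
  define A where "A k = (\<Sum>i<n. a i k * indicator (cell i) x)" for k
  define C where "C k = (\<Sum>j<n. b k j * indicator (cell j) y)" for k
  have "matrix_step n \<tau> a (x, z) * matrix_step n \<tau> b (z, y) = (\<Sum>k<n. (A k * C k) * indicator (cell k) z)" for z
  proof (cases "\<exists>p<n. z \<in> cell p")
    case True
    then obtain p where p: "p < n" "z \<in> cell p"
      by blast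
    have "matrix_step n \<tau> a (x, z) = A p" "matrix_step n \<tau> b (z, y) = C p"
      unfolding matrix_step_snd[of a] matrix_step_fst[of b] A_def C_def by (rule sum_indicator_cell[OF p])+
    then show ?thesis
      by (simp only: sum_indicator_cell[OF p])
  next
    case False
    then show ?thesis
      by (subst matrix_step_outside) auto
  qed
  then have "(\<integral>z. matrix_step n \<tau> a (x, z) * matrix_step n \<tau> b (z, y) \<partial>lborel) =
      (\<integral>z. (\<Sum>k<n. (A k * C k) * indicator (cell k) z) \<partial>lborel)"
    by (simp only:)
  also have "\<dots> = (\<Sum>k<n. \<integral>z. (A k * C k) * indicator (cell k) z \<partial>lborel)"
  proof (rule Bochner_Integration.integral_sum, rule integrable_mult_right, rule integrable_real_indicator)
    fix k
    show "emeasure lborel (cell k) < \<infinity>"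
      by (rule emeasure_bounded_finite, rule bounded_subset[of "{\<tau> k..\<tau> (Suc k)}"]) auto
  qed auto
  also have "\<dots> = (\<Sum>k<n. (A k * C k) * v k)"
  proof (intro sum.cong refl)
    fix k assume "k \<in> {..<n}"
    then have "\<tau> k \<le> \<tau> (Suc k)"
      using \<tau>_less[of k] by simp
    then show "(\<integral>z. (A k * C k) * indicator (cell k) z \<partial>lborel) = (A k * C k) * v k"
      by simp
  qed
  \<comment> \<open>Distributing the two inner sums leaves the j-sum outside the i-sum, hence the
    swap before terms are compared.\<close>
  also have "\<dots> = (\<Sum>k<n. \<Sum>i<n. \<Sum>j<n. a i k * v k * b k j * indicator (cell i) x * indicator (cell j) y)"
    unfolding A_def C_def sum_distrib_left sum_distrib_right
    by (subst sum.swap, intro sum.cong refl) (simp add: mult_ac)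
  also have "\<dots> = (\<Sum>i<n. \<Sum>k<n. \<Sum>j<n. a i k * v k * b k j * indicator (cell i) x * indicator (cell j) y)"
    by (rule sum.swap)
  also have "\<dots> = (\<Sum>i<n. \<Sum>j<n. \<Sum>k<n. a i k * v k * b k j * indicator (cell i) x * indicator (cell j) y)"
    by (intro sum.cong refl sum.swap)
  also have "\<dots> = matrix_step n \<tau> (\<lambda>i j. \<Sum>k<n. a i k * v k * b k j) (x, y)"
    by (simp only: matrix_step_def prod.case sum_distrib_right)
  finally show ?thesis .
qed

end

lemma (in wiener_process) gaussian_family_increments:
  assumes "partition n \<tau>"
  shows "gaussian_family M {..<n} (\<lambda>i \<omega>. B (\<tau> (Suc i)) \<omega> - B (\<tau> i) \<omega>) (\<lambda>i. \<tau> (Suc i) - \<tau> i)"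
proof -
  interpret partition n \<tau> by fact
  show ?thesis
  proof
    show "indep_vars (\<lambda>_. borel) (\<lambda>i \<omega>. B (\<tau> (Suc i)) \<omega> - B (\<tau> i) \<omega>) {..<n}"
      by (rule independent_increments) (rule \<tau>_less)
    fix i assume "i \<in> {..<n}"
    then have "\<tau> i < \<tau> (Suc i)"
      using \<tau>_less by blast
    then show "0 < \<tau> (Suc i) - \<tau> i"
      and "distributed M lborel (\<lambda>\<omega>. B (\<tau> (Suc i)) \<omega> - B (\<tau> i) \<omega>) (normal_density 0 (sqrt (\<tau> (Suc i) - \<tau> i)))"
      by (simp, rule gaussian_increments)
  qed simp
qed

lemma off_diag_step_integral_eq:
  "off_diag_step_integral B n \<tau> a \<omega> = (\<Sum>i<n. \<Sum>j<n. off_diag a i j *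
     ((B (\<tau> (Suc i)) \<omega> - B (\<tau> i) \<omega>) * (B (\<tau> (Suc j)) \<omega> - B (\<tau> j) \<omega>)))"
  unfolding off_diag_step_integral_def sum_off_diag by (simp add: mult.assoc)

context wiener_process
begin

lemma borel_measurable_off_diag_step_integral[measurable]:
  "off_diag_step_integral B n \<tau> a \<in> borel_measurable M"
proof -
  note [measurable] = random_variable_B
  show ?thesis
    unfolding off_diag_step_integral_def by measurable
qed

text \<open>The upper half of the Ito isometry. It suffices for everything that concerns continuity
  of the integral, and it holds without symmetry of the coefficients.\<close>

lemma off_diag_step_integral_second_moment:
  assumes "partition n \<tau>"
  shows "(\<integral>\<^sup>+\<omega>. ennreal ((off_diag_step_integral B n \<tau> a \<omega>)\<^sup>2) \<partial>M)
    \<le> 2 * (\<integral>\<^sup>+z. ennreal ((off_diag_step n \<tau> a z)\<^sup>2) \<partial>lborel)"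
proof -
  interpret partition n \<tau> by fact
  interpret g: gaussian_family M "{..<n}" "\<lambda>i \<omega>. B (\<tau> (Suc i)) \<omega> - B (\<tau> i) \<omega>" v
    by (rule gaussian_family_increments) fact
  have 0: "off_diag a i i = 0" for i
    by (simp add: off_diag_def)
  have "(\<integral>\<^sup>+\<omega>. ennreal ((off_diag_step_integral B n \<tau> a \<omega>)\<^sup>2) \<partial>M) = ennreal (expectation (\<lambda>\<omega>. (off_diag_step_integral B n \<tau> a \<omega>)\<^sup>2))"
    unfolding off_diag_step_integral_eq
    by (rule nn_integral_eq_integral[OF g.off_diag_form_second_moment(1)]) (auto simp: 0)
  also have "\<dots> \<le> ennreal (2 * (\<Sum>i<n. \<Sum>j<n. (off_diag a i j)\<^sup>2 * (v i * v j)))"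
    unfolding off_diag_step_integral_eq by (intro ennreal_leI g.off_diag_form_second_moment(2)) (auto simp: 0)
  also have "\<dots> = 2 * (\<integral>\<^sup>+z. ennreal ((off_diag_step n \<tau> a z)\<^sup>2) \<partial>lborel)"
    unfolding off_diag_step_eq_matrix_step nn_integral_matrix_step_square
    by (simp add: ennreal_mult weighted_square_sum_nonneg del: sum_ennreal)
  finally show ?thesis .
qed

end

text \<open>The squared distance with values in the extended nonnegative reals: it can be
  manipulated before integrability is known, and the triangle inequality takes the form with factors
  2.\<close>

definition sqdist :: "'b measure \<Rightarrow> ('b \<Rightarrow> real) \<Rightarrow> ('b \<Rightarrow> real) \<Rightarrow> ennreal" where
  "sqdist N f g = (\<integral>\<^sup>+z. ennreal ((f z - g z)\<^sup>2) \<partial>N)"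

lemma sqdist_commute: "sqdist N f g = sqdist N g f"
  by (simp add: sqdist_def power2_commute)

lemma sqdist_triangle:
  assumes [measurable]: "f \<in> borel_measurable N" "g \<in> borel_measurable N" "h \<in> borel_measurable N"
  shows "sqdist N f h \<le> 2 * sqdist N f g + 2 * sqdist N g h"
proof -
  have "sqdist N f h \<le> (\<integral>\<^sup>+z. 2 * ennreal ((f z - g z)\<^sup>2) + 2 * ennreal ((g z - h z)\<^sup>2) \<partial>N)"
    unfolding sqdist_def
  proof (rule nn_integral_mono)
    fix z
    have "ennreal ((f z - h z)\<^sup>2) \<le> ennreal (2 * (f z - g z)\<^sup>2 + 2 * (g z - h z)\<^sup>2)"
      using power2_add_le[of "f z - g z" "g z - h z"] by (intro ennreal_leI) simp
    also have "\<dots> = 2 * ennreal ((f z - g z)\<^sup>2) + 2 * ennreal ((g z - h z)\<^sup>2)"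
      by (simp add: ennreal_mult)
    finally show "ennreal ((f z - h z)\<^sup>2) \<le> 2 * ennreal ((f z - g z)\<^sup>2) + 2 * ennreal ((g z - h z)\<^sup>2)" .
  qed
  also have "\<dots> = 2 * sqdist N f g + 2 * sqdist N g h"
    by (simp add: sqdist_def nn_integral_add nn_integral_cmult)
  finally show ?thesis .
qed

lemma sqdist_dominated_convergence:
  assumes [measurable]: "\<And>k. f k \<in> borel_measurable N" "h \<in> borel_measurable N" "w \<in> borel_measurable N"
    and dom: "\<And>k z. (f k z - h z)\<^sup>2 \<le> w z" and "(\<integral>\<^sup>+z. ennreal (w z) \<partial>N) < \<infinity>"
    and lim: "AE z in N. (\<lambda>k. f k z) \<longlonglongrightarrow> h z"
  shows "(\<lambda>k. sqdist N (f k) h) \<longlonglongrightarrow> 0"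
proof -
  have "(\<lambda>k. \<integral>\<^sup>+z. ennreal ((f k z - h z)\<^sup>2) \<partial>N) \<longlonglongrightarrow> (\<integral>\<^sup>+z. 0 \<partial>N)"
  proof (rule nn_integral_dominated_convergence[where w = "\<lambda>z. ennreal (w z)"])
    show "AE z in N. (\<lambda>k. ennreal ((f k z - h z)\<^sup>2)) \<longlonglongrightarrow> 0"
      using lim
    proof eventually_elim
      fix z assume "(\<lambda>k. f k z) \<longlonglongrightarrow> h z"
      then have "(\<lambda>k. ennreal ((f k z - h z)\<^sup>2)) \<longlonglongrightarrow> ennreal ((h z - h z)\<^sup>2)"
        by (intro tendsto_ennrealI tendsto_intros)
      then show "(\<lambda>k. ennreal ((f k z - h z)\<^sup>2)) \<longlonglongrightarrow> 0"
        by simp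
    qed
  qed (use assms in \<open>auto intro: ennreal_leI\<close>)
  then show ?thesis
    by (simp add: sqdist_def)
qed

lemma L2_converges_eq: "L2_converges N g h \<longleftrightarrow> (\<lambda>k. sqdist N (g k) h) \<longlonglongrightarrow> 0"
  by (simp add: L2_converges_def sqdist_def)

section \<open>Nested dyadic grids\<close>

definition dyadic_count :: "nat \<Rightarrow> nat" where
  "dyadic_count m = 2 * 4 ^ m"

text \<open>The mesh 1 / 2^m and the window from -2^m to 2^m improve together; the length 2 * 2^m of
  the window divided by the mesh gives the 2 * 4^m cells of \<open>dyadic_count\<close>.\<close>

definition dyadic_point :: "nat \<Rightarrow> nat \<Rightarrow> real" where
  "dyadic_point m i = real i / 2 ^ m - 2 ^ m"

lemma real_dyadic_count: "real (dyadic_count m) = 2 * 2 ^ m * 2 ^ m"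
proof -
  have "(2 :: real) ^ m * 2 ^ m = 4 ^ m"
    by (simp flip: power_mult_distrib)
  then show ?thesis
    by (simp add: dyadic_count_def mult.assoc)
qed

abbreviation dyadic_cell :: "nat \<Rightarrow> nat \<Rightarrow> real set" where
  "dyadic_cell m i \<equiv> {dyadic_point m i<..dyadic_point m (Suc i)}"

abbreviation dyadic_integral :: "(real \<Rightarrow> 'a \<Rightarrow> real) \<Rightarrow> nat \<Rightarrow> (nat \<Rightarrow> nat \<Rightarrow> real) \<Rightarrow> 'a \<Rightarrow> real" where
  "dyadic_integral B m \<equiv> off_diag_step_integral B (dyadic_count m) (dyadic_point m)"

abbreviation dyadic_step :: "nat \<Rightarrow> (nat \<Rightarrow> nat \<Rightarrow> real) \<Rightarrow> real \<times> real \<Rightarrow> real" where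
  "dyadic_step m \<equiv> off_diag_step (dyadic_count m) (dyadic_point m)"

lemma dyadic_point_Suc: "dyadic_point m (Suc i) = dyadic_point m i + 1 / 2 ^ m"
  by (simp add: dyadic_point_def add_divide_distrib)

lemma partition_dyadic: "partition (dyadic_count m) (dyadic_point m)"
  by standard (simp add: dyadic_point_Suc)

lemma dyadic_cell_covers:
  assumes "\<bar>x\<bar> < 2 ^ m"
  obtains p where "p < dyadic_count m" "x \<in> dyadic_cell m p"
    "\<bar>dyadic_point m p - x\<bar> \<le> 1 / 2 ^ m"
proof
  let ?y = "(x + 2 ^ m) * 2 ^ m"
  \<comment> \<open>The ceiling minus one rather than the floor, since cells contain their right but
    not their left endpoint.\<close>
  define p where "p = nat (\<lceil>?y\<rceil> - 1)"
  have "0 < x + 2 ^ m" "x + 2 ^ m < 2 * 2 ^ m"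
    using assms by (auto simp: abs_less_iff)
  then have "0 < ?y" and y: "?y < 2 * 2 ^ m * 2 ^ m"
    by (auto intro: mult_strict_right_mono)
  have "0 < \<lceil>?y\<rceil>"
    using \<open>0 < ?y\<close> by (subst zero_less_ceiling)
  then have p: "real p = of_int \<lceil>?y\<rceil> - 1"
    by (simp add: p_def)
  have "real p < ?y" "?y \<le> real p + 1"
    unfolding p using ceiling_correct[of ?y] by linarith+
  have "real p < real (dyadic_count m)"
    using \<open>real p < ?y\<close> y real_dyadic_count[of m] by linarith
  then show "p < dyadic_count m"
    by simp
  have "real p / 2 ^ m < x + 2 ^ m" "x + 2 ^ m \<le> (real p + 1) / 2 ^ m"
    using \<open>real p < ?y\<close> \<open>?y \<le> real p + 1\<close> by (simp_all add: pos_divide_less_eq pos_le_divide_eq)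
  then show *: "x \<in> dyadic_cell m p"
    by (simp add: dyadic_point_def add.commute)
  then show "\<bar>dyadic_point m p - x\<bar> \<le> 1 / 2 ^ m"
    unfolding dyadic_point_Suc by simp
qed

text \<open>
  The grid of level \<open>m\<close> covers \<open>]-2\<^sup>m, 2\<^sup>m]\<close>, so with \<open>N = dyadic_count m\<close> its cell \<open>i\<close> is the union of the
  cells \<open>N + 2 i\<close> and \<open>N + 2 i + 1\<close> of level \<open>m + 1\<close>.
\<close>

definition refine_coeffs :: "nat \<Rightarrow> (nat \<Rightarrow> nat \<Rightarrow> real) \<Rightarrow> nat \<Rightarrow> nat \<Rightarrow> real" where
  "refine_coeffs N a i j = (if i \<in> {N..<3 * N} \<and> j \<in> {N..<3 * N}
     then off_diag a ((i - N) div 2) ((j - N) div 2) else 0)"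

text \<open>Equal fine indices lie over the same coarse cell, where the coefficient is already zero.
  The two unequal fine positions over a coarse diagonal block are zero as well, which is what keeps
  the step function and its integral unchanged under refinement.\<close>

lemma off_diag_refine_coeffs: "off_diag (refine_coeffs N a) = refine_coeffs N a"
  by (simp add: fun_eq_iff off_diag_def refine_coeffs_def)

lemma sum_pairs: "(\<Sum>i\<in>{N..<N + 2 * m}. f i) = (\<Sum>i<m. f (N + 2 * i) + f (Suc (N + 2 * i)))"
  for f :: "nat \<Rightarrow> real"
proof (induction m)
  case (Suc m)
  have "{N..<N + 2 * Suc m} = insert (Suc (N + 2 * m)) (insert (N + 2 * m) {N..<N + 2 * m})"
    by auto
  then show ?case
    using Suc by simp
qed simp

text \<open>Of the 4 N cells of the finer grid, the first and the last N lie outside the coarse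
  window; only the middle 2 N carry coefficients.\<close>

lemma sum_middle_pairs:
  fixes f :: "nat \<Rightarrow> real"
  assumes "\<And>i. i \<notin> {N..<3 * N} \<Longrightarrow> f i = 0"
  shows "(\<Sum>i<4 * N. f i) = (\<Sum>i<N. f (N + 2 * i) + f (Suc (N + 2 * i)))"
proof -
  have "(\<Sum>i<4 * N. f i) = (\<Sum>i\<in>{N..<N + 2 * N}. f i)"
    by (rule sum.mono_neutral_right) (auto intro: assms)
  then show ?thesis
    by (simp only: sum_pairs)
qed

lemma refine_coeffs_pair:
  assumes "i < N" "j < N" "d < 2" "e < 2"
  shows "refine_coeffs N a (N + 2 * i + d) (N + 2 * j + e) = off_diag a i j"
proof -
  have "(2 * i + d) div 2 = i" "(2 * j + e) div 2 = j"
    using assms by auto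
  then show ?thesis
    using assms by (simp add: refine_coeffs_def add.assoc)
qed

text \<open>Each coarse coefficient is copied to a 2 x 2 block of fine ones, and the sum over such a
  block factors into two sums over the halves of a cell.\<close>

lemma sum_refine_coeffs:
  fixes X Y :: "nat \<Rightarrow> real"
  shows "(\<Sum>i<4 * N. \<Sum>j<4 * N. refine_coeffs N a i j * X i * Y j) =
    (\<Sum>i<N. \<Sum>j<N. off_diag a i j * (X (N + 2 * i) + X (Suc (N + 2 * i))) * (Y (N + 2 * j) + Y (Suc (N + 2 * j))))"
proof -
  have pair: "refine_coeffs N a (N + 2 * i) (N + 2 * j) = off_diag a i j"
    "refine_coeffs N a (Suc (N + 2 * i)) (N + 2 * j) = off_diag a i j"
    "refine_coeffs N a (N + 2 * i) (Suc (N + 2 * j)) = off_diag a i j"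
    "refine_coeffs N a (Suc (N + 2 * i)) (Suc (N + 2 * j)) = off_diag a i j" if "i < N" "j < N" for i j
    using refine_coeffs_pair[OF that, of 0 0 a] refine_coeffs_pair[OF that, of 1 0 a]
      refine_coeffs_pair[OF that, of 0 1 a] refine_coeffs_pair[OF that, of 1 1 a] by simp_all
  have "(\<Sum>j<4 * N. refine_coeffs N a i j * X i * Y j) = (\<Sum>j<N. refine_coeffs N a i (N + 2 * j) * X i * Y (N + 2 * j)
      + refine_coeffs N a i (Suc (N + 2 * j)) * X i * Y (Suc (N + 2 * j)))" for i
    by (rule sum_middle_pairs) (auto simp: refine_coeffs_def intro!: sum.neutral)
  then have "(\<Sum>i<4 * N. \<Sum>j<4 * N. refine_coeffs N a i j * X i * Y j) = (\<Sum>i<4 * N. \<Sum>j<N.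
      refine_coeffs N a i (N + 2 * j) * X i * Y (N + 2 * j)
      + refine_coeffs N a i (Suc (N + 2 * j)) * X i * Y (Suc (N + 2 * j)))"
    by (simp only:)
  also have "\<dots> = (\<Sum>i<N. (\<Sum>j<N. refine_coeffs N a (N + 2 * i) (N + 2 * j) * X (N + 2 * i) * Y (N + 2 * j)
        + refine_coeffs N a (N + 2 * i) (Suc (N + 2 * j)) * X (N + 2 * i) * Y (Suc (N + 2 * j)))
      + (\<Sum>j<N. refine_coeffs N a (Suc (N + 2 * i)) (N + 2 * j) * X (Suc (N + 2 * i)) * Y (N + 2 * j)
        + refine_coeffs N a (Suc (N + 2 * i)) (Suc (N + 2 * j)) * X (Suc (N + 2 * i)) * Y (Suc (N + 2 * j))))"
    by (rule sum_middle_pairs) (auto simp: refine_coeffs_def intro!: sum.neutral)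
  also have "\<dots> = (\<Sum>i<N. \<Sum>j<N. off_diag a i j * (X (N + 2 * i) + X (Suc (N + 2 * i))) * (Y (N + 2 * j) + Y (Suc (N + 2 * j))))"
    unfolding sum.distrib[symmetric]
  proof (rule sum.cong[OF refl], rule sum.cong[OF refl])
    fix i j assume "i \<in> {..<N}" "j \<in> {..<N}"
    then have ij: "i < N" "j < N"
      by simp_all
    show "refine_coeffs N a (N + 2 * i) (N + 2 * j) * X (N + 2 * i) * Y (N + 2 * j)
        + refine_coeffs N a (N + 2 * i) (Suc (N + 2 * j)) * X (N + 2 * i) * Y (Suc (N + 2 * j))
      + (refine_coeffs N a (Suc (N + 2 * i)) (N + 2 * j) * X (Suc (N + 2 * i)) * Y (N + 2 * j)
        + refine_coeffs N a (Suc (N + 2 * i)) (Suc (N + 2 * j)) * X (Suc (N + 2 * i)) * Y (Suc (N + 2 * j)))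
      = off_diag a i j * (X (N + 2 * i) + X (Suc (N + 2 * i))) * (Y (N + 2 * j) + Y (Suc (N + 2 * j)))"
      unfolding pair[OF ij] by (simp only: distrib_left distrib_right add_ac)
  qed
  finally show ?thesis .
qed

text \<open>All that matters about the two interval functions is additivity over adjacent intervals.
  Indicators of half-open intervals and increments of B share this property, so one computation
  covers both the step functions and their integrals.\<close>

lemma dyadic_refine_sum:
  fixes \<psi> \<psi>' :: "real \<Rightarrow> real \<Rightarrow> real"
  assumes add: "\<And>a b c. a \<le> b \<Longrightarrow> b \<le> c \<Longrightarrow> \<psi> a b + \<psi> b c = \<psi> a c"
    "\<And>a b c. a \<le> b \<Longrightarrow> b \<le> c \<Longrightarrow> \<psi>' a b + \<psi>' b c = \<psi>' a c"
  defines "\<phi> \<equiv> \<lambda>m i. \<psi> (dyadic_point m i) (dyadic_point m (Suc i))"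
    and "\<phi>' \<equiv> \<lambda>m i. \<psi>' (dyadic_point m i) (dyadic_point m (Suc i))"
  shows "(\<Sum>i<dyadic_count (Suc m). \<Sum>j<dyadic_count (Suc m).
      off_diag (refine_coeffs (dyadic_count m) a) i j * \<phi> (Suc m) i * \<phi>' (Suc m) j) =
    (\<Sum>i<dyadic_count m. \<Sum>j<dyadic_count m. off_diag a i j * \<phi> m i * \<phi>' m j)"
proof -
  define N where "N = dyadic_count m"
  have N: "dyadic_count (Suc m) = 4 * N" "real N = 2 * 2 ^ m * 2 ^ m"
    by (simp_all only: N_def real_dyadic_count) (simp add: dyadic_count_def)
  have p: "dyadic_point (Suc m) (N + 2 * i) = dyadic_point m i" for i
    by (simp add: dyadic_point_def N add_divide_distrib)
  have q: "dyadic_point (Suc m) (Suc (Suc (N + 2 * i))) = dyadic_point m (Suc i)" for i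
    using p[of "Suc i"] by simp
  have mono: "dyadic_point k i \<le> dyadic_point k (Suc i)" for k i
    by (simp add: dyadic_point_Suc)
  have "\<phi> (Suc m) (N + 2 * i) + \<phi> (Suc m) (Suc (N + 2 * i)) = \<phi> m i" for i
    unfolding \<phi>_def using add(1)[OF mono mono, of "Suc m" "N + 2 * i"] by (simp only: p q)
  moreover have "\<phi>' (Suc m) (N + 2 * i) + \<phi>' (Suc m) (Suc (N + 2 * i)) = \<phi>' m i" for i
    unfolding \<phi>'_def using add(2)[OF mono mono, of "Suc m" "N + 2 * i"] by (simp only: p q)
  ultimately show ?thesis
    unfolding off_diag_refine_coeffs N(1) N_def[symmetric] sum_refine_coeffs by (simp only:)
qed

lemma dyadic_refine:
  assumes "k \<le> l"
  shows "\<exists>a'. dyadic_step l a' = dyadic_step k a \<and>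
    dyadic_integral B l a' =
    dyadic_integral B k a"
  using assms
proof (induction l rule: dec_induct)
  case (step l)
  then obtain a' where a': "dyadic_step l a' = dyadic_step k a"
    "dyadic_integral B l a' =
      dyadic_integral B k a"
    by blast
  let ?a = "refine_coeffs (dyadic_count l) a'"
  have "dyadic_step (Suc l) ?a = dyadic_step l a'"
    unfolding off_diag_step_eq_matrix_step matrix_step_def
  proof (intro ext, clarify)
    fix x y
    show "(\<Sum>i<dyadic_count (Suc l). \<Sum>j<dyadic_count (Suc l). off_diag ?a i j *
        indicator (dyadic_cell (Suc l) i) x *
        indicator (dyadic_cell (Suc l) j) y) =
      (\<Sum>i<dyadic_count l. \<Sum>j<dyadic_count l. off_diag a' i j *
        indicator (dyadic_cell l i) x *
        indicator (dyadic_cell l j) y)"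
      by (rule dyadic_refine_sum[where \<psi> = "\<lambda>a b. indicator {a<..b} x" and \<psi>' = "\<lambda>a b. indicator {a<..b} y"])
        (auto simp: indicator_def)
  qed
  moreover have "dyadic_integral B (Suc l) ?a =
      dyadic_integral B l a'"
    unfolding off_diag_step_integral_eq mult.assoc[symmetric]
    by (rule ext, rule dyadic_refine_sum[where \<psi> = "\<lambda>a b. B b _ - B a _" and \<psi>' = "\<lambda>a b. B b _ - B a _"]) auto
  ultimately show ?case
    using a' by auto
qed auto

lemma off_diag_step_diff: "off_diag_step n \<tau> (\<lambda>i j. a i j - b i j) z = off_diag_step n \<tau> a z - off_diag_step n \<tau> b z"
  by (cases z) (simp only: off_diag_step_def prod.case left_diff_distrib sum_subtractf)

lemma off_diag_step_integral_diff:
  "off_diag_step_integral B n \<tau> (\<lambda>i j. a i j - b i j) \<omega> = off_diag_step_integral B n \<tau> a \<omega> - off_diag_step_integral B n \<tau> b \<omega>"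
  by (simp only: off_diag_step_integral_def left_diff_distrib sum_subtractf)

text \<open>After refinement of the coarser one, both step functions have the same grid, their
  difference is an off-diagonal step function there, and the second moment bound applies to
  it.\<close>

lemma (in wiener_process) sqdist_dyadic_integrals:
  assumes "k \<le> l"
  shows "sqdist M (dyadic_integral B l b)
      (dyadic_integral B k a)
    \<le> 2 * sqdist lborel (dyadic_step l b) (dyadic_step k a)"
proof -
  obtain a' where a': "dyadic_step l a' = dyadic_step k a"
    "dyadic_integral B l a' =
      dyadic_integral B k a"
    using dyadic_refine[OF assms] by blast
  show ?thesis
    using off_diag_step_integral_second_moment[OF partition_dyadic, of l "\<lambda>i j. b i j - a' i j"]
    unfolding sqdist_def off_diag_step_diff off_diag_step_integral_diff a' .
qed

section \<open>Density of off-diagonal dyadic step functions\<close>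

lemma off_diag_step_cell:
  assumes "partition n \<tau>" "p < n" "x \<in> {\<tau> p<..\<tau> (Suc p)}" "q < n" "y \<in> {\<tau> q<..\<tau> (Suc q)}"
  shows "off_diag_step n \<tau> a (x, y) = off_diag a p q"
proof -
  interpret partition n \<tau> by fact
  show ?thesis
    unfolding off_diag_step_eq_matrix_step by (rule matrix_step_cell) fact+
qed

lemma off_diag_step_outside:
  assumes "partition n \<tau>"
    and "\<not> (\<exists>p<n. x \<in> {\<tau> p<..\<tau> (Suc p)}) \<or> \<not> (\<exists>q<n. y \<in> {\<tau> q<..\<tau> (Suc q)})"
  shows "off_diag_step n \<tau> a (x, y) = 0"
proof -
  interpret partition n \<tau> by fact
  show ?thesis
    unfolding off_diag_step_eq_matrix_step by (rule matrix_step_outside) fact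
qed

lemma borel_measurable_off_diag_step[measurable]: "off_diag_step n \<tau> a \<in> borel_measurable borel"
  unfolding off_diag_step_eq_matrix_step by simp

lemma diff_square_le_of_abs_le: "\<bar>u\<bar> \<le> K \<Longrightarrow> \<bar>w\<bar> \<le> K \<Longrightarrow> (u - w)\<^sup>2 \<le> 4 * K\<^sup>2" for u w K :: real
  using abs_le_square_iff[of "u - w" "2 * K"] by (simp add: power_mult_distrib) linarith

text \<open>
  Asking for approximants on all fine grids, rather than on some grid, makes the property stable under
  \<open>L\<^sup>2\<close>-limits and provides approximants on nested grids.
\<close>

definition dyadic_approximable :: "(real \<times> real \<Rightarrow> real) \<Rightarrow> bool" where
  "dyadic_approximable h \<longleftrightarrow>
    (\<forall>e>0. \<forall>\<^sub>F m in sequentially. \<exists>a. sqdist lborel (dyadic_step m a) h \<le> ennreal e)"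

lemma dyadic_approximable_limit:
  assumes "\<And>k. dyadic_approximable (g k)" "(\<lambda>k. sqdist lborel (g k) h) \<longlonglongrightarrow> 0"
    and [measurable]: "\<And>k. g k \<in> borel_measurable borel" "h \<in> borel_measurable borel"
  shows "dyadic_approximable h"
  unfolding dyadic_approximable_def
proof (intro allI impI)
  fix e :: real assume "e > 0"
  then have "ennreal (e / 4) > 0"
    by simp
  then obtain k where k: "sqdist lborel (g k) h < ennreal (e / 4)"
    using order_tendstoD(2)[OF assms(2)] eventually_sequentially by (metis order_refl)
  have "\<forall>\<^sub>F m in sequentially. \<exists>a. sqdist lborel (dyadic_step m a) (g k) \<le> ennreal (e / 4)"
    using assms(1)[of k] \<open>e > 0\<close> unfolding dyadic_approximable_def by simp
  then show "\<forall>\<^sub>F m in sequentially. \<exists>a. sqdist lborel (dyadic_step m a) h \<le> ennreal e"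
  proof eventually_elim
    case (elim m)
    then obtain a where a: "sqdist lborel (dyadic_step m a) (g k) \<le> ennreal (e / 4)"
      by blast
    have "sqdist lborel (dyadic_step m a) h \<le> 2 * sqdist lborel (dyadic_step m a) (g k) + 2 * sqdist lborel (g k) h"
      by (rule sqdist_triangle) auto
    also have "\<dots> \<le> 2 * ennreal (e / 4) + 2 * ennreal (e / 4)"
      using a k by (intro add_mono mult_left_mono) auto
    also have "\<dots> = ennreal (2 * (e / 4) + 2 * (e / 4))"
      using \<open>e > 0\<close> by (simp only: ennreal_plus ennreal_mult ennreal_numeral)
    also have "\<dots> = ennreal e"
      by simp
    finally show ?case by blast
  qed
qed

text \<open>Deleting the diagonal blocks is harmless at a point off the diagonal: as soon as the
  mesh is smaller than |x - y|, the coordinates lie in different cells, and the step function equals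
  a sample of g at a nearby corner.\<close>

lemma dyadic_step_samples_tendsto:
  assumes g: "continuous_on UNIV g" and "x \<noteq> y"
  shows "(\<lambda>m. dyadic_step m (\<lambda>i j. g (dyadic_point m i, dyadic_point m j)) (x, y)) \<longlonglongrightarrow> (g (x, y) :: real)"
proof (rule LIMSEQ_I)
  fix e :: real assume "e > 0"
  have "isCont g (x, y)"
    using g by (simp add: continuous_on_eq_continuous_at)
  then obtain d where "d > 0" and d: "\<And>z. dist z (x, y) < d \<Longrightarrow> dist (g z) (g (x, y)) < e"
    using \<open>e > 0\<close> unfolding continuous_at_eps_delta by metis
  have half: "(\<lambda>m. 1 / 2 ^ m :: real) \<longlonglongrightarrow> 0"
    using LIMSEQ_divide_realpow_zero[of 2 1] by simp
  have big: "\<forall>\<^sub>F m in sequentially. r < 2 ^ m" for r :: real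
  proof -
    obtain n where n: "r < 2 ^ n"
      using real_arch_pow[of 2 r] by auto
    show ?thesis
    proof (rule eventually_sequentiallyI[of n])
      fix m assume "n \<le> m"
      then have "(2 :: real) ^ n \<le> 2 ^ m"
        by (intro power_increasing) auto
      with n show "r < 2 ^ m" by linarith
    qed
  qed
  have "\<forall>\<^sub>F m in sequentially. 1 / 2 ^ m < d / 2 \<and> 1 / 2 ^ m < \<bar>x - y\<bar> \<and> \<bar>x\<bar> < 2 ^ m \<and> \<bar>y\<bar> < 2 ^ m"
    using \<open>d > 0\<close> \<open>x \<noteq> y\<close> by (intro eventually_conj order_tendstoD(2)[OF half] big) auto
  then obtain m0 where m0: "\<And>m. m \<ge> m0 \<Longrightarrow>
      1 / 2 ^ m < d / 2 \<and> 1 / 2 ^ m < \<bar>x - y\<bar> \<and> \<bar>x\<bar> < 2 ^ m \<and> \<bar>y\<bar> < 2 ^ m"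
    unfolding eventually_sequentially by blast
  show "\<exists>no. \<forall>m\<ge>no. norm (dyadic_step m (\<lambda>i j. g (dyadic_point m i, dyadic_point m j)) (x, y) - g (x, y)) < e"
  proof (intro exI[of _ m0] allI impI)
    fix m assume "m \<ge> m0"
    note m = m0[OF this]
    obtain p where p: "p < dyadic_count m" "x \<in> dyadic_cell m p"
      "\<bar>dyadic_point m p - x\<bar> \<le> 1 / 2 ^ m"
      using dyadic_cell_covers m by blast
    obtain q where q: "q < dyadic_count m" "y \<in> dyadic_cell m q"
      "\<bar>dyadic_point m q - y\<bar> \<le> 1 / 2 ^ m"
      using dyadic_cell_covers m by blast
    have "p \<noteq> q"
    proof
      assume "p = q"
      with p(2) q(2) have "\<bar>x - y\<bar> \<le> 1 / 2 ^ m"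
        unfolding dyadic_point_Suc by auto
      with m show False by linarith
    qed
    then have "dyadic_step m (\<lambda>i j. g (dyadic_point m i, dyadic_point m j)) (x, y) = g (dyadic_point m p, dyadic_point m q)"
      by (simp add: off_diag_step_cell[OF partition_dyadic p(1,2) q(1,2)] off_diag_def)
    moreover have "dist (dyadic_point m p, dyadic_point m q) (x, y) < d"
    proof -
      have "dist (dyadic_point m p, dyadic_point m q) (x, y) \<le> \<bar>dyadic_point m p - x\<bar> + \<bar>dyadic_point m q - y\<bar>"
        unfolding dist_Pair_Pair dist_real_def by (rule sqrt_sum_squares_le_sum_abs[THEN order_trans]) simp
      with p(3) q(3) m show ?thesis by linarith
    qed
    ultimately show "norm (dyadic_step m (\<lambda>i j. g (dyadic_point m i, dyadic_point m j)) (x, y) - g (x, y)) < e"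
      using d by (simp add: dist_real_def)
  qed
qed

lemma AE_lborel_off_diagonal: "AE z in lborel. fst z \<noteq> (snd z :: real)"
proof -
  have "AE z in lborel \<Otimes>\<^sub>M lborel. fst z \<noteq> (snd z :: real)"
  proof (rule lborel_pair.AE_pair_measure)
    show "{z \<in> space (lborel \<Otimes>\<^sub>M lborel). fst z \<noteq> (snd z :: real)} \<in> sets (lborel \<Otimes>\<^sub>M lborel)"
      by measurable
    show "AE x in lborel. AE y in lborel. fst (x, y) \<noteq> (snd (x, y) :: real)"
    proof (rule AE_I2)
      fix x :: real
      show "AE y in lborel. fst (x, y) \<noteq> snd (x, y)"
        using AE_lborel_singleton[of x] by eventually_elim auto
    qed
  qed
  then show ?thesis
    unfolding lborel_prod .
qed

lemma nn_integral_indicator_cball_finite: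
  "(\<integral>\<^sup>+z. ennreal (c * indicator (cball (0 :: 'a::euclidean_space) R) z) \<partial>lborel) < \<infinity>"
proof -
  have "(\<integral>\<^sup>+z. ennreal (c * indicator (cball (0 :: 'a) R) z) \<partial>lborel) =
      (\<integral>\<^sup>+z. ennreal c * indicator (cball (0 :: 'a) R) z \<partial>lborel)"
    by (intro nn_integral_cong) (simp add: indicator_def)
  also have "\<dots> = ennreal c * emeasure lborel (cball (0 :: 'a) R)"
    by (rule nn_integral_cmult_indicator) simp
  also have "\<dots> < \<infinity>"
    using emeasure_bounded_finite[OF bounded_cball, of "0 :: 'a" R] by (simp add: ennreal_mult_less_top)
  finally show ?thesis .
qed

text \<open>The sampled step functions converge almost everywhere because the diagonal is a null
  set; they inherit the bound of g and, up to the mesh, its support, so dominated convergence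
  applies.\<close>

lemma dyadic_approximable_continuous:
  assumes g: "continuous_on UNIV g" and K: "\<And>z. \<bar>g z\<bar> \<le> K" and R: "\<And>z. norm z > R \<Longrightarrow> g z = 0"
  shows "dyadic_approximable g"
proof -
  define A where "A = (\<lambda>m i j. g (dyadic_point m i, dyadic_point m j))"
  \<comment> \<open>A point of a cell rectangle and the sampled corner differ by at most the mesh in
    each coordinate, hence by at most 2 in norm: this enlarges the radius to R + 2. The factor 4 K^2
    bounds the square of a difference of two values of modulus at most K.\<close>
  define w where "w = (\<lambda>z. 4 * K\<^sup>2 * indicator (cball (0 :: real \<times> real) (R + 2)) z :: real)"
  have "K \<ge> 0"
    using K[of 0] by linarith
  have [measurable]: "g \<in> borel_measurable borel"
    using g by (rule borel_measurable_continuous_onI)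
  have [measurable]: "w \<in> borel_measurable borel"
    unfolding w_def by (intro borel_measurable_times borel_measurable_const borel_measurable_indicator) simp
  have step_bound: "\<bar>dyadic_step m (A m) z\<bar> \<le> K" and step_outside: "norm z > R + 2 \<Longrightarrow> dyadic_step m (A m) z = 0" for m z
  proof -
    obtain x y where z: "z = (x, y)" by fastforce
    let ?c = "\<lambda>x p. p < dyadic_count m \<and> x \<in> dyadic_cell m p"
    have "\<bar>dyadic_step m (A m) z\<bar> \<le> K \<and> (norm z > R + 2 \<longrightarrow> dyadic_step m (A m) z = 0)"
    proof (cases "(\<exists>p. ?c x p) \<and> (\<exists>q. ?c y q)")
      case True
      then obtain p q where pq: "?c x p" "?c y q" by blast
      then have step: "dyadic_step m (A m) z = off_diag (A m) p q"
        unfolding z by (intro off_diag_step_cell[OF partition_dyadic]) auto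
      have "norm z \<le> norm (dyadic_point m p, dyadic_point m q) + norm (x - dyadic_point m p, y - dyadic_point m q)"
        using norm_triangle_ineq[of "(dyadic_point m p, dyadic_point m q)" "(x - dyadic_point m p, y - dyadic_point m q)"]
        by (simp add: z)
      moreover have "norm (x - dyadic_point m p, y - dyadic_point m q) \<le> \<bar>x - dyadic_point m p\<bar> + \<bar>y - dyadic_point m q\<bar>"
        unfolding norm_Pair by (rule sqrt_sum_squares_le_sum_abs[THEN order_trans]) simp
      moreover have "1 / 2 ^ m \<le> (1 :: real)"
        by simp
      moreover have "\<bar>x - dyadic_point m p\<bar> \<le> 1 / 2 ^ m" "\<bar>y - dyadic_point m q\<bar> \<le> 1 / 2 ^ m"
        using pq unfolding dyadic_point_Suc by auto
      ultimately have "norm z > R + 2 \<Longrightarrow> norm (dyadic_point m p, dyadic_point m q) > R"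
        by linarith
      then show ?thesis
        using K R \<open>K \<ge> 0\<close> unfolding step by (auto simp: off_diag_def A_def)
    next
      case False
      then have "dyadic_step m (A m) z = 0"
        unfolding z by (intro off_diag_step_outside[OF partition_dyadic]) blast
      then show ?thesis
        using \<open>K \<ge> 0\<close> by simp
    qed
    then show "\<bar>dyadic_step m (A m) z\<bar> \<le> K" and "norm z > R + 2 \<Longrightarrow> dyadic_step m (A m) z = 0"
      by blast+
  qed
  have "(\<lambda>m. sqdist lborel (dyadic_step m (A m)) g) \<longlonglongrightarrow> 0"
  proof (rule sqdist_dominated_convergence[where w = w])
    fix m z
    show "(dyadic_step m (A m) z - g z)\<^sup>2 \<le> w z"
    proof (cases "norm z > R + 2")
      case True
      then show ?thesis
        using step_outside[OF True] R[of z] by (simp add: w_def)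
    next
      case False
      then have "w z = 4 * K\<^sup>2"
        by (simp add: w_def)
      then show ?thesis
        using diff_square_le_of_abs_le[OF step_bound K] by simp
    qed
  next
    show "(\<integral>\<^sup>+z. ennreal (w z) \<partial>lborel) < \<infinity>"
      unfolding w_def by (rule nn_integral_indicator_cball_finite)
    show "AE z in lborel. (\<lambda>m. dyadic_step m (A m) z) \<longlonglongrightarrow> g z"
      using AE_lborel_off_diagonal
    proof eventually_elim
      case (elim z)
      then show ?case
        using dyadic_step_samples_tendsto[OF g elim] by (simp add: A_def)
    qed
  qed simp_all
  show ?thesis
    unfolding dyadic_approximable_def
  proof (intro allI impI)
    fix e :: real assume "e > 0"
    then have "\<forall>\<^sub>F m in sequentially. sqdist lborel (dyadic_step m (A m)) g < ennreal e"
      using order_tendstoD(2)[OF \<open>(\<lambda>m. sqdist lborel (dyadic_step m (A m)) g) \<longlonglongrightarrow> 0\<close>] by simp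
    then show "\<forall>\<^sub>F m in sequentially. \<exists>a. sqdist lborel (dyadic_step m a) g \<le> ennreal e"
      by eventually_elim (auto intro: less_imp_le)
  qed
qed

text \<open>A measurable function is an almost everywhere limit of continuous functions G n, over
  which there is no control of size or support. Truncating them at height K and multiplying by a
  continuous cutoff c leaves the limit unchanged, since h respects both restrictions, and yields a
  common dominating function.\<close>

lemma dyadic_approximable_bounded:
  assumes h[measurable]: "h \<in> borel_measurable borel"
    and K: "\<And>z. \<bar>h z\<bar> \<le> K" and R: "\<And>z. norm z > R \<Longrightarrow> h z = 0"
  shows "dyadic_approximable h"
proof -
  have "K \<ge> 0"
    using K[of 0] by linarith
  have "h measurable_on UNIV"
    by (rule lebesgue_measurable_imp_measurable_on) (auto intro: measurable_completion)
  then obtain N G where "negligible N" and G: "\<And>n. continuous_on UNIV (G n)"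
    and lim: "\<And>z. z \<notin> N \<Longrightarrow> (\<lambda>n. G n z) \<longlonglongrightarrow> h z"
    unfolding measurable_on_def by auto
  define c where "c = (\<lambda>z :: real \<times> real. max 0 (min 1 (R + 1 - norm z)))"
  define g where "g = (\<lambda>n z. max (- K) (min K (G n z)) * c z)"
  define w where "w = (\<lambda>z. 4 * K\<^sup>2 * indicator (cball (0 :: real \<times> real) (R + 1)) z :: real)"
  have [measurable]: "w \<in> borel_measurable borel"
    unfolding w_def by (intro borel_measurable_times borel_measurable_const borel_measurable_indicator) simp
  have cont: "continuous_on UNIV (g n)" for n
    unfolding g_def c_def by (intro continuous_intros G)
  have bound: "\<bar>g n z\<bar> \<le> K" for n z
  proof -
    have "\<bar>max (- K) (min K (G n z))\<bar> \<le> K" "\<bar>c z\<bar> \<le> 1"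
      using \<open>K \<ge> 0\<close> by (auto simp: c_def)
    then have "\<bar>max (- K) (min K (G n z))\<bar> * \<bar>c z\<bar> \<le> K * 1"
      by (intro mult_mono) (use \<open>K \<ge> 0\<close> in auto)
    then show ?thesis
      by (simp add: g_def abs_mult)
  qed
  have outside: "norm z > R + 1 \<Longrightarrow> g n z = 0" for n z
    by (simp add: g_def c_def)
  have "dyadic_approximable (g n)" for n
    by (rule dyadic_approximable_continuous[OF cont bound outside])
  moreover have "(\<lambda>n. sqdist lborel (g n) h) \<longlonglongrightarrow> 0"
  proof (rule sqdist_dominated_convergence[where w = w])
    show "g n \<in> borel_measurable lborel" for n
      using borel_measurable_continuous_onI[OF cont[of n]] by simp
    fix n z
    show "(g n z - h z)\<^sup>2 \<le> w z"
    proof (cases "norm z > R + 1")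
      case True
      then show ?thesis
        using outside[OF True] R[of z] by (simp add: w_def)
    next
      case False
      then have "w z = 4 * K\<^sup>2"
        by (simp add: w_def)
      then show ?thesis
        using diff_square_le_of_abs_le[OF bound K] by simp
    qed
  next
    show "(\<integral>\<^sup>+z. ennreal (w z) \<partial>lborel) < \<infinity>"
      unfolding w_def by (rule nn_integral_indicator_cball_finite)
    have "AE z in lebesgue. z \<notin> N"
      using \<open>negligible N\<close> by (intro AE_not_in) (simp add: negligible_iff_null_sets)
    then have "AE z in lborel. z \<notin> N"
      by (simp add: AE_completion_iff)
    then show "AE z in lborel. (\<lambda>n. g n z) \<longlonglongrightarrow> h z"
    proof eventually_elim
      case (elim z)
      have "(\<lambda>n. g n z) \<longlonglongrightarrow> max (- K) (min K (h z)) * c z"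
        unfolding g_def by (intro tendsto_intros lim elim)
      moreover have "max (- K) (min K (h z)) = h z"
        using K[of z] by auto
      moreover have "h z * c z = h z"
        using R[of z] by (cases "norm z > R") (auto simp: c_def)
      ultimately show ?case
        by simp
    qed
  qed simp_all
  ultimately show ?thesis
    by (rule dyadic_approximable_limit) (use cont in \<open>auto intro: borel_measurable_continuous_onI\<close>)
qed

text \<open>Truncation of h in height and in support; the squared error is 0 or h^2 at every point,
  so h^2 itself dominates.\<close>

theorem dyadic_approximable_L2:
  assumes h[measurable]: "h \<in> borel_measurable borel" and L2: "(\<integral>\<^sup>+z. ennreal ((h z)\<^sup>2) \<partial>lborel) < \<infinity>"
  shows "dyadic_approximable h"
proof -
  define g where "g = (\<lambda>n z. if \<bar>h z\<bar> \<le> real n \<and> norm z \<le> real n then h z else 0)"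
  have [measurable]: "g n \<in> borel_measurable borel" for n
    unfolding g_def by measurable
  have "dyadic_approximable (g n)" for n
    by (rule dyadic_approximable_bounded[of _ "real n" "real n"]) (auto simp: g_def)
  moreover have "(\<lambda>n. sqdist lborel (g n) h) \<longlonglongrightarrow> 0"
  proof (rule sqdist_dominated_convergence[where w = "\<lambda>z. (h z)\<^sup>2"])
    show "AE z in lborel. (\<lambda>n. g n z) \<longlonglongrightarrow> h z"
    proof (rule AE_I2, rule tendsto_eventually)
      fix z
      have "\<forall>\<^sub>F n in sequentially. n \<ge> nat \<lceil>\<bar>h z\<bar>\<rceil> \<and> n \<ge> nat \<lceil>norm z\<rceil>"
        by (intro eventually_conj eventually_ge_at_top)
      then show "\<forall>\<^sub>F n in sequentially. g n z = h z"
      proof eventually_elim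
        case (elim n)
        then have "\<bar>h z\<bar> \<le> real n" "norm z \<le> real n"
          by linarith+
        then show ?case
          by (simp add: g_def)
      qed
    qed
  qed (use L2 in \<open>auto simp: g_def\<close>)
  ultimately show ?thesis
    by (rule dyadic_approximable_limit) auto
qed

section \<open>Completeness and existence of the double integral\<close>

lemma L2_cauchy_converges:
  assumes [measurable]: "\<And>k. Y k \<in> borel_measurable N"
    and "C \<ge> 0" and Y: "\<And>k l. k \<le> l \<Longrightarrow> sqdist N (Y l) (Y k) \<le> ennreal (C / 8 ^ k)"
  shows "\<exists>X\<in>borel_measurable N. (\<lambda>k. sqdist N (Y k) X) \<longlonglongrightarrow> 0"
proof -
  \<comment> \<open>Where the sequence diverges the value of \<open>lim\<close> carries no
    information; that set will turn out to be null.\<close>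
  define X where "X = (\<lambda>\<omega>. lim (\<lambda>k. Y k \<omega>))"
  \<comment> \<open>The weights 2^k are strong enough to make finiteness of S bound the k-th
    increment by a multiple of 2^(-k/2), which is summable, and weak enough for the rate 8^(-k): the
    weighted expectations are still at most C / 4^k.\<close>
  define S where "S = (\<lambda>\<omega>. \<Sum>k. ennreal (2 ^ k * (Y (Suc k) \<omega> - Y k \<omega>)\<^sup>2))"
  have X[measurable]: "X \<in> borel_measurable N"
    unfolding X_def by (rule borel_measurable_lim_metric) measurable
  have "(\<integral>\<^sup>+\<omega>. S \<omega> \<partial>N) = (\<Sum>k. \<integral>\<^sup>+\<omega>. ennreal (2 ^ k * (Y (Suc k) \<omega> - Y k \<omega>)\<^sup>2) \<partial>N)"
    unfolding S_def by (rule nn_integral_suminf) measurable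
  also have "\<dots> \<le> (\<Sum>k. ennreal (C * (1 / 4) ^ k))"
  proof (rule suminf_le)
    fix k
    have "(\<integral>\<^sup>+\<omega>. ennreal (2 ^ k * (Y (Suc k) \<omega> - Y k \<omega>)\<^sup>2) \<partial>N) = ennreal (2 ^ k) * sqdist N (Y (Suc k)) (Y k)"
      unfolding sqdist_def by (simp add: ennreal_mult nn_integral_cmult)
    also have "\<dots> \<le> ennreal (2 ^ k) * ennreal (C / 8 ^ k)"
      by (intro mult_left_mono Y) auto
    also have "\<dots> = ennreal (2 ^ k * (C / 8 ^ k))"
      using \<open>C \<ge> 0\<close> by (intro ennreal_mult[symmetric]) auto
    also have "2 ^ k * (C / 8 ^ k) = C * (1 / 4) ^ k"
    proof -
      have "(8 :: real) ^ k = 2 ^ k * 4 ^ k"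
        by (simp flip: power_mult_distrib)
      then show ?thesis
        by (simp add: power_one_over)
    qed
    finally show "(\<integral>\<^sup>+\<omega>. ennreal (2 ^ k * (Y (Suc k) \<omega> - Y k \<omega>)\<^sup>2) \<partial>N) \<le> ennreal (C * (1 / 4) ^ k)" .
  qed auto
  also have "\<dots> < \<infinity>"
  proof -
    have "summable (\<lambda>k. C * (1 / 4 :: real) ^ k)"
      by (intro summable_mult summable_geometric) simp
    then have "(\<Sum>k. ennreal (C * (1 / 4) ^ k)) \<noteq> top"
      by (rule ennreal_suminf_neq_top) (use \<open>C \<ge> 0\<close> in simp)
    then show ?thesis
      by (simp only: less_top infinity_ennreal_def)
  qed
  finally have "AE \<omega> in N. S \<omega> \<noteq> \<infinity>"
    unfolding S_def by (intro nn_integral_PInf_AE) auto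
  then have conv: "AE \<omega> in N. (\<lambda>k. Y k \<omega>) \<longlonglongrightarrow> X \<omega>"
  proof eventually_elim
    case (elim \<omega>)
    then obtain s where s: "S \<omega> = ennreal s" "0 \<le> s"
      by (cases "S \<omega>") auto
    have bound: "norm (Y (Suc k) \<omega> - Y k \<omega>) \<le> sqrt s * (1 / sqrt 2) ^ k" for k
    proof -
      have "(\<Sum>i\<in>{k}. ennreal (2 ^ i * (Y (Suc i) \<omega> - Y i \<omega>)\<^sup>2)) \<le> S \<omega>"
        unfolding S_def by (rule sum_le_suminf) auto
      then have "2 ^ k * (Y (Suc k) \<omega> - Y k \<omega>)\<^sup>2 \<le> s"
        using s by simp
      then have "sqrt (2 ^ k * (Y (Suc k) \<omega> - Y k \<omega>)\<^sup>2) \<le> sqrt s"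
        by (rule real_sqrt_le_mono)
      then have "sqrt 2 ^ k * \<bar>Y (Suc k) \<omega> - Y k \<omega>\<bar> \<le> sqrt s"
        by (simp only: real_sqrt_mult real_sqrt_abs real_sqrt_power[of 2 k])
      then show ?thesis
        by (simp add: power_one_over field_simps)
    qed
    have "summable (\<lambda>k. sqrt s * (1 / sqrt 2) ^ k)"
      by (intro summable_mult summable_geometric) (simp add: real_less_lsqrt)
    then have "summable (\<lambda>k. Y (Suc k) \<omega> - Y k \<omega>)"
      by (rule summable_comparison_test'[where N = 0]) (use bound in blast)
    then have "convergent (\<lambda>n. Y 0 \<omega> + (\<Sum>k<n. Y (Suc k) \<omega> - Y k \<omega>))"
      by (intro convergent_add convergent_const) (simp add: summable_iff_convergent)
    moreover have "Y 0 \<omega> + (\<Sum>k<n. Y (Suc k) \<omega> - Y k \<omega>) = Y n \<omega>" for n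
      using sum_lessThan_telescope[of "\<lambda>k. Y k \<omega>" n] by simp
    ultimately have "convergent (\<lambda>n. Y n \<omega>)"
      by (simp only:)
    then show ?case
      unfolding X_def by (simp add: convergent_LIMSEQ_iff)
  qed
  have "sqdist N (Y k) X \<le> ennreal (C / 8 ^ k)" for k
  proof -
    \<comment> \<open>Fatou's lemma in l for fixed k carries the Cauchy bound over to the pointwise
      limit.\<close>
    have "sqdist N (Y k) X = (\<integral>\<^sup>+\<omega>. liminf (\<lambda>l. ennreal ((Y l \<omega> - Y k \<omega>)\<^sup>2)) \<partial>N)"
      unfolding sqdist_def
    proof (rule nn_integral_cong_AE, use conv in eventually_elim)
      fix \<omega> assume "(\<lambda>k. Y k \<omega>) \<longlonglongrightarrow> X \<omega>"
      then have "(\<lambda>l. ennreal ((Y l \<omega> - Y k \<omega>)\<^sup>2)) \<longlonglongrightarrow> ennreal ((X \<omega> - Y k \<omega>)\<^sup>2)"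
        by (intro tendsto_ennrealI tendsto_intros)
      then show "ennreal ((Y k \<omega> - X \<omega>)\<^sup>2) = liminf (\<lambda>l. ennreal ((Y l \<omega> - Y k \<omega>)\<^sup>2))"
        using lim_imp_Liminf[OF sequentially_bot, of "\<lambda>l. ennreal ((Y l \<omega> - Y k \<omega>)\<^sup>2)"]
        unfolding power2_commute[of "Y k \<omega>"] by metis
    qed
    also have "\<dots> \<le> liminf (\<lambda>l. sqdist N (Y l) (Y k))"
      unfolding sqdist_def by (rule nn_integral_liminf) measurable
    also have "\<dots> \<le> limsup (\<lambda>l. sqdist N (Y l) (Y k))"
      by (rule Liminf_le_Limsup) simp
    also have "\<dots> \<le> ennreal (C / 8 ^ k)"
      by (rule Limsup_bounded) (auto intro: eventually_sequentiallyI[of k] Y)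
    finally show ?thesis .
  qed
  moreover have "(\<lambda>k. ennreal (C / 8 ^ k)) \<longlonglongrightarrow> ennreal 0"
    by (intro tendsto_ennrealI LIMSEQ_divide_realpow_zero) simp
  ultimately have "(\<lambda>k. sqdist N (Y k) X) \<longlonglongrightarrow> 0"
    by (intro tendsto_sandwich[of "\<lambda>_. 0" "\<lambda>k. sqdist N (Y k) X" sequentially "\<lambda>k. ennreal (C / 8 ^ k)"]) auto
  with X show ?thesis by blast
qed

lemma sqdist_lebesgue:
  assumes [measurable]: "f \<in> borel_measurable borel" "g \<in> borel_measurable borel"
  shows "sqdist lebesgue f g = sqdist lborel f g"
  unfolding sqdist_def by (rule nn_integral_completion) measurable

text \<open>Dyadic approximants of h at rate 8^(-k) have integrals that are Cauchy at the same rate,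
  by the second moment bound on a common grid; their limit is the required random variable.\<close>

theorem (in wiener_process) wiener_ito2_exists:
  assumes h[measurable]: "h \<in> borel_measurable borel" and L2: "(\<integral>\<^sup>+z. ennreal ((h z)\<^sup>2) \<partial>lborel) < \<infinity>"
  shows "\<exists>X. is_wiener_ito2 M B h X"
proof -
  have "\<exists>m0. \<forall>m\<ge>m0. \<exists>a. sqdist lborel (dyadic_step m a) h \<le> ennreal (1 / 8 ^ k)" for k :: nat
    using dyadic_approximable_L2[OF assms] unfolding dyadic_approximable_def eventually_sequentially
    by (auto dest!: spec[of _ "1 / 8 ^ k"])
  then obtain m0 where m0: "\<And>k m. m \<ge> m0 k \<Longrightarrow> \<exists>a. sqdist lborel (dyadic_step m a) h \<le> ennreal (1 / 8 ^ k)"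
    by metis
  \<comment> \<open>Summing the thresholds makes the levels nondecreasing, so that the grids are
    nested, and keeps \<open>m k\<close> above \<open>m0 k\<close>.\<close>
  define m where "m k = (\<Sum>i\<le>k. m0 i)" for k
  have m_mono: "m k \<le> m l" if "k \<le> l" for k l
    unfolding m_def using that by (intro sum_mono2) auto
  have "m0 k \<le> m k" for k
    unfolding m_def by (rule member_le_sum) auto
  then have "\<exists>a. sqdist lborel (dyadic_step (m k) a) h \<le> ennreal (1 / 8 ^ k)" for k
    using m0 by blast
  then obtain a where a: "\<And>k. sqdist lborel (dyadic_step (m k) (a k)) h \<le> ennreal (1 / 8 ^ k)"
    by metis
  define Y where "Y k = dyadic_integral B (m k) (a k)" for k
  \<comment> \<open>The constant is 8 = 2 * (2 + 2): a factor 2 from the second moment bound and two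
    factors 2 from the triangle inequality through h.\<close>
  have "sqdist M (Y l) (Y k) \<le> ennreal (8 / 8 ^ k)" if "k \<le> l" for k l
  proof -
    have "sqdist M (Y l) (Y k) \<le> 2 * sqdist lborel (dyadic_step (m l) (a l)) (dyadic_step (m k) (a k))"
      unfolding Y_def by (rule sqdist_dyadic_integrals[OF m_mono[OF that]])
    also have "\<dots> \<le> 2 * (2 * sqdist lborel (dyadic_step (m l) (a l)) h + 2 * sqdist lborel h (dyadic_step (m k) (a k)))"
      by (intro mult_left_mono sqdist_triangle) auto
    also have "\<dots> \<le> 2 * (2 * ennreal (1 / 8 ^ k) + 2 * ennreal (1 / 8 ^ k))"
    proof -
      have "ennreal (1 / 8 ^ l) \<le> ennreal (1 / 8 ^ k)"
        using that by (intro ennreal_leI) (simp add: divide_simps power_increasing)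
      then show ?thesis
        using order_trans[OF a[of l]] a[of k] unfolding sqdist_commute[of _ h "dyadic_step (m k) (a k)"]
        by (intro mult_left_mono add_mono) auto
    qed
    also have "\<dots> = ennreal (2 * (2 * (1 / 8 ^ k) + 2 * (1 / 8 ^ k)))"
    proof -
      have "2 * ennreal r = ennreal (2 * r)" if "0 \<le> r" for r
        using that by (simp add: ennreal_mult)
      then show ?thesis
        by (simp add: ennreal_plus[symmetric] del: ennreal_plus)
    qed
    finally show ?thesis
      by simp
  qed
  then obtain X where X: "X \<in> borel_measurable M" "(\<lambda>k. sqdist M (Y k) X) \<longlonglongrightarrow> 0"
    using L2_cauchy_converges[of Y M 8] unfolding Y_def by auto
  have "(\<lambda>k. ennreal (1 / 8 ^ k)) \<longlonglongrightarrow> ennreal 0"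
    by (intro tendsto_ennrealI LIMSEQ_divide_realpow_zero) simp
  then have "(\<lambda>k. sqdist lborel (dyadic_step (m k) (a k)) h) \<longlonglongrightarrow> 0"
    using a by (intro tendsto_sandwich[of "\<lambda>_. 0" "\<lambda>k. sqdist lborel (dyadic_step (m k) (a k)) h"
          sequentially "\<lambda>k. ennreal (1 / 8 ^ k)"]) auto
  then have "L2_converges lebesgue (\<lambda>k. dyadic_step (m k) (a k)) h"
    unfolding L2_converges_eq by (simp add: sqdist_lebesgue)
  moreover have "\<forall>k. \<forall>i<dyadic_count (m k). dyadic_point (m k) i < dyadic_point (m k) (Suc i)"
    using partition_dyadic unfolding partition_def by blast
  ultimately have "is_wiener_ito2 M B h X"
    using X unfolding is_wiener_ito2_def L2_converges_eq Y_def
    by (intro conjI exI[of _ "\<lambda>k. dyadic_count (m k)"] exI[of _ "\<lambda>k. dyadic_point (m k)"] exI[of _ a]) auto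
  then show ?thesis by blast
qed

section \<open>Contractions and the characteristic function of a double Wiener integral\<close>

text \<open>If the product is not integrable, its Bochner integral is 0 and the inequality is
  trivial. This convention matches that of \<open>contract\<close>.\<close>

lemma Cauchy_Schwarz_Bochner:
  fixes f g :: "'a \<Rightarrow> real"
  assumes [measurable]: "f \<in> borel_measurable N" "g \<in> borel_measurable N"
  shows "ennreal ((\<integral>x. f x * g x \<partial>N)\<^sup>2) \<le> (\<integral>\<^sup>+x. ennreal ((f x)\<^sup>2) \<partial>N) * (\<integral>\<^sup>+x. ennreal ((g x)\<^sup>2) \<partial>N)"
proof (cases "integrable N (\<lambda>x. f x * g x)")
  case True
  have sq: "(ennreal \<bar>r\<bar>)\<^sup>2 = ennreal (r\<^sup>2)" for r
    by (simp add: ennreal_power)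
  have "ennreal ((\<integral>x. f x * g x \<partial>N)\<^sup>2) = (ennreal (norm (\<integral>x. f x * g x \<partial>N)))\<^sup>2"
    by (simp add: sq)
  also have "\<dots> \<le> (\<integral>\<^sup>+x. norm (f x * g x) \<partial>N)\<^sup>2"
    by (intro power_mono integral_norm_bound_ennreal True) simp
  also have "(\<integral>\<^sup>+x. norm (f x * g x) \<partial>N) = (\<integral>\<^sup>+x. ennreal \<bar>f x\<bar> * ennreal \<bar>g x\<bar> \<partial>N)"
    by (simp add: abs_mult ennreal_mult)
  also have "\<dots>\<^sup>2 \<le> (\<integral>\<^sup>+x. (ennreal \<bar>f x\<bar>)\<^sup>2 \<partial>N) * (\<integral>\<^sup>+x. (ennreal \<bar>g x\<bar>)\<^sup>2 \<partial>N)"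
    by (rule Cauchy_Schwarz_nn_integral) measurable
  finally show ?thesis
    by (simp only: sq)
qed (simp add: not_integrable_integral_eq)

definition l2sq :: "(real \<times> real \<Rightarrow> real) \<Rightarrow> ennreal" where
  "l2sq h = (\<integral>\<^sup>+z. ennreal ((h z)\<^sup>2) \<partial>lborel)"

text \<open>
  The inner integral is \<open>0\<close> where the product is not integrable; for square-integrable arguments this
  happens only on a null set.
\<close>

definition contract :: "(real \<times> real \<Rightarrow> real) \<Rightarrow> (real \<times> real \<Rightarrow> real) \<Rightarrow> real \<times> real \<Rightarrow> real" where
  "contract g h = (\<lambda>(x, y). \<integral>z. g (x, z) * h (z, y) \<partial>lborel)"

lemma borel_measurable_contract[measurable]:
  assumes [measurable]: "g \<in> borel_measurable borel" "h \<in> borel_measurable borel"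
  shows "contract g h \<in> borel_measurable borel"
proof -
  have [measurable]: "g \<in> borel_measurable (borel \<Otimes>\<^sub>M borel)" "h \<in> borel_measurable (borel \<Otimes>\<^sub>M borel)"
    using assms by (simp_all add: borel_prod)
  have "contract g h \<in> borel_measurable (borel \<Otimes>\<^sub>M borel)"
    unfolding contract_def by measurable
  then show ?thesis
    by (simp add: borel_prod)
qed

lemma l2sq_iterated:
  assumes g[measurable]: "g \<in> borel_measurable borel"
  shows "l2sq g = (\<integral>\<^sup>+x. \<integral>\<^sup>+z. ennreal ((g (x, z))\<^sup>2) \<partial>lborel \<partial>lborel)"
    and "l2sq g = (\<integral>\<^sup>+y. \<integral>\<^sup>+z. ennreal ((g (z, y))\<^sup>2) \<partial>lborel \<partial>lborel)"
proof -
  have m: "(\<lambda>z. ennreal ((g z)\<^sup>2)) \<in> borel_measurable (lborel \<Otimes>\<^sub>M lborel)"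
    by (simp add: lborel_prod)
  show "l2sq g = (\<integral>\<^sup>+x. \<integral>\<^sup>+z. ennreal ((g (x, z))\<^sup>2) \<partial>lborel \<partial>lborel)"
    unfolding l2sq_def lborel_prod[symmetric] by (rule lborel.nn_integral_fst[OF m, symmetric])
  show "l2sq g = (\<integral>\<^sup>+y. \<integral>\<^sup>+z. ennreal ((g (z, y))\<^sup>2) \<partial>lborel \<partial>lborel)"
    unfolding l2sq_def lborel_prod[symmetric] by (rule lborel_pair.nn_integral_snd[OF m, symmetric])
qed

text \<open>Cauchy-Schwarz in z for each pair (x, y); the resulting bound is a function of x times a
  function of y, and the double integral factors.\<close>

lemma l2sq_contract_le:
  assumes [measurable]: "g \<in> borel_measurable borel" "h \<in> borel_measurable borel"
  shows "l2sq (contract g h) \<le> l2sq g * l2sq h"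
proof -
  have [measurable]: "g \<in> borel_measurable (borel \<Otimes>\<^sub>M borel)" "h \<in> borel_measurable (borel \<Otimes>\<^sub>M borel)"
    using assms by (simp_all add: borel_prod)
  have "l2sq (contract g h) = (\<integral>\<^sup>+x. \<integral>\<^sup>+y. ennreal ((contract g h (x, y))\<^sup>2) \<partial>lborel \<partial>lborel)"
    by (rule l2sq_iterated) measurable
  also have "\<dots> \<le> (\<integral>\<^sup>+x. \<integral>\<^sup>+y. (\<integral>\<^sup>+z. ennreal ((g (x, z))\<^sup>2) \<partial>lborel) * (\<integral>\<^sup>+z. ennreal ((h (z, y))\<^sup>2) \<partial>lborel) \<partial>lborel \<partial>lborel)"
    unfolding contract_def prod.case
    by (intro nn_integral_mono Cauchy_Schwarz_Bochner) measurable
  also have "\<dots> = l2sq g * l2sq h"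
    unfolding l2sq_iterated(1)[OF assms(1)] l2sq_iterated(2)[OF assms(2)]
    by (simp add: nn_integral_cmult nn_integral_multc)
  finally show ?thesis .
qed

lemma l2sq_triangle3:
  assumes [measurable]: "f \<in> borel_measurable borel" "g \<in> borel_measurable borel" "h \<in> borel_measurable borel"
    "k \<in> borel_measurable borel"
    and eq: "AE z in lborel. f z = g z + h z + k z"
  shows "l2sq f \<le> 3 * l2sq g + 3 * l2sq h + 3 * l2sq k"
proof -
  have "l2sq f \<le> (\<integral>\<^sup>+z. 3 * ennreal ((g z)\<^sup>2) + 3 * ennreal ((h z)\<^sup>2) + 3 * ennreal ((k z)\<^sup>2) \<partial>lborel)"
    unfolding l2sq_def
  proof (rule nn_integral_mono_AE, use eq in eventually_elim)
    fix z assume f: "f z = g z + h z + k z"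
    have "(f z)\<^sup>2 \<le> 3 * (g z)\<^sup>2 + 3 * (h z)\<^sup>2 + 3 * (k z)\<^sup>2"
      using sum_squares_bound[of "g z" "h z"] sum_squares_bound[of "g z" "k z"] sum_squares_bound[of "h z" "k z"]
      unfolding f by (simp add: power2_eq_square algebra_simps)
    then have "ennreal ((f z)\<^sup>2) \<le> ennreal (3 * (g z)\<^sup>2 + 3 * (h z)\<^sup>2 + 3 * (k z)\<^sup>2)"
      by (rule ennreal_leI)
    also have "\<dots> = 3 * ennreal ((g z)\<^sup>2) + 3 * ennreal ((h z)\<^sup>2) + 3 * ennreal ((k z)\<^sup>2)"
      by (simp add: ennreal_mult)
    finally show "ennreal ((f z)\<^sup>2) \<le> 3 * ennreal ((g z)\<^sup>2) + 3 * ennreal ((h z)\<^sup>2) + 3 * ennreal ((k z)\<^sup>2)" .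
  qed
  also have "\<dots> = 3 * l2sq g + 3 * l2sq h + 3 * l2sq k"
    by (simp add: l2sq_def nn_integral_add nn_integral_cmult)
  finally show ?thesis .
qed

lemma AE_sections_square_integrable:
  assumes [measurable]: "g \<in> borel_measurable borel" and "l2sq g < \<infinity>"
  shows "AE x in lborel. integrable lborel (\<lambda>z. (g (x, z))\<^sup>2)"
    and "AE y in lborel. integrable lborel (\<lambda>z. (g (z, y))\<^sup>2)"
proof -
  have [measurable]: "g \<in> borel_measurable (borel \<Otimes>\<^sub>M borel)"
    using assms by (simp add: borel_prod)
  have "AE x in lborel. (\<integral>\<^sup>+z. ennreal ((g (x, z))\<^sup>2) \<partial>lborel) \<noteq> \<infinity>"
    by (rule nn_integral_PInf_AE) (use assms in \<open>simp_all add: l2sq_iterated(1)\<close>)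
  then show "AE x in lborel. integrable lborel (\<lambda>z. (g (x, z))\<^sup>2)"
    by eventually_elim (simp add: integrable_iff_bounded less_top)
  have "AE y in lborel. (\<integral>\<^sup>+z. ennreal ((g (z, y))\<^sup>2) \<partial>lborel) \<noteq> \<infinity>"
    by (rule nn_integral_PInf_AE) (use assms in \<open>simp_all add: l2sq_iterated(2)\<close>)
  then show "AE y in lborel. integrable lborel (\<lambda>z. (g (z, y))\<^sup>2)"
    by eventually_elim (simp add: integrable_iff_bounded less_top)
qed


lemma AE_lborel_fst:
  fixes P :: "'a::euclidean_space \<Rightarrow> bool"
  assumes "AE x in lborel. P x"
  shows "AE w in (lborel :: ('a \<times> 'b::euclidean_space) measure). P (fst w)"
proof -
  obtain N :: "'a set" where N: "{x \<in> space lborel. \<not> P x} \<subseteq> N" "N \<in> sets lborel" "emeasure lborel N = 0"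
    using assms by (auto elim!: AE_E)
  have "emeasure (lborel \<Otimes>\<^sub>M lborel) (N \<times> (UNIV :: 'b set)) = 0"
    using N by (simp add: lborel.emeasure_pair_measure_Times)
  then have null: "N \<times> (UNIV :: 'b set) \<in> null_sets (lborel \<Otimes>\<^sub>M lborel)"
    using N(2) by (auto intro!: null_setsI pair_measureI)
  show ?thesis
    by (rule AE_I'[OF null[unfolded lborel_prod]]) (use N(1) in auto)
qed

lemma AE_lborel_snd:
  fixes P :: "'b::euclidean_space \<Rightarrow> bool"
  assumes "AE x in lborel. P x"
  shows "AE w in (lborel :: ('a::euclidean_space \<times> 'b) measure). P (snd w)"
proof -
  obtain N :: "'b set" where N: "{x \<in> space lborel. \<not> P x} \<subseteq> N" "N \<in> sets lborel" "emeasure lborel N = 0"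
    using assms by (auto elim!: AE_E)
  have "emeasure (lborel \<Otimes>\<^sub>M lborel) ((UNIV :: 'a set) \<times> N) = 0"
    using N by (simp add: lborel.emeasure_pair_measure_Times)
  then have null: "(UNIV :: 'a set) \<times> N \<in> null_sets (lborel \<Otimes>\<^sub>M lborel)"
    using N(2) by (auto intro!: null_setsI pair_measureI)
  show ?thesis
    by (rule AE_I'[OF null[unfolded lborel_prod]]) (use N(1) in auto)
qed

text \<open>With d = g - h, the telescoping identity is that the contraction of g with g equals
  those of d with g, of h with d and of h with h together. It holds almost everywhere, namely where
  the sections involved are square integrable. The constants 3 come from squaring a sum of three
  terms.\<close>

lemma l2sq_contract_perturb:
  assumes [measurable]: "g \<in> borel_measurable borel" "h \<in> borel_measurable borel"
    and fin: "l2sq g < \<infinity>" "l2sq h < \<infinity>"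
  shows "l2sq (contract g g) \<le> 3 * (sqdist lborel g h * l2sq g) + 3 * (l2sq h * sqdist lborel g h) + 3 * l2sq (contract h h)"
proof -
  define d where "d = (\<lambda>z. g z - h z)"
  have [measurable]: "d \<in> borel_measurable borel"
    unfolding d_def by measurable
  have d: "l2sq d = sqdist lborel g h"
    by (simp add: l2sq_def sqdist_def d_def)
  note sec_g = AE_sections_square_integrable[OF assms(1) fin(1)]
  note sec_h = AE_sections_square_integrable[OF assms(2) fin(2)]
  have "AE w in lborel. contract g g w = contract d g w + contract h d w + contract h h w"
    using AE_lborel_fst[OF sec_g(1)] AE_lborel_snd[OF sec_g(2)]
      AE_lborel_fst[OF sec_h(1)] AE_lborel_snd[OF sec_h(2)]
  proof eventually_elim
    case (elim w)
    obtain x y where w: "w = (x, y)" by fastforce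
    have int: "integrable lborel (\<lambda>z. g (x, z) * g (z, y))" "integrable lborel (\<lambda>z. h (x, z) * g (z, y))"
      "integrable lborel (\<lambda>z. h (x, z) * h (z, y))"
      using elim unfolding w by (intro integrable_mult_of_squares; simp)+
    have "(\<integral>z. d (x, z) * g (z, y) \<partial>lborel) = (\<integral>z. g (x, z) * g (z, y) \<partial>lborel) - (\<integral>z. h (x, z) * g (z, y) \<partial>lborel)"
      unfolding d_def left_diff_distrib by (rule Bochner_Integration.integral_diff[OF int(1,2)])
    moreover have "(\<integral>z. h (x, z) * d (z, y) \<partial>lborel) = (\<integral>z. h (x, z) * g (z, y) \<partial>lborel) - (\<integral>z. h (x, z) * h (z, y) \<partial>lborel)"
      unfolding d_def right_diff_distrib by (rule Bochner_Integration.integral_diff[OF int(2,3)])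
    ultimately show ?case
      by (simp add: w contract_def)
  qed
  then have "l2sq (contract g g) \<le> 3 * l2sq (contract d g) + 3 * l2sq (contract h d) + 3 * l2sq (contract h h)"
    by (intro l2sq_triangle3) measurable
  also have "\<dots> \<le> 3 * (l2sq d * l2sq g) + 3 * (l2sq h * l2sq d) + 3 * l2sq (contract h h)"
    by (intro add_mono mult_left_mono l2sq_contract_le order_refl) auto
  finally show ?thesis
    by (simp only: d)
qed

section \<open>Symmetrisation and passage to the limit\<close>

lemma borel_measurable_swap: "(\<lambda>z :: real \<times> real. (snd z, fst z)) \<in> borel \<rightarrow>\<^sub>M borel"
  unfolding borel_prod[symmetric] by measurable

lemma l2sq_swap:
  fixes d :: "real \<times> real \<Rightarrow> real"
  assumes [measurable]: "d \<in> borel_measurable borel"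
  shows "l2sq (\<lambda>z. d (snd z, fst z)) = l2sq d"
proof -
  have [measurable]: "(\<lambda>z :: real \<times> real. d (snd z, fst z)) \<in> borel_measurable borel"
    by (rule measurable_compose[OF borel_measurable_swap assms])
  show ?thesis
    by (subst l2sq_iterated(1)) (simp_all add: l2sq_iterated(2))
qed

text \<open>Reflection preserves Lebesgue measure and fixes h, so f and its reflection are equally
  far from h; by convexity of the square their average is no farther.\<close>

lemma sqdist_symmetrize_le:
  fixes f h :: "real \<times> real \<Rightarrow> real"
  assumes [measurable]: "f \<in> borel_measurable borel" "h \<in> borel_measurable borel"
    and sym: "\<And>x y. h (x, y) = h (y, x)"
  shows "sqdist lborel (\<lambda>z. (f z + f (snd z, fst z)) / 2) h \<le> sqdist lborel f h"
proof -
  define d where "d = (\<lambda>z. f z - h z)"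
  have [measurable]: "d \<in> borel_measurable borel"
    unfolding d_def by measurable
  have [measurable]: "(\<lambda>z :: real \<times> real. d (snd z, fst z)) \<in> borel_measurable borel"
    by (rule measurable_compose[OF borel_measurable_swap \<open>d \<in> _\<close>])
  have "sqdist lborel (\<lambda>z. (f z + f (snd z, fst z)) / 2) h \<le>
      (\<integral>\<^sup>+z. ennreal (1 / 2) * ennreal ((d z)\<^sup>2) + ennreal (1 / 2) * ennreal ((d (snd z, fst z))\<^sup>2) \<partial>lborel)"
    unfolding sqdist_def
  proof (rule nn_integral_mono)
    fix z :: "real \<times> real"
    have "(f z + f (snd z, fst z)) / 2 - h z = d z / 2 + d (snd z, fst z) / 2"
      using sym[of "fst z" "snd z"] by (simp add: d_def field_simps)
    then have "((f z + f (snd z, fst z)) / 2 - h z)\<^sup>2 \<le> 1 / 2 * (d z)\<^sup>2 + 1 / 2 * (d (snd z, fst z))\<^sup>2"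
      using power2_add_le[of "d z / 2" "d (snd z, fst z) / 2"] by (simp add: power_divide)
    then have "ennreal (((f z + f (snd z, fst z)) / 2 - h z)\<^sup>2) \<le> ennreal (1 / 2 * (d z)\<^sup>2 + 1 / 2 * (d (snd z, fst z))\<^sup>2)"
      by (rule ennreal_leI)
    also have "\<dots> = ennreal (1 / 2) * ennreal ((d z)\<^sup>2) + ennreal (1 / 2) * ennreal ((d (snd z, fst z))\<^sup>2)"
      by (simp only: ennreal_plus ennreal_mult zero_le_power2 mult_nonneg_nonneg zero_le_divide_1_iff zero_le_numeral)
    finally show "ennreal (((f z + f (snd z, fst z)) / 2 - h z)\<^sup>2) \<le>
      ennreal (1 / 2) * ennreal ((d z)\<^sup>2) + ennreal (1 / 2) * ennreal ((d (snd z, fst z))\<^sup>2)" .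
  qed
  also have "\<dots> = ennreal (1 / 2) * l2sq d + ennreal (1 / 2) * l2sq (\<lambda>z. d (snd z, fst z))"
    unfolding l2sq_def by (subst nn_integral_add) (simp_all add: nn_integral_cmult)
  also have "\<dots> = (ennreal (1 / 2) + ennreal (1 / 2)) * l2sq d"
    by (simp only: l2sq_swap[OF \<open>d \<in> _\<close>] distrib_right)
  also have "ennreal (1 / 2) + ennreal (1 / 2) = 1"
    by (subst ennreal_plus[symmetric]) simp_all
  finally show ?thesis
    by (simp add: l2sq_def sqdist_def d_def)
qed

lemma sum_symmetrize:
  fixes b :: "nat \<Rightarrow> nat \<Rightarrow> real"
  shows "(\<Sum>i<n. \<Sum>j<n. (b i j + b j i) / 2 * X i * Y j) =
    ((\<Sum>i<n. \<Sum>j<n. b i j * X i * Y j) + (\<Sum>i<n. \<Sum>j<n. b i j * Y i * X j)) / 2"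
proof -
  have "(\<Sum>i<n. \<Sum>j<n. (b i j + b j i) / 2 * X i * Y j) =
      (\<Sum>i<n. \<Sum>j<n. b i j * X i * Y j / 2) + (\<Sum>i<n. \<Sum>j<n. b j i * X i * Y j / 2)"
    unfolding sum.distrib[symmetric] by (intro sum.cong refl) (simp add: field_simps)
  also have "(\<Sum>i<n. \<Sum>j<n. b j i * X i * Y j / 2) = (\<Sum>i<n. \<Sum>j<n. b i j * Y i * X j / 2)"
    by (subst sum.swap) (intro sum.cong refl, simp)
  finally show ?thesis
    by (simp only: sum_divide_distrib add_divide_distrib)
qed

text \<open>The bound for quadratic forms needs a symmetric matrix, whereas approximants of the
  double integral may have any coefficients. Averaging with the transpose leaves the random variable
  unchanged, because products of increments commute, and does not increase the distance to a
  symmetric h. The bound is then expressed through norms of g alone, so the partition disappears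
  from it.\<close>

lemma (in wiener_process) off_diag_step_symmetrization:
  assumes part: "partition n \<tau>" and h[measurable]: "h \<in> borel_measurable borel"
    and sym: "\<And>x y. h (x, y) = h (y, x)"
  obtains g where "g \<in> borel_measurable borel" "l2sq g < \<infinity>"
    "sqdist lborel g h \<le> sqdist lborel (off_diag_step n \<tau> a) h"
    "\<And>t. cmod (expectation (\<lambda>\<omega>. iexp (t * off_diag_step_integral B n \<tau> a \<omega>)) - exp (- (enn2real (l2sq g) * t\<^sup>2)))
      \<le> 4 * t\<^sup>2 * sqrt (enn2real (l2sq (contract g g)))"
proof -
  interpret partition n \<tau> by fact
  interpret g: gaussian_family M "{..<n}" "\<lambda>i \<omega>. B (\<tau> (Suc i)) \<omega> - B (\<tau> i) \<omega>" v
    by (rule gaussian_family_increments) fact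
  define \<alpha> where "\<alpha> = (\<lambda>i j. (off_diag a i j + off_diag a j i) / 2)"
  define g where "g = matrix_step n \<tau> \<alpha>"
  have \<alpha>_sym: "\<alpha> i j = \<alpha> j i" and \<alpha>_diag: "\<alpha> i i = 0" for i j
    by (simp_all add: \<alpha>_def off_diag_def)
  have l2: "l2sq g = ennreal (\<Sum>i<n. \<Sum>j<n. (\<alpha> i j)\<^sup>2 * (v i * v j))"
    unfolding l2sq_def g_def by (rule nn_integral_matrix_step_square)
  have "contract g g = matrix_step n \<tau> (\<lambda>i j. \<Sum>k<n. \<alpha> i k * v k * \<alpha> k j)"
    by (auto simp: contract_def g_def matrix_step_contraction)
  then have con: "l2sq (contract g g) = ennreal (\<Sum>i<n. \<Sum>j<n. (\<Sum>k<n. \<alpha> i k * v k * \<alpha> k j)\<^sup>2 * (v i * v j))"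
    unfolding l2sq_def by (simp only: nn_integral_matrix_step_square)
  have G: "off_diag_step_integral B n \<tau> a \<omega> = (\<Sum>i<n. \<Sum>j<n. \<alpha> i j *
      ((B (\<tau> (Suc i)) \<omega> - B (\<tau> i) \<omega>) * (B (\<tau> (Suc j)) \<omega> - B (\<tau> j) \<omega>)))" for \<omega>
    unfolding off_diag_step_integral_eq \<alpha>_def mult.assoc[symmetric] sum_symmetrize by simp
  have g_eq: "g = (\<lambda>z. (off_diag_step n \<tau> a z + off_diag_step n \<tau> a (snd z, fst z)) / 2)"
    unfolding off_diag_step_eq_matrix_step g_def matrix_step_def \<alpha>_def
    by (rule ext) (simp only: case_prod_beta fst_conv snd_conv sum_symmetrize)
  show thesis
  proof
    show "g \<in> borel_measurable borel"
      unfolding g_def by measurable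
    show "l2sq g < \<infinity>"
      by (simp add: l2)
    show "sqdist lborel g h \<le> sqdist lborel (off_diag_step n \<tau> a) h"
      unfolding g_eq by (rule sqdist_symmetrize_le) (use sym in auto)
    show "cmod (expectation (\<lambda>\<omega>. iexp (t * off_diag_step_integral B n \<tau> a \<omega>)) - exp (- (enn2real (l2sq g) * t\<^sup>2)))
      \<le> 4 * t\<^sup>2 * sqrt (enn2real (l2sq (contract g g)))" for t
      unfolding G l2 con enn2real_ennreal[OF weighted_square_sum_nonneg]
      by (rule g.quadratic_form_char_bound[of \<alpha>, OF \<alpha>_sym \<alpha>_diag])
  qed
qed

text \<open>The function exp(i t x) is |t|-Lipschitz in x, so characteristic functions differ by at
  most |t| times the mean distance, which the L2 distance controls.\<close>

lemma (in prob_space) tendsto_expectation_iexp_L2: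
  assumes [measurable]: "\<And>k. Y k \<in> borel_measurable M" "X \<in> borel_measurable M"
    and lim: "(\<lambda>k. sqdist M (Y k) X) \<longlonglongrightarrow> 0"
  shows "(\<lambda>k. expectation (\<lambda>\<omega>. iexp (t * Y k \<omega>))) \<longlonglongrightarrow> expectation (\<lambda>\<omega>. iexp (t * X \<omega>))"
proof -
  have "\<forall>\<^sub>F k in sequentially. norm (expectation (\<lambda>\<omega>. iexp (t * Y k \<omega>)) - expectation (\<lambda>\<omega>. iexp (t * X \<omega>)))
      \<le> \<bar>t\<bar> * sqrt (enn2real (sqdist M (Y k) X))"
    using order_tendstoD(2)[OF lim, of 1, simplified]
  proof eventually_elim
    case (elim k)
    have int: "integrable M (\<lambda>\<omega>. (Y k \<omega> - X \<omega>)\<^sup>2)"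
      using elim unfolding sqdist_def by (simp add: integrable_iff_bounded order_less_trans)
    have eq: "expectation (\<lambda>\<omega>. (Y k \<omega> - X \<omega>)\<^sup>2) = enn2real (sqdist M (Y k) X)"
      unfolding sqdist_def by (rule integral_eq_nn_integral) auto
    have "expectation (\<lambda>\<omega>. iexp (t * Y k \<omega>)) - expectation (\<lambda>\<omega>. iexp (t * X \<omega>)) =
        expectation (\<lambda>\<omega>. iexp (t * Y k \<omega>) - iexp (t * X \<omega>))"
      by (intro Bochner_Integration.integral_diff[symmetric] integrable_iexp) auto
    also have "norm \<dots> \<le> expectation (\<lambda>\<omega>. \<bar>t\<bar> * \<bar>Y k \<omega> - X \<omega>\<bar>)"
    proof (rule order_trans[OF integral_norm_bound], rule integral_mono)
      show "integrable M (\<lambda>\<omega>. cmod (iexp (t * Y k \<omega>) - iexp (t * X \<omega>)))"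
        by (intro integrable_norm Bochner_Integration.integrable_diff integrable_iexp) auto
      show "integrable M (\<lambda>\<omega>. \<bar>t\<bar> * \<bar>Y k \<omega> - X \<omega>\<bar>)"
        using integrable_of_square[OF _ int] by simp
      fix \<omega>
      have "t * Y k \<omega> = t * X \<omega> + t * (Y k \<omega> - X \<omega>)"
        by (simp add: right_diff_distrib)
      then have "\<i> * complex_of_real (t * Y k \<omega>) = \<i> * complex_of_real (t * X \<omega>) + \<i> * complex_of_real (t * (Y k \<omega> - X \<omega>))"
        by (simp only: of_real_add distrib_left)
      then have "iexp (t * Y k \<omega>) - iexp (t * X \<omega>) = iexp (t * X \<omega>) * (iexp (t * (Y k \<omega> - X \<omega>)) - 1)"
        by (simp only: exp_add right_diff_distrib mult_1_right)
      then have "cmod (iexp (t * Y k \<omega>) - iexp (t * X \<omega>)) = cmod (iexp (t * (Y k \<omega> - X \<omega>)) - 1)"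
        by (simp only: norm_mult norm_exp_i_times mult_1)
      also have "\<dots> \<le> \<bar>t * (Y k \<omega> - X \<omega>)\<bar>"
        using iexp_approx1[of "t * (Y k \<omega> - X \<omega>)" 0] by simp
      finally show "cmod (iexp (t * Y k \<omega>) - iexp (t * X \<omega>)) \<le> \<bar>t\<bar> * \<bar>Y k \<omega> - X \<omega>\<bar>"
        by (simp only: abs_mult)
    qed
    also have "\<dots> = \<bar>t\<bar> * expectation (\<lambda>\<omega>. \<bar>Y k \<omega> - X \<omega>\<bar>)"
      by simp
    also have "\<dots> \<le> \<bar>t\<bar> * sqrt (expectation (\<lambda>\<omega>. (Y k \<omega> - X \<omega>)\<^sup>2))"
      by (intro mult_left_mono expectation_abs_le_sqrt int) auto
    finally show ?case
      unfolding eq .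
  qed
  moreover have "(\<lambda>k. \<bar>t\<bar> * sqrt (enn2real (sqdist M (Y k) X))) \<longlonglongrightarrow> \<bar>t\<bar> * sqrt 0"
    using tendsto_enn2real[OF lim[folded ennreal_0]]
    by (intro tendsto_mult tendsto_const tendsto_real_sqrt) simp
  then have "(\<lambda>k. \<bar>t\<bar> * sqrt (enn2real (sqdist M (Y k) X))) \<longlonglongrightarrow> 0"
    by simp
  ultimately have "(\<lambda>k. expectation (\<lambda>\<omega>. iexp (t * Y k \<omega>)) - expectation (\<lambda>\<omega>. iexp (t * X \<omega>))) \<longlonglongrightarrow> 0"
    by (rule Lim_null_comparison)
  then show ?thesis
    by (rule LIM_zero_cancel)
qed

text \<open>Expand the square of g = h + (g - h) and apply Cauchy-Schwarz to the mixed term. The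
  bound contains only the norm of the fixed h and the distance d, hence it vanishes with d.\<close>

lemma l2sq_difference_bound:
  assumes [measurable]: "g \<in> borel_measurable borel" "h \<in> borel_measurable borel"
    and fin: "l2sq g < \<infinity>" "l2sq h < \<infinity>"
  defines "d \<equiv> enn2real (sqdist lborel g h)"
  shows "\<bar>enn2real (l2sq g) - enn2real (l2sq h)\<bar> \<le> d + 2 * sqrt (enn2real (l2sq h) * d)"
    and "sqdist lborel g h < \<infinity>"
proof -
  have "sqdist lborel g h \<le> 2 * sqdist lborel g (\<lambda>_. 0) + 2 * sqdist lborel (\<lambda>_. 0) h"
    by (rule sqdist_triangle) auto
  also have "\<dots> < \<infinity>"
    using fin by (simp add: sqdist_def l2sq_def ennreal_mult_less_top)
  finally show fin_d: "sqdist lborel g h < \<infinity>" .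
  have ig: "integrable lborel (\<lambda>z. (g z)\<^sup>2)" and ih: "integrable lborel (\<lambda>z. (h z)\<^sup>2)"
    and id: "integrable lborel (\<lambda>z. (g z - h z)\<^sup>2)"
    using fin fin_d unfolding l2sq_def sqdist_def by (simp_all add: integrable_iff_bounded)
  have ihd: "integrable lborel (\<lambda>z. h z * (g z - h z))"
    by (rule integrable_mult_of_squares) (use ih id in auto)
  have eg: "(\<integral>z. (g z)\<^sup>2 \<partial>lborel) = enn2real (l2sq g)" and eh: "(\<integral>z. (h z)\<^sup>2 \<partial>lborel) = enn2real (l2sq h)"
    and ed: "(\<integral>z. (g z - h z)\<^sup>2 \<partial>lborel) = d"
    unfolding l2sq_def d_def sqdist_def by (intro integral_eq_nn_integral; simp)+
  define c where "c = (\<integral>z. h z * (g z - h z) \<partial>lborel)"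
  have "(\<lambda>z. (g z)\<^sup>2) = (\<lambda>z. (h z)\<^sup>2 + 2 * (h z * (g z - h z)) + (g z - h z)\<^sup>2)"
    by (rule ext) (simp add: power2_eq_square algebra_simps)
  then have split: "enn2real (l2sq g) = enn2real (l2sq h) + 2 * c + d"
    using ih id ihd by (simp add: c_def flip: eg eh ed)
  have "ennreal (c\<^sup>2) \<le> l2sq h * sqdist lborel g h"
    unfolding c_def l2sq_def sqdist_def by (rule Cauchy_Schwarz_Bochner) auto
  also have "\<dots> = ennreal (enn2real (l2sq h) * d)"
    using fin fin_d by (simp add: d_def ennreal_mult)
  finally have "c\<^sup>2 \<le> enn2real (l2sq h) * d"
    by (simp add: d_def)
  then have "\<bar>c\<bar> \<le> sqrt (enn2real (l2sq h) * d)"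
    using real_le_rsqrt[of "\<bar>c\<bar>"] by simp
  moreover have "0 \<le> d" by (simp add: d_def)
  ultimately show "\<bar>enn2real (l2sq g) - enn2real (l2sq h)\<bar> \<le> d + 2 * sqrt (enn2real (l2sq h) * d)"
    unfolding split by linarith
qed

text \<open>The bound for symmetrised approximants g k is taken to the limit. Of the three terms in
  \<open>l2sq_contract_perturb\<close>, two carry the distance from g k to h and vanish; the third
  explains the factor 3 under the root.\<close>

theorem (in wiener_process) wiener_ito2_char_bound:
  assumes h[measurable]: "h \<in> borel_measurable borel" and sym: "\<And>x y. h (x, y) = h (y, x)"
    and fin: "l2sq h < \<infinity>" and X: "is_wiener_ito2 M B h X"
  shows "cmod (expectation (\<lambda>\<omega>. iexp (t * X \<omega>)) - exp (- (enn2real (l2sq h) * t\<^sup>2)))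
    \<le> 4 * t\<^sup>2 * sqrt (3 * enn2real (l2sq (contract h h)))"
proof -
  obtain n \<tau> a where \<tau>: "\<And>k i. i < n k \<Longrightarrow> \<tau> k i < \<tau> k (Suc i)"
    and conv_h: "L2_converges lebesgue (\<lambda>k. off_diag_step (n k) (\<tau> k) (a k)) h"
    and conv_X: "L2_converges M (\<lambda>k. off_diag_step_integral B (n k) (\<tau> k) (a k)) X"
    and [measurable]: "X \<in> borel_measurable M"
    using X unfolding is_wiener_ito2_def by blast
  have part: "partition (n k) (\<tau> k)" for k
    unfolding partition_def using \<tau> by blast
  define f where "f k = off_diag_step (n k) (\<tau> k) (a k)" for k
  define Y where "Y k = off_diag_step_integral B (n k) (\<tau> k) (a k)" for k
  have [measurable]: "f k \<in> borel_measurable borel" "Y k \<in> borel_measurable M" for k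
    unfolding f_def Y_def by measurable
  have f_lim: "(\<lambda>k. sqdist lborel (f k) h) \<longlonglongrightarrow> 0"
    using conv_h unfolding L2_converges_eq f_def by (simp add: sqdist_lebesgue)
  have Y_lim: "(\<lambda>k. sqdist M (Y k) X) \<longlonglongrightarrow> 0"
    using conv_X unfolding L2_converges_eq Y_def .
  have "\<exists>g. g \<in> borel_measurable borel \<and> l2sq g < \<infinity> \<and> sqdist lborel g h \<le> sqdist lborel (f k) h \<and>
    cmod (expectation (\<lambda>\<omega>. iexp (t * Y k \<omega>)) - exp (- (enn2real (l2sq g) * t\<^sup>2)))
      \<le> 4 * t\<^sup>2 * sqrt (enn2real (l2sq (contract g g)))" for k
    unfolding f_def Y_def by (rule off_diag_step_symmetrization[OF part h sym, where a = "a k"]) blast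
  then obtain g where [measurable]: "\<And>k. g k \<in> borel_measurable borel" and gfin: "\<And>k. l2sq (g k) < \<infinity>"
    and gh: "\<And>k. sqdist lborel (g k) h \<le> sqdist lborel (f k) h"
    and bound: "\<And>k. cmod (expectation (\<lambda>\<omega>. iexp (t * Y k \<omega>)) - exp (- (enn2real (l2sq (g k)) * t\<^sup>2)))
      \<le> 4 * t\<^sup>2 * sqrt (enn2real (l2sq (contract (g k) (g k))))"
    by metis
  have g_lim: "(\<lambda>k. sqdist lborel (g k) h) \<longlonglongrightarrow> 0"
    by (rule tendsto_sandwich[OF _ _ tendsto_const f_lim]) (auto simp: gh)
  define s where "s = enn2real (l2sq h)"
  define q where "q = enn2real (l2sq (contract h h))"
  define d where "d k = enn2real (sqdist lborel (g k) h)" for k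
  define sk where "sk k = enn2real (l2sq (g k))" for k
  have d0: "d \<longlonglongrightarrow> 0"
    using tendsto_enn2real[OF g_lim[folded ennreal_0]] unfolding d_def by simp
  have d_nonneg: "0 \<le> d k" for k
    by (simp add: d_def)
  have "(\<lambda>k. sk k - s) \<longlonglongrightarrow> 0"
  proof (rule Lim_null_comparison)
    show "\<forall>\<^sub>F k in sequentially. norm (sk k - s) \<le> d k + 2 * sqrt (s * d k)"
      unfolding sk_def s_def d_def real_norm_def
      by (intro always_eventually allI l2sq_difference_bound(1) gfin fin) measurable
    have "(\<lambda>k. d k + 2 * sqrt (s * d k)) \<longlonglongrightarrow> 0 + 2 * sqrt (s * 0)"
      by (intro tendsto_intros d0)
    then show "(\<lambda>k. d k + 2 * sqrt (s * d k)) \<longlonglongrightarrow> 0"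
      by simp
  qed
  then have sk: "sk \<longlonglongrightarrow> s"
    by (rule LIM_zero_cancel)
  have cfin: "l2sq (contract h h) < \<infinity>"
    using l2sq_contract_le[OF h h] fin by (auto simp: ennreal_mult_less_top intro: order.strict_trans1)
  have Q: "enn2real (l2sq (contract (g k) (g k))) \<le> 3 * (d k * sk k) + 3 * (s * d k) + 3 * q" for k
  proof -
    have fin_d: "sqdist lborel (g k) h < \<infinity>"
      by (rule l2sq_difference_bound(2)[OF _ h gfin fin]) measurable
    have "l2sq (contract (g k) (g k)) \<le>
        3 * (sqdist lborel (g k) h * l2sq (g k)) + 3 * (l2sq h * sqdist lborel (g k) h) + 3 * l2sq (contract h h)"
      by (rule l2sq_contract_perturb[OF _ h gfin fin]) measurable
    also have "\<dots> = 3 * (ennreal (d k) * ennreal (sk k)) + 3 * (ennreal s * ennreal (d k)) + 3 * ennreal q"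
      using fin_d gfin[of k] fin cfin by (simp add: d_def sk_def s_def q_def)
    also have "\<dots> = ennreal (3 * (d k * sk k) + 3 * (s * d k) + 3 * q)"
      by (simp add: ennreal_mult d_def sk_def s_def q_def)
    finally have "enn2real (l2sq (contract (g k) (g k))) \<le> enn2real (ennreal (3 * (d k * sk k) + 3 * (s * d k) + 3 * q))"
      by (rule enn2real_mono) simp
    also have "\<dots> = 3 * (d k * sk k) + 3 * (s * d k) + 3 * q"
      by (rule enn2real_ennreal) (simp add: d_def sk_def s_def q_def)
    finally show ?thesis .
  qed
  have lhs: "(\<lambda>k. cmod (expectation (\<lambda>\<omega>. iexp (t * Y k \<omega>)) - complex_of_real (exp (- (sk k * t\<^sup>2)))))
      \<longlonglongrightarrow> cmod (expectation (\<lambda>\<omega>. iexp (t * X \<omega>)) - complex_of_real (exp (- (s * t\<^sup>2))))"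
    by (intro tendsto_intros tendsto_expectation_iexp_L2 Y_lim sk) auto
  have rhs: "(\<lambda>k. 4 * t\<^sup>2 * sqrt (3 * (d k * sk k) + 3 * (s * d k) + 3 * q))
      \<longlonglongrightarrow> 4 * t\<^sup>2 * sqrt (3 * (0 * s) + 3 * (s * 0) + 3 * q)"
    by (intro tendsto_intros d0 sk)
  have "cmod (expectation (\<lambda>\<omega>. iexp (t * Y k \<omega>)) - complex_of_real (exp (- (sk k * t\<^sup>2))))
      \<le> 4 * t\<^sup>2 * sqrt (3 * (d k * sk k) + 3 * (s * d k) + 3 * q)" for k
  proof -
    have "4 * t\<^sup>2 * sqrt (enn2real (l2sq (contract (g k) (g k)))) \<le> 4 * t\<^sup>2 * sqrt (3 * (d k * sk k) + 3 * (s * d k) + 3 * q)"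
      using Q[of k] by (intro mult_left_mono real_sqrt_le_mono) auto
    with bound[of k] show ?thesis
      unfolding sk_def by linarith
  qed
  then have "cmod (expectation (\<lambda>\<omega>. iexp (t * X \<omega>)) - complex_of_real (exp (- (s * t\<^sup>2))))
      \<le> 4 * t\<^sup>2 * sqrt (3 * (0 * s) + 3 * (s * 0) + 3 * q)"
    by (intro LIMSEQ_le[OF lhs rhs]) blast
  then show ?thesis
    by (simp add: s_def q_def)
qed

section \<open>The Rosenblatt kernel\<close>

text \<open>Substitution \<open>y = u - d z / (1 - z)\<close> with \<open>d = v - u\<close>, mapping \<open>]0, 1[\<close> onto \<open>]-\<infinity>, u[\<close>.\<close>

lemma nn_integral_Beta_kernel_less:
  fixes H u v :: real
  assumes H: "0 < H" "H < 1" and "u < v"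
  shows "(\<integral>\<^sup>+y. ennreal ((max (u - y) 0) powr (H / 2 - 1) * (max (v - y) 0) powr (H / 2 - 1)) \<partial>lborel) =
    ennreal (Beta (H / 2) (1 - H) * \<bar>u - v\<bar> powr (H - 1))"
proof -
  define d where "d = v - u"
  define F where "F = (\<lambda>y. (max (u - y) 0) powr (H / 2 - 1) * (max (v - y) 0) powr (H / 2 - 1))"
  define g where "g = (\<lambda>z. u - d * z / (1 - z))"
  define g' where "g' = (\<lambda>z. - d / (1 - z)\<^sup>2)"
  define I where "I = Beta (H / 2) (1 - H) * d powr (H - 1)"
  have "d > 0"
    using \<open>u < v\<close> by (simp add: d_def)
  have img: "g ` {0<..<1} = {..<u}"
  proof (intro set_eqI iffI)
    fix y assume "y \<in> {..<u}"
    \<comment> \<open>The solution of y = u - d z / (1 - z) for z.\<close>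
    define z where "z = (u - y) / (d + (u - y))"
    have "u - y > 0" using \<open>y \<in> _\<close> by simp
    then have "z \<in> {0<..<1}" "1 - z = d / (d + (u - y))"
      using \<open>d > 0\<close> by (simp_all add: z_def field_simps)
    moreover have "g z = y"
      using \<open>d > 0\<close> \<open>u - y > 0\<close> unfolding g_def \<open>1 - z = _\<close> by (simp add: z_def)
    ultimately show "y \<in> g ` {0<..<1}" by blast
  next
    fix y assume "y \<in> g ` {0<..<1}"
    then show "y \<in> {..<u}"
      using \<open>d > 0\<close> by (auto simp: g_def)
  qed
  have der: "(g has_field_derivative g' z) (at z within {0<..<1})" if "z \<in> {0<..<1}" for z
    unfolding g_def g'_def using that
    by (auto intro!: derivative_eq_intros simp: field_simps power2_eq_square)
  have inj: "inj_on g {0<..<1}"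
  proof (rule inj_onI)
    fix x y :: real assume xy: "x \<in> {0<..<1}" "y \<in> {0<..<1}" "g x = g y"
    then have "x / (1 - x) = y / (1 - y)"
      using \<open>d > 0\<close> by (simp add: g_def times_divide_eq_right[symmetric] del: times_divide_eq_right)
    with xy show "x = y"
      by (simp add: field_simps)
  qed
  \<comment> \<open>Counting exponents: d receives 1 + 2 (H / 2 - 1) = H - 1, z receives H / 2 - 1
    from the first factor only, and 1 - z receives -2 - 2 (H / 2 - 1) = -H = (1 - H) - 1. What
    remains is the integrand of Beta (H / 2) (1 - H).\<close>
  have pull: "\<bar>g' z\<bar> * F (g z) = d powr (H - 1) * (z powr (H / 2 - 1) * (1 - z) powr ((1 - H) - 1))"
    if z: "z \<in> {0<..<1}" for z
  proof -
    have e1: "max (u - g z) 0 = d * z / (1 - z)"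
      using z \<open>d > 0\<close> by (simp add: g_def)
    have "v - g z = d / (1 - z)"
      using z by (simp add: g_def d_def field_simps)
    then have e2: "max (v - g z) 0 = d / (1 - z)"
      using z \<open>d > 0\<close> by simp
    have e3: "\<bar>g' z\<bar> = d powr 1 * (1 - z) powr (- 2)"
      using z \<open>d > 0\<close> by (simp add: g'_def powr_minus powr_numeral divide_inverse)
    have "\<bar>g' z\<bar> * F (g z) = (d powr 1 * d powr (H / 2 - 1) * d powr (H / 2 - 1)) * z powr (H / 2 - 1) *
        ((1 - z) powr (- 2) * (1 - z) powr (- (H / 2 - 1)) * (1 - z) powr (- (H / 2 - 1)))"
    proof -
      have "(d * z / (1 - z)) powr a = d powr a * z powr a * (1 - z) powr (- a)"
        and "(d / (1 - z)) powr a = d powr a * (1 - z) powr (- a)" for a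
        using z \<open>d > 0\<close> by (simp_all add: powr_divide powr_mult powr_minus_divide)
      then show ?thesis
        unfolding F_def e1 e2 e3 by (simp only: mult_ac)
    qed
    also have "\<dots> = d powr (1 + (H / 2 - 1) + (H / 2 - 1)) * z powr (H / 2 - 1) *
        (1 - z) powr (- 2 + - (H / 2 - 1) + - (H / 2 - 1))"
      using z \<open>d > 0\<close> by (simp only: powr_add[symmetric])
    also have "\<dots> = d powr (H - 1) * (z powr (H / 2 - 1) * (1 - z) powr ((1 - H) - 1))"
      by (simp add: mult.assoc)
    finally show ?thesis .
  qed
  have "((\<lambda>z. z powr (H / 2 - 1) * (1 - z) powr ((1 - H) - 1)) has_integral Beta (H / 2) (1 - H)) {0..1}"
    by (rule has_integral_Beta_real) (use H in auto)
  then have "((\<lambda>z. d powr (H - 1) * (z powr (H / 2 - 1) * (1 - z) powr ((1 - H) - 1))) has_integral d powr (H - 1) * Beta (H / 2) (1 - H)) {0<..<1}"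
    unfolding has_integral_Icc_iff_Ioo by (rule has_integral_mult_right)
  then have pulled: "((\<lambda>z. \<bar>g' z\<bar> * F (g z)) has_integral I) {0<..<1}"
    by (subst has_integral_cong[OF pull]) (simp_all add: I_def mult.commute)
  have "(\<lambda>z. \<bar>g' z\<bar> * F (g z)) absolutely_integrable_on {0<..<1}"
    by (rule nonnegative_absolutely_integrable_1) (use pulled in \<open>auto simp: F_def has_integral_integrable\<close>)
  then have "F absolutely_integrable_on {..<u} \<and> integral {..<u} F = I"
    using has_absolute_integral_change_of_variables_1'[OF _ der inj, of F I] integral_unique[OF pulled]
    unfolding img by simp
  then have "(F has_integral I) {..<u}"
    using absolutely_integrable_on_def integrable_integral by blast
  then have "(\<integral>\<^sup>+y. ennreal (F y) * indicator {..<u} y \<partial>lborel) = ennreal I"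
    by (intro nn_integral_has_integral_lebesgue') (auto simp: F_def)
  \<comment> \<open>For y \<ge> u the base \<open>max (u - y) 0\<close> is 0, and 0 to any power is
    0, so F vanishes outside the half-line.\<close>
  moreover have "(\<integral>\<^sup>+y. ennreal (F y) * indicator {..<u} y \<partial>lborel) = (\<integral>\<^sup>+y. ennreal (F y) \<partial>lborel)"
    by (intro nn_integral_cong) (auto simp: F_def indicator_def)
  ultimately show ?thesis
    using \<open>u < v\<close> by (simp add: F_def I_def d_def)
qed

lemma nn_integral_Beta_kernel:
  fixes H u v :: real
  assumes H: "0 < H" "H < 1" and "u \<noteq> v"
  shows "(\<integral>\<^sup>+y. ennreal ((max (u - y) 0) powr (H / 2 - 1) * (max (v - y) 0) powr (H / 2 - 1)) \<partial>lborel) =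
    ennreal (Beta (H / 2) (1 - H) * \<bar>u - v\<bar> powr (H - 1))"
proof (cases "u < v")
  case True
  then show ?thesis
    by (rule nn_integral_Beta_kernel_less[OF H])
next
  case False
  then have "v < u" using \<open>u \<noteq> v\<close> by simp
  from nn_integral_Beta_kernel_less[OF H this] show ?thesis
    by (simp add: mult.commute abs_minus_commute)
qed

lemma Beta_pos_real: "0 < a \<Longrightarrow> 0 < b \<Longrightarrow> 0 < Beta a (b :: real)"
  by (simp add: Beta_def Gamma_real_pos)

text \<open>For almost every y the product of the two inner integrals is one integral over the
  product of A and B, and Fubini moves the integral over y inside. Finiteness is required with the
  y-integral innermost, since that is the integral which the Beta identity evaluates in closed
  form.\<close>

lemma
  fixes \<phi> \<eta> :: "_ \<Rightarrow> real"
  assumes "sigma_finite_measure A" "sigma_finite_measure B" "sigma_finite_measure N"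
    and [measurable]: "\<phi> \<in> borel_measurable (A \<Otimes>\<^sub>M N)" "\<eta> \<in> borel_measurable (B \<Otimes>\<^sub>M N)"
    and fin: "(\<integral>\<^sup>+p. \<integral>\<^sup>+y. ennreal \<bar>\<phi> (fst p, y) * \<eta> (snd p, y)\<bar> \<partial>N \<partial>(A \<Otimes>\<^sub>M B)) < \<infinity>"
  shows Fubini_bilinear: "(\<integral>y. (\<integral>a. \<phi> (a, y) \<partial>A) * (\<integral>b. \<eta> (b, y) \<partial>B) \<partial>N) =
      (\<integral>p. (\<integral>y. \<phi> (fst p, y) * \<eta> (snd p, y) \<partial>N) \<partial>(A \<Otimes>\<^sub>M B))"
    and Fubini_bilinear_integrable: "integrable N (\<lambda>y. (\<integral>a. \<phi> (a, y) \<partial>A) * (\<integral>b. \<eta> (b, y) \<partial>B))"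
proof -
  interpret A: sigma_finite_measure A by fact
  interpret B: sigma_finite_measure B by fact
  interpret N: sigma_finite_measure N by fact
  interpret AB: pair_sigma_finite A B ..
  interpret ABN: pair_sigma_finite "A \<Otimes>\<^sub>M B" N ..
  define F where "F = (\<lambda>(p, y). \<phi> (fst p, y) * \<eta> (snd p, y))"
  have [measurable]: "F \<in> borel_measurable ((A \<Otimes>\<^sub>M B) \<Otimes>\<^sub>M N)"
    unfolding F_def by measurable
  have int: "integrable ((A \<Otimes>\<^sub>M B) \<Otimes>\<^sub>M N) F"
    unfolding integrable_iff_bounded
  proof
    have "(\<integral>\<^sup>+z. ennreal (norm (F z)) \<partial>((A \<Otimes>\<^sub>M B) \<Otimes>\<^sub>M N)) =
        (\<integral>\<^sup>+p. \<integral>\<^sup>+y. ennreal (norm (F (p, y))) \<partial>N \<partial>(A \<Otimes>\<^sub>M B))"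
      by (rule N.nn_integral_fst[symmetric]) measurable
    then show "(\<integral>\<^sup>+z. ennreal (norm (F z)) \<partial>((A \<Otimes>\<^sub>M B) \<Otimes>\<^sub>M N)) < \<infinity>"
      using fin by (simp add: F_def)
  qed measurable
  have inner: "AE y in N. (\<integral>p. F (p, y) \<partial>(A \<Otimes>\<^sub>M B)) = (\<integral>a. \<phi> (a, y) \<partial>A) * (\<integral>b. \<eta> (b, y) \<partial>B)"
  proof -
    have "AE y in N. integrable (A \<Otimes>\<^sub>M B) (\<lambda>p. F (p, y))"
      using ABN.AE_integrable_snd[of "\<lambda>p y. F (p, y)"] int by (simp add: case_prod_beta')
    then show ?thesis
    proof eventually_elim
      case (elim y)
      have "(\<integral>p. F (p, y) \<partial>(A \<Otimes>\<^sub>M B)) = (\<integral>a. \<integral>b. F ((a, b), y) \<partial>B \<partial>A)"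
        using AB.integral_fst'[OF elim] by simp
      then show ?case
        by (simp add: F_def)
    qed
  qed
  have int_y: "integrable N (\<lambda>y. \<integral>p. F (p, y) \<partial>(A \<Otimes>\<^sub>M B))"
    using ABN.integrable_snd[of "\<lambda>p y. F (p, y)"] int by (simp add: case_prod_beta')
  show "integrable N (\<lambda>y. (\<integral>a. \<phi> (a, y) \<partial>A) * (\<integral>b. \<eta> (b, y) \<partial>B))"
    using integrable_cong_AE[OF _ _ inner] int_y by simp
  have "(\<integral>y. (\<integral>a. \<phi> (a, y) \<partial>A) * (\<integral>b. \<eta> (b, y) \<partial>B) \<partial>N) = (\<integral>y. (\<integral>p. F (p, y) \<partial>(A \<Otimes>\<^sub>M B)) \<partial>N)"
    using inner by (intro integral_cong_AE) auto
  also have "\<dots> = (\<integral>p. (\<integral>y. F (p, y) \<partial>N) \<partial>(A \<Otimes>\<^sub>M B))"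
    using ABN.Fubini_integral[of "\<lambda>p y. F (p, y)"] int by (simp add: case_prod_beta')
  finally show "(\<integral>y. (\<integral>a. \<phi> (a, y) \<partial>A) * (\<integral>b. \<eta> (b, y) \<partial>B) \<partial>N) =
      (\<integral>p. (\<integral>y. \<phi> (fst p, y) * \<eta> (snd p, y) \<partial>N) \<partial>(A \<Otimes>\<^sub>M B))"
    by (simp add: F_def)
qed

text \<open>By Tonelli the hypothesis bounds the integral over y of the square of the integral of
  |\<phi>(a, y)| over a, so this inner integral is finite for almost every y.\<close>

lemma AE_finite_of_bilinear:
  fixes \<phi> :: "_ \<Rightarrow> real"
  assumes "sigma_finite_measure A" "sigma_finite_measure N"
    and [measurable]: "\<phi> \<in> borel_measurable (A \<Otimes>\<^sub>M N)"
    and fin: "(\<integral>\<^sup>+p. \<integral>\<^sup>+y. ennreal \<bar>\<phi> (fst p, y) * \<phi> (snd p, y)\<bar> \<partial>N \<partial>(A \<Otimes>\<^sub>M A)) < \<infinity>"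
  shows "AE y in N. (\<integral>\<^sup>+a. ennreal \<bar>\<phi> (a, y)\<bar> \<partial>A) < \<infinity>"
proof -
  interpret A: sigma_finite_measure A by fact
  interpret N: sigma_finite_measure N by fact
  interpret AA: pair_sigma_finite A A ..
  interpret AAN: pair_sigma_finite "A \<Otimes>\<^sub>M A" N ..
  have "(\<integral>\<^sup>+p. \<integral>\<^sup>+y. ennreal \<bar>\<phi> (fst p, y) * \<phi> (snd p, y)\<bar> \<partial>N \<partial>(A \<Otimes>\<^sub>M A)) =
      (\<integral>\<^sup>+y. \<integral>\<^sup>+p. ennreal \<bar>\<phi> (fst p, y) * \<phi> (snd p, y)\<bar> \<partial>(A \<Otimes>\<^sub>M A) \<partial>N)"
    using AAN.Fubini'[of "\<lambda>p y. ennreal \<bar>\<phi> (fst p, y) * \<phi> (snd p, y)\<bar>"] by simp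
  with fin have "(\<integral>\<^sup>+y. \<integral>\<^sup>+p. ennreal \<bar>\<phi> (fst p, y) * \<phi> (snd p, y)\<bar> \<partial>(A \<Otimes>\<^sub>M A) \<partial>N) \<noteq> \<infinity>"
    by simp
  moreover have "(\<lambda>y. \<integral>\<^sup>+p. ennreal \<bar>\<phi> (fst p, y) * \<phi> (snd p, y)\<bar> \<partial>(A \<Otimes>\<^sub>M A)) \<in> borel_measurable N"
    by measurable
  ultimately have "AE y in N. (\<integral>\<^sup>+p. ennreal \<bar>\<phi> (fst p, y) * \<phi> (snd p, y)\<bar> \<partial>(A \<Otimes>\<^sub>M A)) \<noteq> \<infinity>"
    by (intro nn_integral_PInf_AE)
  with AE_space show ?thesis
  proof eventually_elim
    case (elim y)
    then have [measurable]: "(\<lambda>a. \<phi> (a, y)) \<in> borel_measurable A"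
      by measurable
    have "(\<integral>\<^sup>+p. ennreal \<bar>\<phi> (fst p, y) * \<phi> (snd p, y)\<bar> \<partial>(A \<Otimes>\<^sub>M A)) =
        (\<integral>\<^sup>+a. \<integral>\<^sup>+b. ennreal \<bar>\<phi> (a, y)\<bar> * ennreal \<bar>\<phi> (b, y)\<bar> \<partial>A \<partial>A)"
      by (subst A.nn_integral_fst[symmetric]) (simp_all add: abs_mult ennreal_mult)
    also have "\<dots> = (\<integral>\<^sup>+a. ennreal \<bar>\<phi> (a, y)\<bar> \<partial>A) * (\<integral>\<^sup>+b. ennreal \<bar>\<phi> (b, y)\<bar> \<partial>A)"
      by (simp add: nn_integral_cmult nn_integral_multc)
    finally show ?case
      using elim by (auto simp: less_top ennreal_mult_eq_top_iff)
  qed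
qed

section \<open>The norm of the unnormalised kernel and the four-cycle integrand\<close>

abbreviation lborel2 :: "(real \<times> real) measure" where
  "lborel2 \<equiv> lborel \<Otimes>\<^sub>M lborel"

abbreviation lborel4 :: "((real \<times> real) \<times> (real \<times> real)) measure" where
  "lborel4 \<equiv> lborel2 \<Otimes>\<^sub>M lborel2"

abbreviation pair_integrand :: "real \<Rightarrow> (real \<Rightarrow> real) \<Rightarrow> real \<times> real \<Rightarrow> real" where
  "pair_integrand H f p \<equiv> f (fst p) * f (snd p) * \<bar>fst p - snd p\<bar> powr (2 * H - 2)"

definition four_cycle :: "real \<Rightarrow> (real \<Rightarrow> real) \<Rightarrow> real \<times> real \<times> real \<times> real \<Rightarrow> real" where
  "four_cycle H f = (\<lambda>(u1, u2, u3, u4). f u1 * f u2 * f u3 * f u4 *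
     \<bar>u1 - u2\<bar> powr (H - 1) * \<bar>u2 - u3\<bar> powr (H - 1) * \<bar>u3 - u4\<bar> powr (H - 1) * \<bar>u4 - u1\<bar> powr (H - 1))"

lemma lborel_sigma_finite: "sigma_finite_measure lborel" "sigma_finite_measure lborel2"
  by (rule lborel.sigma_finite_measure_axioms) (simp add: lborel_prod lborel.sigma_finite_measure_axioms)

lemma nn_integral_pair_mult:
  fixes g h :: "real \<Rightarrow> real"
  assumes [measurable]: "g \<in> borel_measurable borel" "h \<in> borel_measurable borel" and "\<And>x. 0 \<le> g x" "\<And>x. 0 \<le> h x"
  shows "(\<integral>\<^sup>+y. ennreal (g (fst y) * h (snd y)) \<partial>lborel2) = (\<integral>\<^sup>+x. g x \<partial>lborel) * (\<integral>\<^sup>+x. h x \<partial>lborel)"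
proof -
  have "(\<integral>\<^sup>+y. ennreal (g (fst y) * h (snd y)) \<partial>lborel2) = (\<integral>\<^sup>+x. \<integral>\<^sup>+y. ennreal (g x) * ennreal (h y) \<partial>lborel \<partial>lborel)"
    using assms(3,4) by (subst lborel.nn_integral_fst[symmetric]) (simp_all add: ennreal_mult)
  then show ?thesis
    by (simp add: nn_integral_cmult nn_integral_multc)
qed

lemma AE_pair_off_diagonal: "AE p in lborel2. fst p \<noteq> (snd p :: real)"
  using AE_lborel_off_diagonal unfolding lborel_prod .

text \<open>The Beta identity requires distinct arguments. These are the two pairs of variables that
  share a coordinate of y when the contraction is squared.\<close>

lemma AE_pair_pair_off_diagonal:
  "AE q in lborel4.
     fst (fst q) \<noteq> (fst (snd q) :: real) \<and> snd (fst q) \<noteq> (snd (snd q) :: real)"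
proof -
  interpret LL: pair_sigma_finite "lborel2" "lborel2"
    by (intro pair_sigma_finite.intro lborel_sigma_finite)
  show ?thesis
  proof (rule LL.AE_pair_measure)
    show "AE p in lborel2. AE p' in lborel2.
      fst (fst (p, p')) \<noteq> (fst (snd (p, p')) :: real) \<and> snd (fst (p, p')) \<noteq> (snd (snd (p, p')) :: real)"
    proof (rule AE_I2)
      fix p :: "real \<times> real"
      show "AE p' in lborel2. fst (fst (p, p')) \<noteq> (fst (snd (p, p')) :: real) \<and> snd (fst (p, p')) \<noteq> (snd (snd (p, p')) :: real)"
        using AE_lborel_fst[OF AE_lborel_singleton[of "fst p"]] AE_lborel_snd[OF AE_lborel_singleton[of "snd p"]]
        unfolding lborel_prod by eventually_elim auto
    qed
  qed measurable
qed

text \<open>The function f is taken Borel measurable, so that all integrands below are measurable on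
  products of Borel measures; \<open>rosenblatt_borel_representative\<close> reduces the general
  case to this one.\<close>

locale rosenblatt_integrand =
  fixes H :: real and f :: "real \<Rightarrow> real"
  assumes H: "1 / 2 < H" "H < 1"
    and f[measurable]: "f \<in> borel_measurable borel"
    and f_int: "integrable lborel2 (\<lambda>p. pair_integrand H f p)"
begin

definition K :: "real \<Rightarrow> real \<Rightarrow> real" where
  "K u y = (max (u - y) 0) powr (H / 2 - 1)"

definition r :: "real \<Rightarrow> real \<Rightarrow> real" where
  "r u v = \<bar>u - v\<bar> powr (H - 1)"

definition b :: real where
  "b = Beta (H / 2) (1 - H)"

lemma K_nonneg[simp]: "0 \<le> K u y" and r_nonneg[simp]: "0 \<le> r u v"
  by (simp_all add: K_def r_def)

lemma b_pos: "0 < b"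
  unfolding b_def by (rule Beta_pos_real) (use H in simp_all)

lemma measurable_K[measurable]: "g \<in> borel_measurable M \<Longrightarrow> h \<in> borel_measurable M \<Longrightarrow> (\<lambda>x. K (g x) (h x)) \<in> borel_measurable M"
  unfolding K_def by measurable

lemma measurable_r[measurable]: "g \<in> borel_measurable M \<Longrightarrow> h \<in> borel_measurable M \<Longrightarrow> (\<lambda>x. r (g x) (h x)) \<in> borel_measurable M"
  unfolding r_def by measurable

lemma r_square: "(r u v)\<^sup>2 = \<bar>u - v\<bar> powr (2 * H - 2)"
proof -
  have "(r u v)\<^sup>2 = \<bar>u - v\<bar> powr ((H - 1) + (H - 1))"
    unfolding r_def power2_eq_square by (rule powr_add[symmetric])
  then show ?thesis
    by (simp add: algebra_simps)
qed

lemma nn_integral_kernel_product: "u \<noteq> v \<Longrightarrow> (\<integral>\<^sup>+y. ennreal (K u y * K v y) \<partial>lborel) = ennreal (b * r u v)"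
  unfolding K_def b_def r_def by (rule nn_integral_Beta_kernel) (use H in simp_all)

lemma integral_kernel_product: "u \<noteq> v \<Longrightarrow> (\<integral>y. K u y * K v y \<partial>lborel) = b * r u v"
  using b_pos by (subst integral_eq_nn_integral) (auto simp: nn_integral_kernel_product)

lemma nn_integral_kernel_products:
  assumes "u \<noteq> u'" "v \<noteq> v'"
  shows "(\<integral>\<^sup>+y. ennreal ((K u (fst y) * K u' (fst y)) * (K v (snd y) * K v' (snd y))) \<partial>lborel2) =
    ennreal (b\<^sup>2 * (r u u' * r v v'))"
proof -
  have "(\<integral>\<^sup>+y. ennreal ((K u (fst y) * K u' (fst y)) * (K v (snd y) * K v' (snd y))) \<partial>lborel2) =
      (\<integral>\<^sup>+y. ennreal (K u y * K u' y) \<partial>lborel) * (\<integral>\<^sup>+y. ennreal (K v y * K v' y) \<partial>lborel)"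
    by (rule nn_integral_pair_mult) (auto intro: mult_nonneg_nonneg)
  also have "\<dots> = ennreal (b * r u u' * (b * r v v'))"
    unfolding nn_integral_kernel_product[OF assms(1)] nn_integral_kernel_product[OF assms(2)]
    using b_pos by (intro ennreal_mult[symmetric]) auto
  finally show ?thesis
    by (simp add: power2_eq_square mult_ac)
qed

lemma integral_kernel_products:
  assumes "u \<noteq> u'" "v \<noteq> v'"
  shows "(\<integral>y. (K u (fst y) * K u' (fst y)) * (K v (snd y) * K v' (snd y)) \<partial>lborel2) =
    b\<^sup>2 * (r u u' * r v v')"
  by (subst integral_eq_nn_integral) (auto simp: nn_integral_kernel_products[OF assms])

definition \<Phi> :: "real \<times> real \<Rightarrow> real" where
  "\<Phi> y = (\<integral>u. f u * K u (fst y) * K u (snd y) \<partial>lborel)"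

lemma \<Phi>_sym: "\<Phi> (x, y) = \<Phi> (y, x)"
  by (simp add: \<Phi>_def mult_ac)

lemma measurable_\<Phi>[measurable]: "\<Phi> \<in> borel_measurable lborel2"
  unfolding \<Phi>_def by measurable

text \<open>Squaring introduces a second variable v. For fixed u and v the integral over y = (y1,
  y2) factors into two Beta integrals, each equal to b |u - v|^(H - 1), and their product is b^2
  times the weight of the Rosenblatt norm.\<close>

lemma \<Phi>_square_integral:
  "integrable lborel2 (\<lambda>y. (\<Phi> y)\<^sup>2)"
  "(\<integral>y. (\<Phi> y)\<^sup>2 \<partial>lborel2) =
    b\<^sup>2 * (\<integral>p. pair_integrand H f p \<partial>lborel2)"
proof -
  define \<kappa> where "\<kappa> = (\<lambda>(u, y). f u * K u (fst y) * K u (snd y))"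
  have [measurable]: "\<kappa> \<in> borel_measurable (lborel \<Otimes>\<^sub>M lborel2)"
    unfolding \<kappa>_def by measurable
  have \<kappa>: "\<kappa> (u, y) * \<kappa> (v, y) = (f u * f v) * ((K u (fst y) * K v (fst y)) * (K u (snd y) * K v (snd y)))" for u v y
    by (simp add: \<kappa>_def mult_ac)
  have nn: "AE p in lborel2. (\<integral>\<^sup>+y. ennreal \<bar>\<kappa> (fst p, y) * \<kappa> (snd p, y)\<bar> \<partial>lborel2) =
      ennreal (b\<^sup>2) * ennreal \<bar>pair_integrand H f p\<bar>"
    using AE_pair_off_diagonal
  proof eventually_elim
    case (elim p)
    have "(\<integral>\<^sup>+y. ennreal \<bar>\<kappa> (fst p, y) * \<kappa> (snd p, y)\<bar> \<partial>lborel2) =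
      (\<integral>\<^sup>+y. ennreal \<bar>f (fst p) * f (snd p)\<bar> * ennreal ((K (fst p) (fst y) * K (snd p) (fst y)) * (K (fst p) (snd y) * K (snd p) (snd y))) \<partial>lborel2)"
      unfolding \<kappa> by (intro nn_integral_cong) (simp add: abs_mult ennreal_mult)
    also have "\<dots> = ennreal \<bar>f (fst p) * f (snd p)\<bar> * ennreal (b\<^sup>2 * (r (fst p) (snd p) * r (fst p) (snd p)))"
      by (subst nn_integral_cmult) (simp_all add: nn_integral_kernel_products[OF elim elim])
    also have "\<dots> = ennreal (\<bar>f (fst p) * f (snd p)\<bar> * (b\<^sup>2 * (r (fst p) (snd p) * r (fst p) (snd p))))"
      by (rule ennreal_mult[symmetric]) simp_all
    also have "\<bar>f (fst p) * f (snd p)\<bar> * (b\<^sup>2 * (r (fst p) (snd p) * r (fst p) (snd p))) =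
        b\<^sup>2 * \<bar>pair_integrand H f p\<bar>"
      by (simp add: abs_mult flip: r_square) (simp add: power2_eq_square)
    finally show ?case
      by (simp add: ennreal_mult)
  qed
  have "(\<integral>\<^sup>+p. \<integral>\<^sup>+y. ennreal \<bar>\<kappa> (fst p, y) * \<kappa> (snd p, y)\<bar> \<partial>lborel2 \<partial>lborel2) =
      (\<integral>\<^sup>+p. ennreal (b\<^sup>2) * ennreal \<bar>pair_integrand H f p\<bar> \<partial>lborel2)"
    by (rule nn_integral_cong_AE[OF nn])
  also have "\<dots> < \<infinity>"
    using f_int by (subst nn_integral_cmult) (simp_all add: integrable_iff_bounded ennreal_mult_less_top)
  finally have fin: "(\<integral>\<^sup>+p. \<integral>\<^sup>+y. ennreal \<bar>\<kappa> (fst p, y) * \<kappa> (snd p, y)\<bar> \<partial>lborel2 \<partial>lborel2) < \<infinity>" .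
  have \<Phi>: "(\<integral>u. \<kappa> (u, y) \<partial>lborel) = \<Phi> y" for y
    by (simp add: \<kappa>_def \<Phi>_def)
  note bil = Fubini_bilinear_integrable[OF lborel_sigma_finite(1) lborel_sigma_finite(1) lborel_sigma_finite(2) _ _ fin]
    Fubini_bilinear[OF lborel_sigma_finite(1) lborel_sigma_finite(1) lborel_sigma_finite(2) _ _ fin]
  show "integrable lborel2 (\<lambda>y. (\<Phi> y)\<^sup>2)"
    using bil(1) unfolding \<Phi> power2_eq_square by simp
  have "(\<integral>y. (\<Phi> y)\<^sup>2 \<partial>lborel2) = (\<integral>p. (\<integral>y. \<kappa> (fst p, y) * \<kappa> (snd p, y) \<partial>lborel2) \<partial>lborel2)"
    using bil(2) unfolding \<Phi> power2_eq_square by simp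
  also have "\<dots> = (\<integral>p. b\<^sup>2 * (pair_integrand H f p) \<partial>lborel2)"
  proof (rule integral_cong_AE)
    show "AE p in lborel2. (\<integral>y. \<kappa> (fst p, y) * \<kappa> (snd p, y) \<partial>lborel2) =
        b\<^sup>2 * (pair_integrand H f p)"
      using AE_pair_off_diagonal
    proof eventually_elim
      case (elim p)
      have "(\<integral>y. \<kappa> (fst p, y) * \<kappa> (snd p, y) \<partial>lborel2) =
          (f (fst p) * f (snd p)) * (b\<^sup>2 * (r (fst p) (snd p) * r (fst p) (snd p)))"
        unfolding \<kappa> integral_mult_right_zero integral_kernel_products[OF elim elim] ..
      then show ?case
        unfolding r_square[symmetric] power2_eq_square by (simp only: mult_ac)
    qed
  qed measurable
  also have "\<dots> = b\<^sup>2 * (\<integral>p. pair_integrand H f p \<partial>lborel2)"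
    by (rule integral_mult_right_zero)
  finally show "(\<integral>y. (\<Phi> y)\<^sup>2 \<partial>lborel2) =
    b\<^sup>2 * (\<integral>p. pair_integrand H f p \<partial>lborel2)" .
qed

text \<open>The four-cycle with vertices grouped as ((u, v), (u', v')), the form in which it arises
  from squaring the contraction: the edges uv and u'v' come from the contracted variable, the edges
  uu' and vv' from the two free ones.\<close>

definition paired_cycle :: "(real \<times> real) \<times> (real \<times> real) \<Rightarrow> real" where
  "paired_cycle q = (f (fst (fst q)) * f (snd (fst q)) * r (fst (fst q)) (snd (fst q))) *
     (f (fst (snd q)) * f (snd (snd q)) * r (fst (snd q)) (snd (snd q))) *
     (r (fst (fst q)) (fst (snd q)) * r (snd (fst q)) (snd (snd q)))"

lemma measurable_paired_cycle[measurable]: "paired_cycle \<in> borel_measurable lborel4"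
  unfolding paired_cycle_def by measurable

text \<open>The absolute value of \<open>pair_integrand\<close> with separate arguments, so that
  weights between variables of different pairs can be formed.\<close>

definition pair_weight :: "real \<Rightarrow> real \<Rightarrow> real" where
  "pair_weight u v = \<bar>f u * f v\<bar> * (r u v)\<^sup>2"

lemma pair_weight_nonneg: "0 \<le> pair_weight u v"
  by (simp add: pair_weight_def)

lemma measurable_pair_weight[measurable]:
  assumes [measurable]: "h \<in> borel_measurable M" "k \<in> borel_measurable M"
  shows "(\<lambda>x. pair_weight (h x) (k x)) \<in> borel_measurable M"
  unfolding pair_weight_def by measurable

text \<open>
  By the inequality \<open>x y \<le> x\<^sup>2 + y\<^sup>2\<close>, applied to the products over the two pairs of opposite edges of the
  cycle; each of the squares yields an integral that factorises.
\<close>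

lemma nn_integral_paired_cycle_finite:
  "(\<integral>\<^sup>+q. ennreal \<bar>paired_cycle q\<bar> \<partial>lborel4) < \<infinity>"
proof -
  define G where "G = (\<integral>\<^sup>+u. \<integral>\<^sup>+v. ennreal (pair_weight u v) \<partial>lborel \<partial>lborel)"
  have G_eq: "G = (\<integral>\<^sup>+p. ennreal (pair_weight (fst p) (snd p)) \<partial>lborel2)"
    unfolding G_def by (subst lborel.nn_integral_fst[symmetric]) simp_all
  have "G < \<infinity>"
  proof -
    have "norm (pair_integrand H f p) = pair_weight (fst p) (snd p)" for p
      unfolding pair_weight_def r_square real_norm_def abs_mult by simp
    then show ?thesis
      using f_int unfolding G_eq integrable_iff_bounded by (simp only:)
  qed
  have le: "\<bar>paired_cycle q\<bar> \<le> pair_weight (fst (fst q)) (snd (fst q)) * pair_weight (fst (snd q)) (snd (snd q))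
      + pair_weight (fst (fst q)) (fst (snd q)) * pair_weight (snd (fst q)) (snd (snd q))" for q
  proof -
    obtain u v u' v' where q: "q = ((u, v), (u', v'))"
      by (metis surj_pair)
    have "\<bar>paired_cycle q\<bar> = \<bar>f u * f v * f u' * f v'\<bar> * \<bar>(r u v * r u' v') * (r u u' * r v v')\<bar>"
      by (simp add: q paired_cycle_def abs_mult mult_ac)
    also have "\<dots> \<le> \<bar>f u * f v * f u' * f v'\<bar> * ((r u v * r u' v')\<^sup>2 + (r u u' * r v v')\<^sup>2)"
      by (intro mult_left_mono abs_mult_le_sum_squares) simp
    also have "\<dots> = pair_weight u v * pair_weight u' v' + pair_weight u u' * pair_weight v v'"
      by (simp add: pair_weight_def abs_mult power_mult_distrib algebra_simps)
    finally show ?thesis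
      by (simp add: q)
  qed
  have "(\<integral>\<^sup>+q. ennreal \<bar>paired_cycle q\<bar> \<partial>lborel4) \<le>
    (\<integral>\<^sup>+q. ennreal (pair_weight (fst (fst q)) (snd (fst q))) * ennreal (pair_weight (fst (snd q)) (snd (snd q)))
      + ennreal (pair_weight (fst (fst q)) (fst (snd q))) * ennreal (pair_weight (snd (fst q)) (snd (snd q)))
      \<partial>lborel4)"
  proof (rule nn_integral_mono)
    fix q
    have "ennreal \<bar>paired_cycle q\<bar> \<le> ennreal (pair_weight (fst (fst q)) (snd (fst q)) * pair_weight (fst (snd q)) (snd (snd q))
      + pair_weight (fst (fst q)) (fst (snd q)) * pair_weight (snd (fst q)) (snd (snd q)))"
      by (rule ennreal_leI[OF le])
    also have "\<dots> = ennreal (pair_weight (fst (fst q)) (snd (fst q))) * ennreal (pair_weight (fst (snd q)) (snd (snd q)))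
      + ennreal (pair_weight (fst (fst q)) (fst (snd q))) * ennreal (pair_weight (snd (fst q)) (snd (snd q)))"
      using pair_weight_nonneg by (simp only: ennreal_plus ennreal_mult mult_nonneg_nonneg)
    finally show "ennreal \<bar>paired_cycle q\<bar> \<le> ennreal (pair_weight (fst (fst q)) (snd (fst q))) * ennreal (pair_weight (fst (snd q)) (snd (snd q)))
      + ennreal (pair_weight (fst (fst q)) (fst (snd q))) * ennreal (pair_weight (snd (fst q)) (snd (snd q)))" .
  qed
  also have "\<dots> = (\<integral>\<^sup>+q. ennreal (pair_weight (fst (fst q)) (snd (fst q))) * ennreal (pair_weight (fst (snd q)) (snd (snd q))) \<partial>lborel4)
      + (\<integral>\<^sup>+q. ennreal (pair_weight (fst (fst q)) (fst (snd q))) * ennreal (pair_weight (snd (fst q)) (snd (snd q))) \<partial>lborel4)"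
    by (rule nn_integral_add) measurable
  also have "(\<integral>\<^sup>+q. ennreal (pair_weight (fst (fst q)) (snd (fst q))) * ennreal (pair_weight (fst (snd q)) (snd (snd q))) \<partial>lborel4) = G * G"
  proof (subst sigma_finite_measure.nn_integral_fst[OF lborel_sigma_finite(2), symmetric])
    show "(\<integral>\<^sup>+p. \<integral>\<^sup>+p'. ennreal (pair_weight (fst (fst (p, p'))) (snd (fst (p, p')))) * ennreal (pair_weight (fst (snd (p, p'))) (snd (snd (p, p'))))
        \<partial>lborel2 \<partial>lborel2) = G * G"
      unfolding G_eq fst_conv snd_conv by (simp add: nn_integral_cmult nn_integral_multc)
  qed measurable
  also have "(\<integral>\<^sup>+q. ennreal (pair_weight (fst (fst q)) (fst (snd q))) * ennreal (pair_weight (snd (fst q)) (snd (snd q))) \<partial>lborel4) = G * G"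
  proof (subst sigma_finite_measure.nn_integral_fst[OF lborel_sigma_finite(2), symmetric])
    \<comment> \<open>Here the weights join the two pairs, yet the integral over (u', v') is a
      function of u times a function of v, so the integral over (u, v) factors as well.\<close>
    have inner: "(\<integral>\<^sup>+p'. ennreal (pair_weight (fst p) (fst p')) * ennreal (pair_weight (snd p) (snd p')) \<partial>lborel2) =
        (\<integral>\<^sup>+u'. ennreal (pair_weight (fst p) u') \<partial>lborel) * (\<integral>\<^sup>+v'. ennreal (pair_weight (snd p) v') \<partial>lborel)" for p :: "real \<times> real"
      by (subst lborel.nn_integral_fst[symmetric]) (simp_all add: nn_integral_cmult nn_integral_multc)
    show "(\<integral>\<^sup>+p. \<integral>\<^sup>+p'. ennreal (pair_weight (fst (fst (p, p'))) (fst (snd (p, p')))) * ennreal (pair_weight (snd (fst (p, p'))) (snd (snd (p, p'))))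
        \<partial>lborel2 \<partial>lborel2) = G * G"
      unfolding fst_conv snd_conv inner G_def
      by (subst lborel.nn_integral_fst[symmetric]) (simp_all add: nn_integral_cmult nn_integral_multc)
  qed measurable
  also have "G * G + G * G < \<infinity>"
    using \<open>G < \<infinity>\<close> by (simp add: ennreal_mult_less_top)
  finally show ?thesis .
qed

end

section \<open>The contraction of the kernel with itself\<close>

context rosenblatt_integrand
begin

text \<open>In the contraction of \<open>\<Phi>\<close> with itself at y, the contracted variable
  occurs only in a product of two kernels with integral b times \<open>r u v\<close>. What is left,
  up to the factor b, is this function of (u, v) and y.\<close>

definition \<psi> :: "(real \<times> real) \<times> (real \<times> real) \<Rightarrow> real" where
  "\<psi> q = (f (fst (fst q)) * f (snd (fst q)) * r (fst (fst q)) (snd (fst q))) *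
     (K (fst (fst q)) (fst (snd q)) * K (snd (fst q)) (snd (snd q)))"

definition \<Psi> :: "real \<times> real \<Rightarrow> real" where
  "\<Psi> y = (\<integral>p. \<psi> (p, y) \<partial>lborel2)"

lemma measurable_\<psi>[measurable]: "\<psi> \<in> borel_measurable lborel4"
  unfolding \<psi>_def by measurable

lemma measurable_\<Psi>[measurable]: "\<Psi> \<in> borel_measurable lborel2"
proof -
  interpret LL: pair_sigma_finite "lborel2" "lborel2"
    by (intro pair_sigma_finite.intro lborel_sigma_finite)
  show ?thesis
    unfolding \<Psi>_def by measurable
qed

lemma \<psi>_mult: "\<psi> (p, y) * \<psi> (p', y) =
    ((f (fst p) * f (snd p) * r (fst p) (snd p)) * (f (fst p') * f (snd p') * r (fst p') (snd p'))) *
    ((K (fst p) (fst y) * K (fst p') (fst y)) * (K (snd p) (snd y) * K (snd p') (snd y)))"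
  by (simp only: \<psi>_def fst_conv snd_conv mult_ac)

text \<open>The y-integral is again a product of two Beta integrals and supplies the edges uu' and
  vv', so up to b^2 the integral is that of the absolute four-cycle.\<close>

lemma \<psi>_bilinear_finite:
  "(\<integral>\<^sup>+q. \<integral>\<^sup>+y. ennreal \<bar>\<psi> (fst q, y) * \<psi> (snd q, y)\<bar> \<partial>lborel2
     \<partial>lborel4) < \<infinity>"
proof -
  have nn: "AE q in lborel4.
      (\<integral>\<^sup>+y. ennreal \<bar>\<psi> (fst q, y) * \<psi> (snd q, y)\<bar> \<partial>lborel2) = ennreal (b\<^sup>2) * ennreal \<bar>paired_cycle q\<bar>"
    using AE_pair_pair_off_diagonal
  proof eventually_elim
    case (elim q)
    define C where "C = (f (fst (fst q)) * f (snd (fst q)) * r (fst (fst q)) (snd (fst q))) *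
      (f (fst (snd q)) * f (snd (snd q)) * r (fst (snd q)) (snd (snd q)))"
    let ?k = "\<lambda>y. (K (fst (fst q)) (fst y) * K (fst (snd q)) (fst y)) * (K (snd (fst q)) (snd y) * K (snd (snd q)) (snd y))"
    have "\<bar>\<psi> (fst q, y) * \<psi> (snd q, y)\<bar> = \<bar>C\<bar> * ?k y" for y
      unfolding \<psi>_mult C_def[symmetric] abs_mult[of C] by simp
    then have "(\<integral>\<^sup>+y. ennreal \<bar>\<psi> (fst q, y) * \<psi> (snd q, y)\<bar> \<partial>lborel2) =
        (\<integral>\<^sup>+y. ennreal \<bar>C\<bar> * ennreal (?k y) \<partial>lborel2)"
      by (intro nn_integral_cong) (simp add: ennreal_mult)
    also have "\<dots> = ennreal \<bar>C\<bar> * ennreal (b\<^sup>2 * (r (fst (fst q)) (fst (snd q)) * r (snd (fst q)) (snd (snd q))))"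
      by (subst nn_integral_cmult) (simp_all add: nn_integral_kernel_products elim)
    also have "\<dots> = ennreal (\<bar>C\<bar> * (b\<^sup>2 * (r (fst (fst q)) (fst (snd q)) * r (snd (fst q)) (snd (snd q)))))"
      by (rule ennreal_mult[symmetric]) simp_all
    also have "\<bar>C\<bar> * (b\<^sup>2 * (r (fst (fst q)) (fst (snd q)) * r (snd (fst q)) (snd (snd q)))) = b\<^sup>2 * \<bar>paired_cycle q\<bar>"
    proof -
      have "\<bar>paired_cycle q\<bar> = \<bar>C\<bar> * (r (fst (fst q)) (fst (snd q)) * r (snd (fst q)) (snd (snd q)))"
        unfolding paired_cycle_def C_def[symmetric] abs_mult[of C] by simp
      then show ?thesis
        by (simp only: mult_ac)
    qed
    finally show ?case
      by (simp add: ennreal_mult)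
  qed
  have "(\<integral>\<^sup>+q. \<integral>\<^sup>+y. ennreal \<bar>\<psi> (fst q, y) * \<psi> (snd q, y)\<bar> \<partial>lborel2
     \<partial>lborel4) =
     (\<integral>\<^sup>+q. ennreal (b\<^sup>2) * ennreal \<bar>paired_cycle q\<bar> \<partial>lborel4)"
    by (rule nn_integral_cong_AE[OF nn])
  also have "\<dots> < \<infinity>"
    using nn_integral_paired_cycle_finite by (subst nn_integral_cmult) (simp_all add: ennreal_mult_less_top)
  finally show ?thesis .
qed

text \<open>Absolute convergence being known, the same evaluation is carried out with signs.\<close>

lemma \<Psi>_square_integral:
  "integrable lborel2 (\<lambda>y. (\<Psi> y)\<^sup>2)"
  "(\<integral>y. (\<Psi> y)\<^sup>2 \<partial>lborel2) = b\<^sup>2 * (\<integral>q. paired_cycle q \<partial>lborel4)"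
proof -
  note bil = Fubini_bilinear_integrable[OF lborel_sigma_finite(2) lborel_sigma_finite(2) lborel_sigma_finite(2)
      measurable_\<psi> measurable_\<psi> \<psi>_bilinear_finite, folded \<Psi>_def]
    Fubini_bilinear[OF lborel_sigma_finite(2) lborel_sigma_finite(2) lborel_sigma_finite(2)
      measurable_\<psi> measurable_\<psi> \<psi>_bilinear_finite, folded \<Psi>_def]
  show "integrable lborel2 (\<lambda>y. (\<Psi> y)\<^sup>2)"
    using bil(1) unfolding power2_eq_square .
  have "(\<integral>y. (\<Psi> y)\<^sup>2 \<partial>lborel2) = (\<integral>q. (\<integral>y. \<psi> (fst q, y) * \<psi> (snd q, y) \<partial>lborel2)
      \<partial>lborel4)"
    using bil(2) unfolding power2_eq_square .
  also have "\<dots> = (\<integral>q. b\<^sup>2 * paired_cycle q \<partial>lborel4)"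
  proof (rule integral_cong_AE)
    show "AE q in lborel4.
        (\<integral>y. \<psi> (fst q, y) * \<psi> (snd q, y) \<partial>lborel2) = b\<^sup>2 * paired_cycle q"
      using AE_pair_pair_off_diagonal
    proof eventually_elim
      case (elim q)
      then have ne: "fst (fst q) \<noteq> fst (snd q)" "snd (fst q) \<noteq> snd (snd q)" by blast+
      show ?case
        unfolding \<psi>_mult integral_mult_right_zero integral_kernel_products[OF ne] paired_cycle_def
        by (simp only: mult_ac)
    qed
    show "(\<lambda>q. \<integral>y. \<psi> (fst q, y) * \<psi> (snd q, y) \<partial>lborel2)
        \<in> borel_measurable lborel4"
      by (rule sigma_finite_measure.borel_measurable_lebesgue_integral[OF lborel_sigma_finite(2)]) measurable
  qed measurable
  also have "\<dots> = b\<^sup>2 * (\<integral>q. paired_cycle q \<partial>lborel4)"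
    by (rule integral_mult_right_zero)
  finally show "(\<integral>y. (\<Psi> y)\<^sup>2 \<partial>lborel2) = b\<^sup>2 * (\<integral>q. paired_cycle q \<partial>lborel4)" .
qed

text \<open>Exchanging the contracted variable with u and v requires absolute integrability of
  \<open>\<psi>\<close> at the given y. Finiteness of the squared expression provides this for
  almost every y, hence the identity only almost everywhere.\<close>

lemma contract_\<Phi>: "AE y in lborel2. contract \<Phi> \<Phi> y = b * \<Psi> y"
  using AE_finite_of_bilinear[OF lborel_sigma_finite(2) lborel_sigma_finite(2) measurable_\<psi> \<psi>_bilinear_finite]
proof eventually_elim
  case (elim y)
  \<comment> \<open>The two kernels of the contraction at y, with the contracted variable in the
    second coordinate of x in both: \<open>\<phi>\<close> carries the first coordinate of y,
    \<open>\<eta>\<close> the second.\<close>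
  define \<phi> where "\<phi> = (\<lambda>x :: real \<times> real. f (fst x) * K (fst x) (fst y) * K (fst x) (snd x))"
  define \<eta> where "\<eta> = (\<lambda>x :: real \<times> real. f (fst x) * K (fst x) (snd x) * K (fst x) (snd y))"
  have m: "\<phi> \<in> borel_measurable lborel2" "\<eta> \<in> borel_measurable lborel2"
    unfolding \<phi>_def \<eta>_def by measurable
  define C where "C = (\<lambda>p. f (fst p) * f (snd p) * (K (fst p) (fst y) * K (snd p) (snd y)))"
  have \<phi>\<eta>: "\<phi> (u, z) * \<eta> (v, z) = C (u, v) * (K u z * K v z)" for u v z
    by (simp only: \<phi>_def \<eta>_def C_def fst_conv snd_conv mult_ac)
  have [measurable]: "(\<lambda>p. \<psi> (p, y)) \<in> borel_measurable lborel2"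
    unfolding \<psi>_def fst_conv snd_conv by measurable
  have C\<psi>: "C p * r (fst p) (snd p) = \<psi> (p, y)" for p
    by (simp only: C_def \<psi>_def fst_conv snd_conv mult_ac)
  have fin: "(\<integral>\<^sup>+p. \<integral>\<^sup>+z. ennreal \<bar>\<phi> (fst p, z) * \<eta> (snd p, z)\<bar> \<partial>lborel \<partial>lborel2) < \<infinity>"
  proof -
    have "AE p in lborel2. (\<integral>\<^sup>+z. ennreal \<bar>\<phi> (fst p, z) * \<eta> (snd p, z)\<bar> \<partial>lborel) = ennreal b * ennreal \<bar>\<psi> (p, y)\<bar>"
      using AE_pair_off_diagonal
    proof eventually_elim
      case (elim p)
      have "(\<integral>\<^sup>+z. ennreal \<bar>\<phi> (fst p, z) * \<eta> (snd p, z)\<bar> \<partial>lborel) =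
          (\<integral>\<^sup>+z. ennreal \<bar>C p\<bar> * ennreal (K (fst p) z * K (snd p) z) \<partial>lborel)"
        unfolding \<phi>\<eta> abs_mult[of "C _"] by (intro nn_integral_cong) (simp add: ennreal_mult)
      also have "\<dots> = ennreal \<bar>C p\<bar> * ennreal (b * r (fst p) (snd p))"
        by (subst nn_integral_cmult) (simp_all add: nn_integral_kernel_product[OF elim])
      also have "\<dots> = ennreal (\<bar>C p\<bar> * (b * r (fst p) (snd p)))"
        by (rule ennreal_mult[symmetric]) (use b_pos in simp_all)
      also have "\<bar>C p\<bar> * (b * r (fst p) (snd p)) = b * \<bar>\<psi> (p, y)\<bar>"
        unfolding C\<psi>[symmetric] abs_mult[of "C p"] by simp
      also have "ennreal \<dots> = ennreal b * ennreal \<bar>\<psi> (p, y)\<bar>"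
        by (rule ennreal_mult) (use b_pos in simp_all)
      finally show ?case .
    qed
    then have "(\<integral>\<^sup>+p. \<integral>\<^sup>+z. ennreal \<bar>\<phi> (fst p, z) * \<eta> (snd p, z)\<bar> \<partial>lborel \<partial>lborel2) =
        (\<integral>\<^sup>+p. ennreal b * ennreal \<bar>\<psi> (p, y)\<bar> \<partial>lborel2)"
      by (rule nn_integral_cong_AE)
    also have "\<dots> < \<infinity>"
      using elim by (subst nn_integral_cmult) (simp_all add: ennreal_mult_less_top)
    finally show ?thesis .
  qed
  have "contract \<Phi> \<Phi> y = (\<integral>z. (\<integral>u. \<phi> (u, z) \<partial>lborel) * (\<integral>v. \<eta> (v, z) \<partial>lborel) \<partial>lborel)"
    by (simp add: contract_def \<Phi>_def \<phi>_def \<eta>_def case_prod_beta)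
  also have "\<dots> = (\<integral>p. (\<integral>z. \<phi> (fst p, z) * \<eta> (snd p, z) \<partial>lborel) \<partial>lborel2)"
    by (rule Fubini_bilinear[OF lborel_sigma_finite(1) lborel_sigma_finite(1) lborel_sigma_finite(1) m fin])
  also have "\<dots> = (\<integral>p. b * \<psi> (p, y) \<partial>lborel2)"
  proof (rule integral_cong_AE)
    show "AE p in lborel2. (\<integral>z. \<phi> (fst p, z) * \<eta> (snd p, z) \<partial>lborel) = b * \<psi> (p, y)"
      using AE_pair_off_diagonal
    proof eventually_elim
      case (elim p)
      show ?case
        unfolding \<phi>\<eta> integral_mult_right_zero C\<psi>[symmetric] integral_kernel_product[OF elim]
        by (simp only: prod.collapse mult_ac)
    qed
    show "(\<lambda>p. \<integral>z. \<phi> (fst p, z) * \<eta> (snd p, z) \<partial>lborel) \<in> borel_measurable lborel2"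
      unfolding \<phi>_def \<eta>_def by measurable
  qed measurable
  also have "\<dots> = b * \<Psi> y"
    unfolding \<Psi>_def by (rule integral_mult_right_zero)
  finally show ?case .
qed

section \<open>Norms of the normalised kernel and of its contraction\<close>

lemma measurable_lborel_pair_iff: "g \<in> borel_measurable lborel2 \<longleftrightarrow> g \<in> borel_measurable (borel :: (real \<times> real) measure)"
  by (simp add: lborel_prod)

text \<open>The normalisation cancels the Beta values produced by the kernel integrals. The
  remaining 1/2 compensates the factor 2 in the second moment of the double integral.\<close>

lemma rosenblatt_const_square: "(rosenblatt_const H)\<^sup>2 * b\<^sup>2 = H * (2 * H - 1) / 2"
proof -
  have "0 \<le> H * (2 * H - 1) / (2 * b\<^sup>2)"
    using H by simp
  then have "(rosenblatt_const H)\<^sup>2 = H * (2 * H - 1) / (2 * b\<^sup>2)"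
    unfolding rosenblatt_const_def b_def[symmetric] by (rule real_sqrt_pow2)
  then show ?thesis
    using b_pos by simp
qed

lemma rosenblatt_kernel_eq: "rosenblatt_kernel H f = (\<lambda>y. rosenblatt_const H * \<Phi> y)"
proof (rule ext)
  fix y :: "real \<times> real"
  have "(\<integral>u. f u * K u (fst y) * K u (snd y) \<partial>lebesgue) = \<Phi> y"
    unfolding \<Phi>_def by (rule integral_completion) measurable
  then show "rosenblatt_kernel H f y = rosenblatt_const H * \<Phi> y"
    by (simp add: rosenblatt_kernel_def K_def case_prod_beta)
qed

lemma borel_measurable_rosenblatt_kernel: "rosenblatt_kernel H f \<in> borel_measurable borel"
  using measurable_\<Phi> unfolding rosenblatt_kernel_eq measurable_lborel_pair_iff by measurable

lemma l2sq_rosenblatt_kernel: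
  "l2sq (rosenblatt_kernel H f) =
    ennreal (H * (2 * H - 1) / 2 * (\<integral>p. pair_integrand H f p \<partial>lborel2))"
proof -
  have "l2sq (rosenblatt_kernel H f) = (\<integral>\<^sup>+y. ennreal ((rosenblatt_const H)\<^sup>2 * (\<Phi> y)\<^sup>2) \<partial>lborel2)"
    unfolding l2sq_def rosenblatt_kernel_eq power_mult_distrib lborel_prod ..
  also have "\<dots> = ennreal (\<integral>y. (rosenblatt_const H)\<^sup>2 * (\<Phi> y)\<^sup>2 \<partial>lborel2)"
    using \<Phi>_square_integral(1) by (intro nn_integral_eq_integral) auto
  also have "(\<integral>y. (rosenblatt_const H)\<^sup>2 * (\<Phi> y)\<^sup>2 \<partial>lborel2) = ((rosenblatt_const H)\<^sup>2 * b\<^sup>2) *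
      (\<integral>p. pair_integrand H f p \<partial>lborel2)"
    by (simp only: integral_mult_right_zero \<Phi>_square_integral(2) mult.assoc)
  finally show ?thesis
    unfolding rosenblatt_const_square .
qed

text \<open>Powers of the constants: the contraction of the normalised kernel is c^2 b times
  \<open>\<Psi>\<close>, and the squared norm of \<open>\<Psi>\<close> brings b^2, in total (c^2
  b)^2 b^2 = (c^2 b^2)^2.\<close>

lemma l2sq_contract_rosenblatt_kernel:
  "l2sq (contract (rosenblatt_kernel H f) (rosenblatt_kernel H f)) =
    ennreal ((H * (2 * H - 1) / 2)\<^sup>2 * (\<integral>q. paired_cycle q \<partial>lborel4))"
proof -
  let ?c = "rosenblatt_const H"
  have "contract (rosenblatt_kernel H f) (rosenblatt_kernel H f) y = (\<integral>z. ?c\<^sup>2 * (\<Phi> (fst y, z) * \<Phi> (z, snd y)) \<partial>lborel)" for y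
    unfolding contract_def rosenblatt_kernel_eq case_prod_beta power2_eq_square by (simp only: mult_ac)
  then have con: "contract (rosenblatt_kernel H f) (rosenblatt_kernel H f) y = ?c\<^sup>2 * contract \<Phi> \<Phi> y" for y
    by (simp add: contract_def case_prod_beta)
  have "l2sq (contract (rosenblatt_kernel H f) (rosenblatt_kernel H f)) =
      (\<integral>\<^sup>+y. ennreal ((?c\<^sup>2 * contract \<Phi> \<Phi> y)\<^sup>2) \<partial>lborel2)"
    unfolding l2sq_def con lborel_prod ..
  also have "\<dots> = (\<integral>\<^sup>+y. ennreal ((?c\<^sup>2 * b)\<^sup>2 * (\<Psi> y)\<^sup>2) \<partial>lborel2)"
    by (rule nn_integral_cong_AE) (use contract_\<Phi> in eventually_elim, simp add: power_mult_distrib)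
  also have "\<dots> = ennreal (\<integral>y. (?c\<^sup>2 * b)\<^sup>2 * (\<Psi> y)\<^sup>2 \<partial>lborel2)"
    using \<Psi>_square_integral(1) by (intro nn_integral_eq_integral) auto
  also have "(\<integral>y. (?c\<^sup>2 * b)\<^sup>2 * (\<Psi> y)\<^sup>2 \<partial>lborel2) =
      (?c\<^sup>2 * b\<^sup>2)\<^sup>2 * (\<integral>q. paired_cycle q \<partial>lborel4)"
    by (simp only: integral_mult_right_zero \<Psi>_square_integral(2)) (simp add: power2_eq_square)
  finally show ?thesis
    unfolding rosenblatt_const_square .
qed

end

text \<open>The vertices \<open>u1, u2, u3, u4\<close> of the cycle in the hypothesis are \<open>u, v, v', u'\<close> for \<open>q = ((u, v), (u', v'))\<close>.\<close>

lemma distr_cycle_order: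
  "distr lborel4 borel
     (\<lambda>q. (fst (fst q), snd (fst q), snd (snd q), fst (snd q))) =
   (lborel :: (real \<times> real \<times> real \<times> real) measure)" (is "distr ?M borel ?T = _")
proof (rule measure_eqI)
  have T[measurable]: "?T \<in> ?M \<rightarrow>\<^sub>M borel"
    unfolding borel_prod[symmetric] by measurable
  fix A assume "A \<in> sets (distr ?M borel ?T)"
  then have A: "A \<in> sets borel"
    by simp
  define G :: "real \<times> real \<times> real \<times> real \<Rightarrow> ennreal" where "G = indicator A"
  have G[measurable]: "G \<in> borel_measurable (lborel \<Otimes>\<^sub>M (lborel \<Otimes>\<^sub>M lborel2))"
    unfolding G_def lborel_prod using A by simp
  have "emeasure (distr ?M borel ?T) A = (\<integral>\<^sup>+x. G x \<partial>distr ?M borel ?T)"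
    unfolding G_def using A by simp
  also have "\<dots> = (\<integral>\<^sup>+q. G (?T q) \<partial>?M)"
    by (rule nn_integral_distr) (use A in \<open>auto simp: G_def\<close>)
  also have "\<dots> = (\<integral>\<^sup>+p. \<integral>\<^sup>+p'. G (fst p, snd p, snd p', fst p') \<partial>lborel2 \<partial>lborel2)"
    by (subst sigma_finite_measure.nn_integral_fst[OF lborel_sigma_finite(2), symmetric]) simp_all
  also have "\<dots> = (\<integral>\<^sup>+p. \<integral>\<^sup>+u'. \<integral>\<^sup>+v'. G (fst p, snd p, v', u') \<partial>lborel \<partial>lborel \<partial>lborel2)"
    by (subst lborel.nn_integral_fst[symmetric]) simp_all
  \<comment> \<open>The one genuine exchange of variables; the other steps only regroup
    pairs.\<close>
  also have "\<dots> = (\<integral>\<^sup>+p. \<integral>\<^sup>+v'. \<integral>\<^sup>+u'. G (fst p, snd p, v', u') \<partial>lborel \<partial>lborel \<partial>lborel2)"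
    by (intro nn_integral_cong lborel_pair.Fubini') measurable
  also have "\<dots> = (\<integral>\<^sup>+u. \<integral>\<^sup>+v. \<integral>\<^sup>+v'. \<integral>\<^sup>+u'. G (u, v, v', u') \<partial>lborel \<partial>lborel \<partial>lborel \<partial>lborel)"
    by (subst lborel.nn_integral_fst[symmetric]) simp_all
  also have "\<dots> = (\<integral>\<^sup>+u. \<integral>\<^sup>+v. \<integral>\<^sup>+w. G (u, v, w) \<partial>lborel2 \<partial>lborel \<partial>lborel)"
    by (intro nn_integral_cong lborel.nn_integral_fst) measurable
  also have "\<dots> = (\<integral>\<^sup>+u. \<integral>\<^sup>+w. G (u, w) \<partial>(lborel \<Otimes>\<^sub>M lborel2) \<partial>lborel)"
    by (intro nn_integral_cong sigma_finite_measure.nn_integral_fst[OF lborel_sigma_finite(2)]) measurable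
  also have "\<dots> = (\<integral>\<^sup>+x. G x \<partial>(lborel \<Otimes>\<^sub>M (lborel \<Otimes>\<^sub>M lborel2)))"
    by (rule sigma_finite_measure.nn_integral_fst[OF _ G]) (simp add: lborel_prod lborel.sigma_finite_measure_axioms)
  also have "\<dots> = emeasure lborel A"
    unfolding G_def lborel_prod using A by simp
  finally show "emeasure (distr ?M borel ?T) A = emeasure lborel A" .
qed simp

context rosenblatt_integrand
begin

lemma measurable_four_cycle[measurable]: "four_cycle H f \<in> borel_measurable borel"
  unfolding four_cycle_def borel_prod[symmetric] by measurable

lemma integral_paired_cycle: "(\<integral>q. paired_cycle q \<partial>lborel4) = (\<integral>x. four_cycle H f x \<partial>lborel)"
proof -
  let ?T = "\<lambda>q :: (real \<times> real) \<times> (real \<times> real). (fst (fst q), snd (fst q), snd (snd q), fst (snd q))"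
  have T: "?T \<in> lborel4 \<rightarrow>\<^sub>M borel"
    unfolding borel_prod[symmetric] by measurable
  have "(\<integral>x. four_cycle H f x \<partial>lborel) = (\<integral>q. four_cycle H f (?T q) \<partial>lborel4)"
    unfolding distr_cycle_order[symmetric] by (rule integral_distr[OF T]) simp
  moreover have "four_cycle H f (?T q) = paired_cycle q" for q
    unfolding four_cycle_def paired_cycle_def r_def prod.case abs_minus_commute[of "snd (snd q)" "fst (snd q)"]
      abs_minus_commute[of "fst (snd q)" "fst (fst q)"]
    by (simp only: mult_ac)
  ultimately show ?thesis
    by (simp only:)
qed

text \<open>To leave the extended reals the cycle integral must be nonnegative, although its
  integrand may change sign; this is read off from its being a positive multiple of the integral of
  \<open>\<Psi>\<close> squared.\<close>

lemma enn2real_l2sq_contract_rosenblatt_kernel: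
  "enn2real (l2sq (contract (rosenblatt_kernel H f) (rosenblatt_kernel H f))) =
    (H / 2)\<^sup>2 * ((2 * H - 1)\<^sup>2 * (\<integral>x. four_cycle H f x \<partial>lborel))"
proof -
  have "0 \<le> (\<integral>y. (\<Psi> y)\<^sup>2 \<partial>lborel2)"
    by simp
  then have "0 \<le> (\<integral>x. four_cycle H f x \<partial>lborel)"
    unfolding \<Psi>_square_integral(2) integral_paired_cycle using b_pos by (simp add: zero_le_mult_iff)
  then have "enn2real (l2sq (contract (rosenblatt_kernel H f) (rosenblatt_kernel H f))) =
      (H * (2 * H - 1) / 2)\<^sup>2 * (\<integral>x. four_cycle H f x \<partial>lborel)"
    unfolding l2sq_contract_rosenblatt_kernel integral_paired_cycle by simp
  then show ?thesis
    by (simp add: power_mult_distrib power_divide)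
qed

lemma enn2real_l2sq_rosenblatt_kernel:
  shows "enn2real (l2sq (rosenblatt_kernel H f)) =
    H * (2 * H - 1) / 2 * (\<integral>p. pair_integrand H f p \<partial>lborel2)"
    and "0 \<le> (\<integral>p. pair_integrand H f p \<partial>lborel2)"
proof -
  have "0 \<le> (\<integral>y. (\<Phi> y)\<^sup>2 \<partial>lborel2)"
    by simp
  then show *: "0 \<le> (\<integral>p. pair_integrand H f p \<partial>lborel2)"
    unfolding \<Phi>_square_integral(2) using b_pos by (simp add: zero_le_mult_iff)
  show "enn2real (l2sq (rosenblatt_kernel H f)) =
    H * (2 * H - 1) / 2 * (\<integral>p. pair_integrand H f p \<partial>lborel2)"
    unfolding l2sq_rosenblatt_kernel using * H by (intro enn2real_ennreal mult_nonneg_nonneg) auto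
qed

end

section \<open>Convergence to the normal law\<close>

text \<open>Completeness of Lebesgue measure makes F measurable as an almost everywhere modification
  of G.\<close>

lemma integral_lebesgue_cong_AE:
  fixes F G :: "'a::euclidean_space \<Rightarrow> real"
  assumes G: "G \<in> borel_measurable borel" and ae: "AE x in lborel. F x = G x"
  shows "(\<integral>x. F x \<partial>lebesgue) = (\<integral>x. G x \<partial>lborel)"
    and "integrable lebesgue F \<longleftrightarrow> integrable lborel G"
proof -
  have GL: "G \<in> borel_measurable lebesgue"
    using G by (auto intro: measurable_completion)
  have ae': "AE x in lebesgue. F x = G x"
    using ae by (rule AE_completion)
  have FL: "F \<in> borel_measurable lebesgue"
    by (rule borel_measurable_AE[OF GL]) (use ae' in eventually_elim, simp)
  show "(\<integral>x. F x \<partial>lebesgue) = (\<integral>x. G x \<partial>lborel)"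
    using integral_cong_AE[OF FL GL ae'] integral_completion[of G lborel] G by simp
  show "integrable lebesgue F \<longleftrightarrow> integrable lborel G"
    using integrable_cong_AE[OF FL GL ae'] integrable_completion[of G lborel] G by simp
qed

text \<open>Every quantity in question is an integral and so depends on f only up to null sets. In
  particular the kernels agree at every point y, because each value is an integral over u; the
  double Wiener integral of f is thus literally that of g.\<close>

lemma rosenblatt_borel_representative:
  fixes f g :: "real \<Rightarrow> real"
  assumes g[measurable]: "g \<in> borel_measurable borel" and ae: "AE x in lborel. f x = g x"
  shows "rosenblatt_kernel H f = rosenblatt_kernel H g"
    and "(\<integral>(u, v). f u * f v * \<bar>u - v\<bar> powr (2 * H - 2) \<partial>lebesgue) =
      (\<integral>p. pair_integrand H g p \<partial>lborel2)"
    and "1 / 2 < H \<Longrightarrow> H < 1 \<Longrightarrow> f \<in> rosenblatt_space H \<Longrightarrow> rosenblatt_integrand H g"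
    and "(\<integral>x. four_cycle H f x \<partial>lebesgue) =
      (\<integral>x. four_cycle H g x \<partial>lborel)"
proof -
  show "rosenblatt_kernel H f = rosenblatt_kernel H g"
  proof (rule ext)
    fix y :: "real \<times> real"
    define k where "k u = (max (u - fst y) 0) powr (H / 2 - 1) * (max (u - snd y) 0) powr (H / 2 - 1)" for u
    have "(\<lambda>u. g u * k u) \<in> borel_measurable borel"
      unfolding k_def by measurable
    moreover have "AE u in lborel. h u * k u = g u * k u" if "AE x in lborel. h x = g x" for h
      using that by eventually_elim simp
    ultimately have "(\<integral>u. h u * k u \<partial>lebesgue) = (\<integral>u. g u * k u \<partial>lborel)" if "AE x in lborel. h x = g x" for h
      using that by (intro integral_lebesgue_cong_AE(1)) auto
    \<comment> \<open>The instance for g itself moves its integral from Lebesgue measure to Borel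
      Lebesgue measure, so that both sides meet there.\<close>
    from this[OF ae] this[of g] show "rosenblatt_kernel H f y = rosenblatt_kernel H g y"
      by (simp add: rosenblatt_kernel_def k_def case_prod_beta mult.assoc)
  qed
  have ae2: "AE p in (lborel :: (real \<times> real) measure). f (fst p) = g (fst p) \<and> f (snd p) = g (snd p)"
    using AE_lborel_fst[OF ae] AE_lborel_snd[OF ae] by eventually_elim blast
  define F2 where "F2 = (\<lambda>p. pair_integrand H g p)"
  have "F2 \<in> borel_measurable lborel2"
    unfolding F2_def by measurable
  then have F2: "F2 \<in> borel_measurable borel"
    by (simp add: lborel_prod)
  have ae_F2: "AE p in lborel. (case p of (u, v) \<Rightarrow> f u * f v * \<bar>u - v\<bar> powr (2 * H - 2)) = F2 p"
    using ae2 by eventually_elim (simp add: F2_def case_prod_beta)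
  show "(\<integral>(u, v). f u * f v * \<bar>u - v\<bar> powr (2 * H - 2) \<partial>lebesgue) =
      (\<integral>p. pair_integrand H g p \<partial>lborel2)"
    using integral_lebesgue_cong_AE(1)[OF F2 ae_F2] unfolding F2_def lborel_prod .
  show "rosenblatt_integrand H g" if "1 / 2 < H" "H < 1" "f \<in> rosenblatt_space H"
  proof
    show "integrable lborel2 (\<lambda>p. pair_integrand H g p)"
      using integral_lebesgue_cong_AE(2)[OF F2 ae_F2] that(3) unfolding F2_def lborel_prod rosenblatt_space_def by simp
  qed (use that in auto)
  have F4: "four_cycle H g \<in> borel_measurable borel"
    unfolding four_cycle_def borel_prod[symmetric] by measurable
  have "AE x in (lborel :: (real \<times> real \<times> real) measure). f (fst x) = g (fst x) \<and> f (fst (snd x)) = g (fst (snd x)) \<and> f (snd (snd x)) = g (snd (snd x))"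
    using AE_lborel_fst[OF ae] AE_lborel_snd[OF ae2] by eventually_elim blast
  then have "AE x in (lborel :: (real \<times> real \<times> real \<times> real) measure). f (fst x) = g (fst x) \<and> f (fst (snd x)) = g (fst (snd x))
      \<and> f (fst (snd (snd x))) = g (fst (snd (snd x))) \<and> f (snd (snd (snd x))) = g (snd (snd (snd x)))"
    by (rule AE_mp[OF AE_lborel_snd AE_mp[OF AE_lborel_fst[OF ae]]]) auto
  then have "AE x in lborel. four_cycle H f x = four_cycle H g x"
    by eventually_elim (simp add: four_cycle_def case_prod_beta)
  then show "(\<integral>x. four_cycle H f x \<partial>lebesgue) = (\<integral>x. four_cycle H g x \<partial>lborel)"
    by (rule integral_lebesgue_cong_AE(1)[OF F4])
qed

lemma real_distribution_normal_law: "0 \<le> s \<Longrightarrow> real_distribution (normal_law 0 s)"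
proof (cases "s = 0")
  case True
  then show ?thesis
    by (auto simp: normal_law_def real_distribution_def real_distribution_axioms_def intro: prob_space_return)
next
  case False
  assume "0 \<le> s"
  with False show ?thesis
    by (auto simp: normal_law_def real_distribution_def real_distribution_axioms_def intro: prob_space_normal_density)
qed

lemma char_normal_law:
  assumes "0 \<le> s"
  shows "char (normal_law 0 s) t = exp (- (s * t\<^sup>2 / 2))"
proof (cases "s = 0")
  case True
  then show ?thesis
    by (simp add: normal_law_def char_def integral_return)
next
  case False
  with assms have "s > 0" by simp
  let ?N = "density lborel (normal_density 0 (sqrt s))"
  interpret N: prob_space ?N
    by (rule prob_space_normal_density) (use \<open>s > 0\<close> in simp)
  have "distributed ?N lborel (\<lambda>x. x) (normal_density 0 (sqrt s))"
    unfolding distributed_def by (auto simp: distr_id2)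
  from N.expectation_iexp_normal[OF this \<open>s > 0\<close>] show ?thesis
    using \<open>s > 0\<close> by (simp add: normal_law_def char_def)
qed

theorem proposition3:
  fixes M :: "'a measure" and B :: "real \<Rightarrow> 'a \<Rightarrow> real"
    and f :: "real \<Rightarrow> real" and \<sigma>sq :: real
  assumes "wiener_process M B"
    and "\<forall>H\<in>{1/2<..<1}. f \<in> rosenblatt_space H"
    and "((\<lambda>H. rosenblatt_sqnorm H f) \<longlongrightarrow> \<sigma>sq) (at_right (1/2))"
    and "((\<lambda>H. (2 * H - 1)\<^sup>2 *
            (\<integral>(u1, u2, u3, u4). f u1 * f u2 * f u3 * f u4 *
                \<bar>u1 - u2\<bar> powr (H - 1) * \<bar>u2 - u3\<bar> powr (H - 1) *
                \<bar>u3 - u4\<bar> powr (H - 1) * \<bar>u4 - u1\<bar> powr (H - 1) \<partial>lebesgue))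
          \<longlongrightarrow> 0) (at_right (1/2))"
  shows "weak_conv_along (at_right (1/2))
           (\<lambda>H. distr M borel (wiener_rosenblatt_integral M B H f)) (normal_law 0 \<sigma>sq)"
proof -
  interpret wiener_process M B by fact
  define I4 where "I4 H = (\<integral>x. four_cycle H f x \<partial>lebesgue)" for H
  \<comment> \<open>Membership at one index, here 3/4, already gives measurability of f; the
    representative g obtained from it serves all H at once.\<close>
  have "f \<in> rosenblatt_space (3 / 4)"
    using assms(2) by simp
  then have "f \<in> borel_measurable (completion lborel)"
    by (simp add: rosenblatt_space_def)
  from completion_ex_borel_measurable_real[OF this]
  obtain g where g: "g \<in> borel_measurable borel" and ae: "AE x in lborel. f x = g x"
    by auto
  note rep = rosenblatt_borel_representative[OF g ae]
  let ?X = "\<lambda>H. wiener_rosenblatt_integral M B H f"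
  have sqnorm_nonneg: "0 \<le> rosenblatt_sqnorm H f"
    and X_meas: "?X H \<in> borel_measurable M"
    and X_char: "cmod (expectation (\<lambda>\<omega>. iexp (t * ?X H \<omega>)) - exp (- (rosenblatt_sqnorm H f / 2 * t\<^sup>2)))
      \<le> 4 * t\<^sup>2 * sqrt (3 * ((H / 2)\<^sup>2 * ((2 * H - 1)\<^sup>2 * I4 H)))"
    if H: "H \<in> {1/2<..<1}" for H t
  proof -
    interpret rosenblatt_integrand H g
      by (rule rep(3)) (use H assms(2) in auto)
    \<comment> \<open>With half the squared norm as exponent coefficient, the comparison is with the
      normal law whose variance is the full squared norm.\<close>
    have l2: "enn2real (l2sq (rosenblatt_kernel H f)) = rosenblatt_sqnorm H f / 2"
      unfolding rep(1) enn2real_l2sq_rosenblatt_kernel rosenblatt_sqnorm_def rep(2) by simp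
    have con: "enn2real (l2sq (contract (rosenblatt_kernel H f) (rosenblatt_kernel H f))) = (H / 2)\<^sup>2 * ((2 * H - 1)\<^sup>2 * I4 H)"
      unfolding rep(1) enn2real_l2sq_contract_rosenblatt_kernel I4_def rep(4) ..
    show "0 \<le> rosenblatt_sqnorm H f"
      using l2 enn2real_nonneg[of "l2sq (rosenblatt_kernel H f)"] by linarith
    have meas: "rosenblatt_kernel H f \<in> borel_measurable borel"
      unfolding rep(1) by (rule borel_measurable_rosenblatt_kernel)
    have fin: "l2sq (rosenblatt_kernel H f) < \<infinity>"
      unfolding rep(1) l2sq_rosenblatt_kernel by simp
    have sym: "rosenblatt_kernel H f (x, y) = rosenblatt_kernel H f (y, x)" for x y
      unfolding rep(1) rosenblatt_kernel_eq \<Phi>_sym[of x y] ..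
    \<comment> \<open>Existence makes the chosen version satisfy its specification, and the bound on
      characteristic functions holds for every version.\<close>
    have "is_wiener_ito2 M B (rosenblatt_kernel H f) (?X H)"
      unfolding wiener_rosenblatt_integral_def wiener_ito2_def
      by (rule someI_ex[OF wiener_ito2_exists[OF meas fin[unfolded l2sq_def]]])
    then show "?X H \<in> borel_measurable M"
      and "cmod (expectation (\<lambda>\<omega>. iexp (t * ?X H \<omega>)) - exp (- (rosenblatt_sqnorm H f / 2 * t\<^sup>2)))
        \<le> 4 * t\<^sup>2 * sqrt (3 * ((H / 2)\<^sup>2 * ((2 * H - 1)\<^sup>2 * I4 H)))"
      using wiener_ito2_char_bound[OF meas sym fin, of "?X H" t] unfolding l2 con
      by (auto simp: is_wiener_ito2_def)
  qed
  have near: "\<forall>\<^sub>F H in at_right (1/2 :: real). H \<in> {1/2<..<1}"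
    by (rule eventually_at_right_real) simp
  \<comment> \<open>A limit of squared norms; \<open>normal_law\<close> is a probability law with
    the expected characteristic function only for a nonnegative variance.\<close>
  have "\<sigma>sq \<ge> 0"
    by (rule tendsto_lowerbound[OF assms(3)])
      (use near sqnorm_nonneg in \<open>auto elim!: eventually_mono simp: trivial_limit_at_right_real\<close>)
  \<comment> \<open>Levy's theorem is about sequences. Near 1/2 the filter may be confined to ]1/2,
    1[, so that all terms of a test sequence, not merely its tail, lie where the estimates
    hold.\<close>
  have filter: "at_right (1/2 :: real) = at (1/2) within {1/2<..<1}"
    by (rule at_within_nhd[of _ "{0<..<1}"]) auto
  show ?thesis
    unfolding weak_conv_along_def filter tendsto_at_iff_sequentially comp_def
  proof (intro allI impI)
    fix x S
    assume x: "isCont (cdf (normal_law 0 \<sigma>sq)) x"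
      and S: "\<forall>i. S i \<in> {1/2<..<1} - {1/2 :: real}" and S_lim: "S \<longlonglongrightarrow> 1/2"
    have S': "S i \<in> {1/2<..<1}" for i
      using S by blast
    have S_filter: "filterlim S (at_right (1/2)) sequentially"
    proof -
      have "S i \<in> {1/2<..}" "S i \<noteq> 1/2" for i
        using S'[of i] by simp_all
      then show ?thesis
        using S_lim unfolding filterlim_at by (intro conjI always_eventually allI)
    qed
    have "weak_conv_m (\<lambda>i. distr M borel (?X (S i))) (normal_law 0 \<sigma>sq)"
    proof (rule levy_continuity)
      show "real_distribution (distr M borel (?X (S i)))" for i
        by (rule real_distribution_distr) (rule X_meas[OF S'])
      show "real_distribution (normal_law 0 \<sigma>sq)"
        by (rule real_distribution_normal_law) fact
      fix t
      have char_eq: "char (distr M borel (?X (S i))) t = expectation (\<lambda>\<omega>. iexp (t * ?X (S i) \<omega>))" for i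
        unfolding char_def by (rule integral_distr[OF X_meas[OF S']]) simp
      have "(\<lambda>i. rosenblatt_sqnorm (S i) f) \<longlonglongrightarrow> \<sigma>sq"
        by (rule filterlim_compose[OF assms(3) S_filter])
      then have exp_lim: "(\<lambda>i. complex_of_real (exp (- (rosenblatt_sqnorm (S i) f / 2 * t\<^sup>2)))) \<longlonglongrightarrow>
          complex_of_real (exp (- (\<sigma>sq / 2 * t\<^sup>2)))"
        by (intro tendsto_intros) simp_all
      have "(\<lambda>i. (2 * S i - 1)\<^sup>2 * I4 (S i)) \<longlonglongrightarrow> 0"
        unfolding I4_def four_cycle_def by (rule filterlim_compose[OF assms(4) S_filter])
      then have "(\<lambda>i. 4 * t\<^sup>2 * sqrt (3 * ((S i / 2)\<^sup>2 * ((2 * S i - 1)\<^sup>2 * I4 (S i))))) \<longlonglongrightarrow>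
          4 * t\<^sup>2 * sqrt (3 * ((1 / 2 / 2)\<^sup>2 * 0))"
        by (intro tendsto_intros S_lim) simp_all
      then have bound_lim: "(\<lambda>i. 4 * t\<^sup>2 * sqrt (3 * ((S i / 2)\<^sup>2 * ((2 * S i - 1)\<^sup>2 * I4 (S i))))) \<longlonglongrightarrow> 0"
        by simp
      have "(\<lambda>i. expectation (\<lambda>\<omega>. iexp (t * ?X (S i) \<omega>)) - exp (- (rosenblatt_sqnorm (S i) f / 2 * t\<^sup>2))) \<longlonglongrightarrow> 0"
        by (rule Lim_null_comparison[OF _ bound_lim]) (intro always_eventually allI X_char S')
      from tendsto_add[OF this exp_lim]
      show "(\<lambda>i. char (distr M borel (?X (S i))) t) \<longlonglongrightarrow> char (normal_law 0 \<sigma>sq) t"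
        unfolding char_eq char_normal_law[OF \<open>\<sigma>sq \<ge> 0\<close>] by simp
    qed
    with x show "(\<lambda>i. cdf (distr M borel (?X (S i))) x) \<longlonglongrightarrow> cdf (normal_law 0 \<sigma>sq) x"
      unfolding weak_conv_m_def weak_conv_def by blast
  qed
qed

end
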